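(* Let $\{\mathbf{x}_k\}$ be generated by the zeroth-order scheme VRG-ZO described in the context, under the assumptions stated there. Let $a>0$ be an arbitrary scalar, $\lambda\in(0,1)$, and for an integer $K\geq 1$ let $\ell:=\lceil\lambda K\rceil$. (a) [Constant step] Let $\gamma_k:=\gamma$ with $0<\gamma<\frac{\eta}{\sqrt{n}L_0}$ and $N_k:=\lceil a\sqrt{n}L_0(k+1)\rceil$ for $k\ge0$. (a-i) For $K>\frac{2}{1-\lambda}$, $$\mathbb{E}\left[\|G_{\eta,1/\gamma}(\mathbf{x}_{R_{\ell,K}})\|^2\right]\le\frac{\mathbb{E}[f(\mathbf{x}_\ell)]-f^*+2L_0\eta+16\sqrt{n}\sqrt{2\pi}\,L_0\,(0.5-\ln\lambda)\,a^{-1}\gamma}{\left(1-\frac{\sqrt{n}L_0\gamma}{\eta}\right)\frac{\gamma}{4}(1-\lambda)K}.$$ (a-ii) Let $\gamma=\frac{\eta}{2\sqrt{n}L_0}$, $\epsilon>0$, and let $K_\epsilon$ be a number of iterations ensuring $\mathbb{E}\left[\|G_{\eta,1/\gamma}(\mathbf{x}_{R_{\ell,K_\epsilon}})\|\right]\le\epsilon$ (with $\ell=\lceil\lambda K_\epsilon\rceil$). Then this is achieved with: (a-ii-1) a total number of projection steps $K_\epsilon=\mathcal{O}\left(n^{1/2}(L_0\eta^{-1}+L_0^2)\epsilon^{-2}\right)$; (a-ii-2) an overall sample complexity $\sum_{k=0}^{K_\epsilon}N_k=\mathcal{O}\left(n^{3/2}(L_0^3\eta^{-2}+L_0^5)\epsilon^{-4}\right)$.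 (b) [Diminishing step] Let $\gamma_k=\frac{\gamma_0}{\sqrt{k+1}}$ and $N_k:=\lceil a\sqrt{n}L_0\sqrt{k+1}\rceil$ for $k\ge 0$, where $0<\gamma_0<\frac{\eta}{\sqrt{n}L_0}$. (b-i) For $K>\frac{2}{1-\lambda}$, $$\mathbb{E}\left[\|G_{\eta,1/\gamma_0}(\mathbf{x}_{R_{\ell,K}})\|^2\right]\le\frac{\mathbb{E}[f(\mathbf{x}_\ell)]-f^*+2L_0\eta+16\sqrt{2\pi}\,L_0\sqrt{n}\,(0.5-\ln\lambda)\,a^{-1}\gamma_0}{\left(1-\frac{\sqrt{n}L_0\gamma_0}{\eta}\right)\frac{\gamma_0}{2}(1-\sqrt{\lambda})\sqrt{K}}.$$ (b-ii) Let $\epsilon>0$ and let $K_\epsilon$ be a number of iterations ensuring $\mathbb{E}\left[\|G_{\eta,1/\gamma_0}(\mathbf{x}_{R_{\ell,K_\epsilon}})\|\right]\le\epsilon$. Then this is achieved with: (b-ii-1) a total number of projection steps $K_\epsilon=\mathcal{O}\left(n(L_0^2\eta^{-2}+L_0^4)\epsilon^{-4}\right)$; (b-ii-2) a total sample complexity $\sum_{k=0}^{K_\epsilon}N_k=\mathcal{O}\left(n^{2}(L_0^4\eta^{-3}+L_0^7)\epsilon^{-6}\right)$.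
   Context: Problem and assumptions. $\boldsymbol{\xi}:\Omega\to\mathbb{R}^d$ is a random variable on a probability space $(\Omega,\mathcal{F},\mathbb{P})$, $\tilde f:\mathbb{R}^n\times\mathbb{R}^d\to\mathbb{R}$, and $f(\mathbf{x})=\mathbb{E}[\tilde f(\mathbf{x},\boldsymbol{\xi})]$ is to be minimized over $\mathcal{X}\subseteq\mathbb{R}^n$. $\mathbb{B}=\{u\in\mathbb{R}^n:\|u\|\le 1\}$ and $\mathbb{S}=\{v\in\mathbb{R}^n:\|v\|=1\}$. It is assumed that: (i) for some $\eta_0>0$, almost surely $\tilde f(\cdot,\boldsymbol{\xi})$ is $\tilde L_0(\boldsymbol{\xi})$-Lipschitz on $\mathcal{X}+\eta_0\mathbb{B}$, where $L_0:=\sqrt{\mathbb{E}[\tilde L_0(\boldsymbol{\xi})^2]}<\infty$; (ii) $\mathcal{X}$ is nonempty, closed and convex; (iii) $\mathbb{E}[\tilde f(\mathbf{x},\boldsymbol{\xi})\mid\mathbf{x}]=f(\mathbf{x})$ for all $\mathbf{x}\in\mathcal{X}+\eta_0\mathbb{B}$. The smoothing parameter satisfies $0<\eta\le\eta_0$, and $f^*:=\inf_{\mathbf{x}\in\mathcal{X}}f(\mathbf{x})$ is finite. Smoothing. $f_\eta(\mathbf{x}):=\mathbb{E}_{\mathbf{u}}[f(\mathbf{x}+\eta\mathbf{u})]$ with $\mathbf{u}$ uniformly distributed on $\mathbb{B}$; it is $C^1$ on $\mathcal{X}$. Algorithm VRG-ZO. Given $\mathbf{x}_0\in\mathcal{X}$,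 stepsizes $\gamma_k>0$ and batch sizes $N_k\ge 1$ (integers), for $k=0,1,2,\dots$: draw samples $\xi_{j,k}$ distributed as $\boldsymbol{\xi}$ and $v_{j,k}$ uniformly distributed on $\eta\mathbb{S}$, $j=1,\dots,N_k$, all random samples being generated independently of each other over all $k\ge 0$ and $1\le j\le N_k$; set $$g_\eta(\mathbf{x}_k,v_{j,k},\xi_{j,k})=\frac{n}{2\eta}\left(\tilde f(\mathbf{x}_k+v_{j,k},\xi_{j,k})-\tilde f(\mathbf{x}_k-v_{j,k},\xi_{j,k})\right)\frac{v_{j,k}}{\|v_{j,k}\|},\qquad g_{\eta,N_k}(\mathbf{x}_k)=\frac1{N_k}\sum_{j=1}^{N_k}g_\eta(\mathbf{x}_k,v_{j,k},\xi_{j,k}),$$ and $\mathbf{x}_{k+1}=\Pi_{\mathcal{X}}[\mathbf{x}_k-\gamma_k g_{\eta,N_k}(\mathbf{x}_k)]$, where $\Pi_{\mathcal{X}}$ is the Euclidean projection onto $\mathcal{X}$. Random output index. $R_{\ell,K}$ is a random integer, independent of the samples, taking values in $\{\ell,\dots,K-1\}$ with $\mathbb{P}[R_{\ell,K}=j]=\gamma_j/\sum_{i=\ell}^{K-1}\gamma_i$ (uniform for a constant stepsize). Expectations of quantities at $\mathbf{x}_{R_{\ell,K}}$ are over both the iterates and $R_{\ell,K}$. Residual. For $\beta>0$, $G_{\eta,\beta}(\mathbf{x}):=\beta\left(\mathbf{x}-\Pi_{\mathcal{X}}\left[\mathbf{x}-\frac1\beta\nabla f_\eta(\mathbf{x})\right]\right)$.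 Convention on $\mathcal{O}(\cdot)$. The estimates are for $\epsilon$ small and track the dependence on $n,L_0,\eta,\epsilon$; the hidden factor may depend on $a$, $\lambda$, $\eta_0$, on an upper bound for $\mathbb{E}[f(\mathbf{x}_\ell)]-f^*$ (treated as a constant), and in (b-ii) on the ratio $\sqrt{n}L_0\gamma_0/\eta\in(0,1)$. *)

theory Defs
  imports "HOL-Probability.Probability"
begin

section \<open>Problem data\<close>

definition obj :: "'w measure \<Rightarrow> ('w \<Rightarrow> real^'d) \<Rightarrow> (real^'n \<Rightarrow> real^'d \<Rightarrow> real) \<Rightarrow> real^'n \<Rightarrow> real" where
  "obj P xi ft x = (\<integral>w. ft x (xi w) \<partial>P)"

text \<open>Joint Borel measurability of the integrand (and of the Lipschitz modulus) is what makes the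
  expectations along the random iterates meaningful. As the objective is by definition the
  expectation of the integrand, unbiasedness of the samples at the points of
  \<open>X + cball 0 eta0\<close> amounts to integrability there. The almost sure Lipschitz property is stated for almost all
  realisations of \<open>xi\<close>, that is with respect to its law, so that it carries over to all samples
  with that law.\<close>

definition zo_problem ::
  "'w measure \<Rightarrow> ('w \<Rightarrow> real^'d) \<Rightarrow> (real^'n) set \<Rightarrow> (real^'n \<Rightarrow> real^'d \<Rightarrow> real)
    \<Rightarrow> (real^'d \<Rightarrow> real) \<Rightarrow> real \<Rightarrow> bool" where
  "zo_problem P xi X ft Lt eta0 \<longleftrightarrow>
     prob_space P \<and> xi \<in> borel_measurable P \<and>
     (\<lambda>(x, z). ft x z) \<in> borel_measurable (borel \<Otimes>\<^sub>M borel) \<and>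
     Lt \<in> borel_measurable borel \<and>
     0 < eta0 \<and>
     (AE z in distr P borel xi. (Lt z)-lipschitz_on (X + cball 0 eta0) (\<lambda>x. ft x z)) \<and>
     integrable P (\<lambda>w. (Lt (xi w))\<^sup>2) \<and>
     X \<noteq> {} \<and> closed X \<and> convex X \<and>
     (\<forall>x \<in> X + cball 0 eta0. integrable P (\<lambda>w. ft x (xi w))) \<and>
     bdd_below (obj P xi ft ` X)"


section \<open>Smoothing and residual\<close>

definition smoothed :: "(real^'n \<Rightarrow> real) \<Rightarrow> real \<Rightarrow> real^'n \<Rightarrow> real" where
  "smoothed f eta x = (\<integral>u. f (x + eta *\<^sub>R u) \<partial>(uniform_measure lborel (cball 0 1)))"

text \<open>The ordinary gradient wherever \<open>F\<close> is differentiable. For \<open>x \<in> X\<close> and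
  \<open>F = smoothed f eta\<close> with \<open>eta < eta0\<close> this is always the case. For \<open>eta = eta0\<close>
  the values of \<open>F\<close> near \<open>x\<close> but outside \<open>X\<close> involve \<open>f\<close> outside \<open>X + cball 0 eta0\<close>, where
  nothing is assumed; then the derivative of \<open>F\<close> relative to \<open>X\<close> is used. It always exists at
  points of \<open>X\<close>, is unique up to vectors orthogonal to \<open>X - X\<close> (\<open>X\<close> being convex), and such
  vectors do not affect the residual below.\<close>

definition gradient_on :: "(real^'n) set \<Rightarrow> (real^'n \<Rightarrow> real) \<Rightarrow> real^'n \<Rightarrow> real^'n" where
  "gradient_on X F x =
     (if F differentiable (at x)
      then (THE g. (F has_derivative (\<lambda>h. g \<bullet> h)) (at x))
      else (SOME g. (F has_derivative (\<lambda>h. g \<bullet> h)) (at x within X)))"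

definition residual ::
  "(real^'n) set \<Rightarrow> (real^'n \<Rightarrow> real) \<Rightarrow> real \<Rightarrow> real \<Rightarrow> real^'n \<Rightarrow> real^'n" where
  "residual X f eta beta x =
     beta *\<^sub>R (x - closest_point X (x - (1 / beta) *\<^sub>R gradient_on X (smoothed f eta) x))"


section \<open>The scheme VRG-ZO\<close>

text \<open>The uniform distribution on the sphere of radius \<open>r\<close> (normalised surface measure), as the
  radial projection of the uniform distribution on the ball; the centre, which is mapped
  to \<open>0\<close>, is a null set.\<close>

definition uniform_sphere :: "real \<Rightarrow> (real^'n) measure" where
  "uniform_sphere r =
     distr (uniform_measure lborel (cball 0 1)) borel (\<lambda>u. (r / norm u) *\<^sub>R u)"

definition zo_grad ::
  "(real^'n \<Rightarrow> real^'d \<Rightarrow> real) \<Rightarrow> real \<Rightarrow> real^'n \<Rightarrow> real^'n \<Rightarrow> real^'d \<Rightarrow> real^'n" where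
  "zo_grad ft eta x v z =
     (real CARD('n) / (2 * eta) * (ft (x + v) z - ft (x - v) z)) *\<^sub>R ((1 / norm v) *\<^sub>R v)"

text \<open>\<open>xis k j\<close> and \<open>vs k j\<close> are the \<open>j\<close>-th samples drawn at iteration \<open>k\<close>, \<open>1 \<le> j \<le> N k\<close>.\<close>

primrec iterate ::
  "(real^'n) set \<Rightarrow> (real^'n \<Rightarrow> real^'d \<Rightarrow> real) \<Rightarrow> real \<Rightarrow> (nat \<Rightarrow> real) \<Rightarrow> (nat \<Rightarrow> nat) \<Rightarrow> real^'n
    \<Rightarrow> (nat \<Rightarrow> nat \<Rightarrow> 's \<Rightarrow> real^'d) \<Rightarrow> (nat \<Rightarrow> nat \<Rightarrow> 's \<Rightarrow> real^'n) \<Rightarrow> nat \<Rightarrow> 's \<Rightarrow> real^'n" where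
  "iterate X ft eta gam N x0 xis vs 0 = (\<lambda>w. x0)"
| "iterate X ft eta gam N x0 xis vs (Suc k) = (\<lambda>w.
     let x = iterate X ft eta gam N x0 xis vs k w in
     closest_point X (x - gam k *\<^sub>R
       ((1 / real (N k)) *\<^sub>R (\<Sum>j = 1..N k. zo_grad ft eta x (vs k j w) (xis k j w)))))"

definition first_index :: "real \<Rightarrow> nat \<Rightarrow> nat" where
  "first_index lam K = nat \<lceil>lam * real K\<rceil>"

text \<open>The draws take values in different types, so their joint independence is expressed
  through the sigma-algebras that they generate.\<close>

datatype draw = Xi_draw nat nat | V_draw nat nat | Out_draw

fun draw_events ::
  "'s measure \<Rightarrow> (nat \<Rightarrow> nat \<Rightarrow> 's \<Rightarrow> real^'d) \<Rightarrow> (nat \<Rightarrow> nat \<Rightarrow> 's \<Rightarrow> real^'n) \<Rightarrow> ('s \<Rightarrow> nat)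
    \<Rightarrow> draw \<Rightarrow> 's set set" where
  "draw_events M xis vs R (Xi_draw k j) = sets (vimage_algebra (space M) (xis k j) borel)"
| "draw_events M xis vs R (V_draw k j) = sets (vimage_algebra (space M) (vs k j) borel)"
| "draw_events M xis vs R Out_draw = sets (vimage_algebra (space M) R (count_space UNIV))"

definition sample_draws :: "(nat \<Rightarrow> nat) \<Rightarrow> draw set" where
  "sample_draws N = {Xi_draw k j | k j. 1 \<le> j \<and> j \<le> N k} \<union> {V_draw k j | k j. 1 \<le> j \<and> j \<le> N k}"

text \<open>\<open>R\<close> is the random output index for the window \<open>{first_index lam K..<K}\<close>.\<close>

definition output_index ::
  "'s measure \<Rightarrow> (nat \<Rightarrow> real) \<Rightarrow> (nat \<Rightarrow> nat) \<Rightarrow> real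
    \<Rightarrow> (nat \<Rightarrow> nat \<Rightarrow> 's \<Rightarrow> real^'d) \<Rightarrow> (nat \<Rightarrow> nat \<Rightarrow> 's \<Rightarrow> real^'n) \<Rightarrow> nat \<Rightarrow> ('s \<Rightarrow> nat) \<Rightarrow> bool" where
  "output_index M gam N lam xis vs K R \<longleftrightarrow>
     R \<in> measurable M (count_space UNIV) \<and>
     (\<forall>w \<in> space M. R w \<in> {first_index lam K..<K}) \<and>
     (\<forall>j \<in> {first_index lam K..<K}.
        measure M {w \<in> space M. R w = j} = gam j / (\<Sum>i = first_index lam K..<K. gam i)) \<and>
     prob_space.indep_sets M (draw_events M xis vs R) (insert Out_draw (sample_draws N))"

text \<open>The randomness of one run, on a probability space \<open>M\<close>, with one output index \<open>R K\<close> for each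
  \<open>K\<close> whose window is nonempty. (The indices \<open>R K\<close> for different \<open>K\<close> need not be independent of
  each other.)\<close>

definition vrg_zo_run ::
  "'w measure \<Rightarrow> ('w \<Rightarrow> real^'d) \<Rightarrow> real \<Rightarrow> 's measure \<Rightarrow> (nat \<Rightarrow> real) \<Rightarrow> (nat \<Rightarrow> nat) \<Rightarrow> real
    \<Rightarrow> (nat \<Rightarrow> nat \<Rightarrow> 's \<Rightarrow> real^'d) \<Rightarrow> (nat \<Rightarrow> nat \<Rightarrow> 's \<Rightarrow> real^'n) \<Rightarrow> (nat \<Rightarrow> 's \<Rightarrow> nat) \<Rightarrow> bool" where
  "vrg_zo_run P xi eta M gam N lam xis vs R \<longleftrightarrow>
     prob_space M \<and>
     (\<forall>k. 0 < gam k \<and> 1 \<le> N k) \<and>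
     (\<forall>k. \<forall>j \<in> {1..N k}.
        xis k j \<in> borel_measurable M \<and> distr M borel (xis k j) = distr P borel xi \<and>
        vs k j \<in> borel_measurable M \<and> distr M borel (vs k j) = uniform_sphere eta) \<and>
     (\<forall>K. first_index lam K < K \<longrightarrow> output_index M gam N lam xis vs K (R K))"


section \<open>Hidden factors of the complexity estimates\<close>

text \<open>The dimension is the cardinality of a type, and an existential quantifier for the hidden
  factor could not be placed in front of the quantification over types. The factors are
  therefore given as functions of the quantities on which they may depend, which exclude the
  dimension; \<open>D\<close> is an upper bound for \<open>E[f(x_l)] - f*\<close> and \<open>r = sqrt n * L0 * gamma_0 / eta\<close>.
  They arise from requiring that the bounds on the mean squared residual be at most \<open>eps\<^sup>2\<close>,
  using \<open>L0 \<le> eta0 * (L0 / eta)\<close>.\<close>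

definition factor_const :: "real \<Rightarrow> real \<Rightarrow> real \<Rightarrow> real \<Rightarrow> real" where
  "factor_const a lam eta0 D =
     32 / (1 - lam) * (2 + D + 8 * sqrt (2 * pi) * (1/2 - ln lam) * eta0 / a)"

definition factor_dim :: "real \<Rightarrow> real \<Rightarrow> real \<Rightarrow> real \<Rightarrow> real \<Rightarrow> real" where
  "factor_dim a lam eta0 D r =
     6 / (r * (1 - r) * (1 - sqrt lam)) *
       (2 + D + 16 * sqrt (2 * pi) * (1/2 - ln lam) * eta0 / a)"

text \<open>The meaning of ``for small \<open>eps\<close>''. Some restriction is needed because \<open>K\<close> and all the
  batch sizes are integers \<open>\<ge> 1\<close>, while the orders tend to \<open>0\<close> as \<open>L0\<close> does. Both
  right-hand sides increase with \<open>n\<close> and decrease with \<open>eta\<close>, so for fixed \<open>L0\<close> one threshold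
  for \<open>eps\<close> serves all dimensions and all \<open>eta \<le> eta0\<close>.\<close>

definition small_eps :: "real \<Rightarrow> real \<Rightarrow> real \<Rightarrow> real \<Rightarrow> bool" where
  "small_eps n L0 eta eps \<longleftrightarrow>
     eps\<^sup>2 \<le> sqrt n * (L0 / eta + L0\<^sup>2) \<and> eps\<^sup>2 \<le> n * L0 * (L0 / eta + L0\<^sup>2)"

end

theory Submission
  imports Defs
begin

text \<open>The smoothing of a globally \<open>L\<close>-Lipschitz function satisfies a Taylor estimate with gradient
  \<open>(n / \<eta>) E[F (x + \<eta> \<theta>) \<theta>]\<close>, \<open>\<theta>\<close> uniform on the unit sphere, and smoothness constant
  \<open>sqrt n L / \<eta>\<close>. It is obtained by differentiating a \<open>C\<^sup>1\<close> cutoff of the ball and letting the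
  width of the cutoff tend to \<open>0\<close>; the constant comes from \<open>E \<langle>\<theta>, h\<rangle>\<^sup>2 = |h|\<^sup>2 / n\<close>. Since the
  objective is controlled on \<open>X + \<eta>\<^sub>0 B\<close> only, it is replaced by a global Lipschitz extension,
  which changes neither the iterates nor the residual.

  The estimator has second moment at most \<open>\<pi>\<^sup>2 n L\<^sub>0\<^sup>2\<close>, because \<open>E (F \<theta> - F (- \<theta>))\<^sup>2 \<le> 4 \<pi>\<^sup>2 L\<^sup>2 / n\<close>:
  one joins \<open>x\<close> to \<open>- x\<close> by the rotation \<open>cos t x + sin t y\<close> with \<open>(x, y)\<close> uniform on the ball of
  \<open>\<real>\<^sup>n \<times> \<real>\<^sup>n\<close>, and at each time the velocity is conditionally rotation invariant. By independence the
  error \<open>e\<^sub>k\<close> of a batch of size \<open>N\<^sub>k\<close> satisfies \<open>E |e\<^sub>k|\<^sup>2 \<le> \<pi>\<^sup>2 n L\<^sub>0\<^sup>2 / N\<^sub>k\<close>.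

  The three-point inequality for projections turns the Taylor estimate into
  \<open>f\<^sub>\<eta> (x\<^sub>k\<^sub>+\<^sub>1) \<le> f\<^sub>\<eta> (x\<^sub>k) - \<gamma>\<^sub>k/2 |G (x\<^sub>k)|\<^sup>2 + \<gamma>\<^sub>k/2 |e\<^sub>k|\<^sup>2\<close>, which is summed over the window of the output
  index. The constants \<open>1/2\<close> matter: the window may have only \<open>(1 - \<lambda>) K / 2\<close> elements, and this
  factor has to be absorbed. For diminishing steps and short windows the sum of the steps is too
  small, but then the claimed bound exceeds \<open>L\<^sub>0\<^sup>2 \<ge> |G|\<^sup>2\<close>.\<close>

subsection \<open>Rotation invariant measures and the sphere\<close>

text \<open>The two halves meet in one inequality: the step-size condition says that the smoothness
  constant \<open>sqrt n * L / eta\<close> is at most \<open>1 / gamma\<close>. The quadratic Taylor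
  term is then swallowed by the term \<open>- |x' - x|^2 / (2 * gamma)\<close> which the three-point
  inequality supplies for the actual step \<open>x'\<close>, and no part of the residual is spent on
  it; the factor \<open>1 - sqrt n * L0 * gamma / eta\<close> of the claimed denominators is simply
  given away. The delicate point is the power of the dimension in the noise. A pointwise bound of
  the estimator gives \<open>n * Lt\<close>, hence a variance of order \<open>n^2\<close>, while
  batches proportional to \<open>sqrt n\<close> pay only for order \<open>n\<close>. As the function
  is merely Lipschitz, the path argument that gains the missing factor is run on its smoothings,
  whose gradient bound is free of the dimension, and transferred by Fatou's lemma. For the iterates
  no conditional expectation is formed: the joint law of the past and one fresh sample is a product,
  and Fubini reduces every expectation to an estimate at a fixed point of \<open>X\<close>.\<close>

abbreviation uball :: "(real^'n) measure" where
  "uball \<equiv> uniform_measure lborel (cball 0 1)"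

lemma emeasure_cball_pos_finite:
  "emeasure lborel (cball (0::'a::euclidean_space) 1) \<noteq> 0" "emeasure lborel (cball (0::'a) 1) < \<infinity>"
proof -
  show "emeasure lborel (cball (0::'a) 1) < \<infinity>"
    by (simp add: emeasure_cball)
  show "emeasure lborel (cball (0::'a) 1) \<noteq> 0"
    using Gamma_real_pos[of "DIM('a) / 2 + 1"]
    by (simp add: emeasure_cball unit_ball_vol_def add_nonneg_pos less_imp_neq[symmetric])
qed

lemma prob_space_uball: "prob_space (uball :: (real^'n) measure)"
  using emeasure_cball_pos_finite[where 'a="real^'n"] by (intro prob_space_uniform_measure) auto

lemma AE_uball: "AE u in (uball :: (real^'n) measure). u \<noteq> 0 \<and> norm u \<le> 1"
proof -
  have "AE u in lborel. u \<noteq> (0::real^'n)"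
    by (rule AE_lborel_singleton)
  then show ?thesis
    by (subst AE_uniform_measure) (use emeasure_cball_pos_finite[where 'a="real^'n"] in auto)
qed

definition rotation_invariant :: "(real^'n) measure \<Rightarrow> bool" where
  "rotation_invariant N \<longleftrightarrow>
     sets N = sets borel \<and> (\<forall>f. orthogonal_transformation f \<longrightarrow> distr N borel f = N)"

lemma orthogonal_transformation_measurable:
  fixes f :: "real^'n \<Rightarrow> real^'n"
  assumes "orthogonal_transformation f"
  shows "f \<in> borel_measurable borel"
  by (intro borel_measurable_continuous_onI linear_continuous_on)
     (simp add: assms linear_conv_bounded_linear[symmetric] orthogonal_transformation_linear)

lemma nn_integral_lborel_translate:
  fixes h :: "'a::euclidean_space \<Rightarrow> ennreal"
  assumes [measurable]: "h \<in> borel_measurable borel"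
  shows "(\<integral>\<^sup>+x. h (a + x) \<partial>lborel) = (\<integral>\<^sup>+x. h x \<partial>lborel)"
proof -
  have "(\<integral>\<^sup>+x. h x \<partial>lborel) = (\<integral>\<^sup>+x. h x \<partial>distr lborel borel ((+) a))"
    by (simp add: lborel_distr_plus)
  then show ?thesis by (simp add: nn_integral_distr)
qed

lemma nn_integral_lborel_reflect:
  fixes h :: "'a::euclidean_space \<Rightarrow> ennreal"
  assumes [measurable]: "h \<in> borel_measurable borel"
  shows "(\<integral>\<^sup>+x. h (a - x) \<partial>lborel) = (\<integral>\<^sup>+x. h x \<partial>lborel)"
  by (subst (2) lborel_affine[of "-1" a]) (simp_all add: nn_integral_density nn_integral_distr)

text \<open>A translation invariant measure is determined by the mass of one ball, by Tonelli; applied to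
  the image of Lebesgue measure under an isometry.\<close>

lemma nn_integral_lborel_orthogonal:
  fixes f :: "'a::euclidean_space \<Rightarrow> 'a"
  assumes f: "orthogonal_transformation f" and h[measurable]: "h \<in> borel_measurable borel"
  shows "(\<integral>\<^sup>+x. h (f x) \<partial>lborel) = (\<integral>\<^sup>+x. h x \<partial>lborel)"
proof -
  have lin: "linear f" using f by (rule orthogonal_transformation_linear)
  have fm[measurable]: "f \<in> borel_measurable borel"
    by (intro borel_measurable_continuous_onI linear_continuous_on)
       (simp add: lin linear_conv_bounded_linear[symmetric])
  define g where "g = inv f"
  have fg: "f (g y) = y" for y
    unfolding g_def by (rule surj_f_inv_f[OF orthogonal_transformation_surj[OF f]])
  let ?B = "indicator (cball 0 1) :: 'a \<Rightarrow> ennreal"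
  let ?v = "emeasure lborel (cball (0::'a) 1)"
  have [measurable]: "cball (0::'a) 1 \<in> sets borel" by simp
  have "(\<integral>\<^sup>+x. h (f x) \<partial>lborel) * ?v = (\<integral>\<^sup>+x. h (f x) * (\<integral>\<^sup>+y. ?B (f x + y) \<partial>lborel) \<partial>lborel)"
    by (simp add: nn_integral_lborel_translate nn_integral_multc)
  also have "\<dots> = (\<integral>\<^sup>+x. (\<integral>\<^sup>+y. h (f x) * ?B (f x + y) \<partial>lborel) \<partial>lborel)"
    by (intro nn_integral_cong nn_integral_cmult[symmetric]) measurable
  also have "\<dots> = (\<integral>\<^sup>+y. (\<integral>\<^sup>+x. h (f x) * ?B (f x + y) \<partial>lborel) \<partial>lborel)"
    by (rule lborel_pair.Fubini') measurable
  \<comment> \<open>Shifting \<open>x\<close> by the preimage of \<open>y\<close> moves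
    \<open>y\<close> from the ball into the argument of \<open>h\<close>. After one more exchange
    the inner integral of \<open>h\<close> no longer depends on \<open>x\<close>, and what remains
    is the ball, which \<open>f\<close> preserves.\<close>
  also have "\<dots> = (\<integral>\<^sup>+y. (\<integral>\<^sup>+x. h (f x - y) * ?B (f x) \<partial>lborel) \<partial>lborel)"
  proof (rule nn_integral_cong)
    fix y
    have "(\<integral>\<^sup>+x. h (f (- g y + x)) * ?B (f (- g y + x) + y) \<partial>lborel) = (\<integral>\<^sup>+x. h (f x) * ?B (f x + y) \<partial>lborel)"
      by (rule nn_integral_lborel_translate) measurable
    moreover have "f (- g y + x) = f x - y" for x
      using linear_diff[OF lin, of x "g y"] by (simp add: fg)
    ultimately show "(\<integral>\<^sup>+x. h (f x) * ?B (f x + y) \<partial>lborel) = (\<integral>\<^sup>+x. h (f x - y) * ?B (f x) \<partial>lborel)"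
      by simp
  qed
  also have "\<dots> = (\<integral>\<^sup>+x. (\<integral>\<^sup>+y. h (f x - y) * ?B (f x) \<partial>lborel) \<partial>lborel)"
    by (rule lborel_pair.Fubini') measurable
  also have "\<dots> = (\<integral>\<^sup>+x. (\<integral>\<^sup>+y. h y \<partial>lborel) * ?B x \<partial>lborel)"
    by (intro nn_integral_cong)
       (simp add: nn_integral_multc nn_integral_lborel_reflect orthogonal_transformation_norm[OF f] indicator_def)
  also have "\<dots> = (\<integral>\<^sup>+y. h y \<partial>lborel) * ?v"
    by (simp add: nn_integral_cmult)
  finally show ?thesis
    using emeasure_cball_pos_finite[where 'a='a]
    by (metis infinity_ennreal_def less_irrefl mult_divide_eq_ennreal)
qed

lemma rotation_invariant_lborel: "rotation_invariant (lborel :: (real^'n) measure)"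
  unfolding rotation_invariant_def
proof (intro conjI allI impI)
  fix f :: "real^'n \<Rightarrow> real^'n" assume f: "orthogonal_transformation f"
  have fm[measurable]: "f \<in> borel_measurable borel"
    using f by (rule orthogonal_transformation_measurable)
  show "distr lborel borel f = lborel"
  proof (rule measure_eqI)
    fix A assume "A \<in> sets (distr lborel borel f)"
    then have [measurable]: "A \<in> sets borel" by simp
    have "(\<integral>\<^sup>+x. indicator A x \<partial>distr lborel borel f) = (\<integral>\<^sup>+x. indicator A (f x) \<partial>lborel)"
      by (rule nn_integral_distr) measurable
    also have "\<dots> = (\<integral>\<^sup>+x. indicator A x \<partial>lborel)"
      by (rule nn_integral_lborel_orthogonal[OF f]) measurable
    finally show "emeasure (distr lborel borel f) A = emeasure lborel A" by simp
  qed simp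
qed simp

lemma rotation_invariant_density:
  fixes N :: "(real^'n) measure"
  assumes N: "rotation_invariant N" and w[measurable]: "w \<in> borel_measurable borel"
    and wf: "\<And>f x. orthogonal_transformation f \<Longrightarrow> w (f x) = w x"
  shows "rotation_invariant (density N w)"
  unfolding rotation_invariant_def
proof (intro conjI allI impI)
  have sN[measurable_cong]: "sets N = sets borel" using N by (simp add: rotation_invariant_def)
  show "sets (density N w) = sets borel" by (simp add: sN)
  fix f :: "real^'n \<Rightarrow> real^'n" assume f: "orthogonal_transformation f"
  have fm[measurable]: "f \<in> borel_measurable borel"
    using f by (rule orthogonal_transformation_measurable)
  have "density N w = density (distr N borel f) w"
    using N f by (simp add: rotation_invariant_def)
  also have "\<dots> = distr (density N (\<lambda>x. w (f x))) borel f"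
    by (rule density_distr) measurable
  finally show "distr (density N w) borel f = density N w"
    unfolding wf[OF f] by (rule sym)
qed

lemma rotation_invariant_distr:
  fixes N :: "(real^'n) measure"
  assumes N: "rotation_invariant N" and g[measurable]: "g \<in> borel_measurable borel"
    and gf: "\<And>f x. orthogonal_transformation f \<Longrightarrow> g (f x) = f (g x)"
  shows "rotation_invariant (distr N borel g)"
  unfolding rotation_invariant_def
proof (intro conjI allI impI)
  have sN[measurable_cong]: "sets N = sets borel" using N by (simp add: rotation_invariant_def)
  show "sets (distr N borel g) = sets borel" by simp
  fix f :: "real^'n \<Rightarrow> real^'n" assume f: "orthogonal_transformation f"
  have fm[measurable]: "f \<in> borel_measurable borel"
    using f by (rule orthogonal_transformation_measurable)
  have "distr (distr N borel g) borel f = distr N borel (\<lambda>x. g (f x))"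
    by (subst distr_distr) (auto simp: o_def gf[OF f])
  also have "\<dots> = distr (distr N borel f) borel g"
    by (subst distr_distr) (auto simp: o_def)
  finally show "distr (distr N borel g) borel f = distr N borel g"
    using N f by (simp add: rotation_invariant_def)
qed

lemma sgn_measurable[measurable]: "(sgn :: real^'n \<Rightarrow> real^'n) \<in> borel_measurable borel"
  unfolding sgn_div_norm by measurable

lemma rotation_invariant_uball: "rotation_invariant (uball :: (real^'n) measure)"
  unfolding uniform_measure_def
  by (intro rotation_invariant_density rotation_invariant_lborel)
     (auto simp: indicator_def orthogonal_transformation)

text \<open>Normalised surface measure of the unit sphere. It is written with \<open>sgn\<close>,
  which commutes with linear isometries and so passes their invariance on; spheres of other radii
  are scalings of this one (\<open>uniform_sphere_eq\<close>).\<close>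

definition sphere_measure :: "(real^'n) measure" where
  "sphere_measure = distr uball borel sgn"

lemma rotation_invariant_sphere: "rotation_invariant (sphere_measure :: (real^'n) measure)"
  unfolding sphere_measure_def
  by (intro rotation_invariant_distr rotation_invariant_uball)
     (auto simp: sgn_div_norm orthogonal_transformation linear_cmul)

lemma sets_sphere_measure[measurable_cong, simp]: "sets (sphere_measure :: (real^'n) measure) = sets borel"
  by (simp add: sphere_measure_def)

lemma space_sphere_measure[simp]: "space (sphere_measure :: (real^'n) measure) = UNIV"
  by (simp add: sphere_measure_def)

lemma prob_space_sphere: "prob_space (sphere_measure :: (real^'n) measure)"
  unfolding sphere_measure_def by (intro prob_space.prob_space_distr prob_space_uball) simp

lemma AE_sphere_measure: "AE t in (sphere_measure :: (real^'n) measure). norm t = 1"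
  unfolding sphere_measure_def
  by (subst AE_distr_iff) (use AE_uball[where 'n='n] in \<open>auto simp: norm_sgn\<close>)

lemma rotation_invariant_nn_integral:
  assumes N: "rotation_invariant N" and f: "orthogonal_transformation f"
    and k[measurable]: "k \<in> borel_measurable borel"
  shows "(\<integral>\<^sup>+x. k (f x) \<partial>N) = (\<integral>\<^sup>+x. k x \<partial>N)"
proof -
  have fm[measurable]: "f \<in> borel_measurable borel"
    using f by (rule orthogonal_transformation_measurable)
  have sN[measurable_cong]: "sets N = sets borel" using N by (simp add: rotation_invariant_def)
  have "(\<integral>\<^sup>+x. k x \<partial>N) = (\<integral>\<^sup>+x. k x \<partial>distr N borel f)"
    using N f by (simp add: rotation_invariant_def)
  also have "\<dots> = (\<integral>\<^sup>+x. k (f x) \<partial>N)"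
    by (rule nn_integral_distr) (auto simp: sN)
  finally show ?thesis by simp
qed

text \<open>By invariance the second moment is the same in the direction of every unit vector, and
  over an orthonormal basis these moments add up to that of the norm. Stated in
  \<open>ennreal\<close>, so that it also applies to unnormalised densities, such as the slices of
  the ball of the product space.\<close>

lemma rotation_invariant_second_moment:
  fixes h :: "real^'n"
  assumes N: "rotation_invariant N"
  shows "of_nat CARD('n) * (\<integral>\<^sup>+x. ennreal ((h \<bullet> x)\<^sup>2) \<partial>N)
    = ennreal ((norm h)\<^sup>2) * (\<integral>\<^sup>+x. ennreal ((norm x)\<^sup>2) \<partial>N)"
proof -
  have sN[measurable_cong]: "sets N = sets borel" using N by (simp add: rotation_invariant_def)
  have unit: "(\<integral>\<^sup>+x. ennreal ((a \<bullet> x)\<^sup>2) \<partial>N) = (\<integral>\<^sup>+x. ennreal ((b \<bullet> x)\<^sup>2) \<partial>N)"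
    if ab: "norm a = 1" "norm b = 1" for a b
  proof -
    obtain f where f: "orthogonal_transformation f" "f a = b"
      using orthogonal_transformation_exists_1[OF ab] .
    have "(\<integral>\<^sup>+x. ennreal ((b \<bullet> x)\<^sup>2) \<partial>N) = (\<integral>\<^sup>+x. ennreal ((f a \<bullet> f x)\<^sup>2) \<partial>N)"
      unfolding f(2)
      by (rule rotation_invariant_nn_integral[OF N f(1), symmetric]) measurable
    also have "\<dots> = (\<integral>\<^sup>+x. ennreal ((a \<bullet> x)\<^sup>2) \<partial>N)"
      using f(1) by (simp add: orthogonal_transformation_def)
    finally show ?thesis by simp
  qed
  have norm2: "of_nat CARD('n) * (\<integral>\<^sup>+x. ennreal ((a \<bullet> x)\<^sup>2) \<partial>N) = (\<integral>\<^sup>+x. ennreal ((norm x)\<^sup>2) \<partial>N)"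
    if a: "norm a = 1" for a :: "real^'n"
  proof -
    have "(\<integral>\<^sup>+x. ennreal ((norm x)\<^sup>2) \<partial>N) = (\<integral>\<^sup>+x. (\<Sum>b\<in>Basis. ennreal ((b \<bullet> x)\<^sup>2)) \<partial>N)"
    proof (intro nn_integral_cong)
      fix x :: "real^'n"
      have "(norm x)\<^sup>2 = (\<Sum>b\<in>Basis. (b \<bullet> x)\<^sup>2)"
        unfolding power2_norm_eq_inner
        by (subst euclidean_inner) (simp only: inner_commute power2_eq_square)
      then show "ennreal ((norm x)\<^sup>2) = (\<Sum>b\<in>Basis. ennreal ((b \<bullet> x)\<^sup>2))"
        by (simp only: sum_ennreal zero_le_power2)
    qed
    also have "\<dots> = (\<Sum>b\<in>Basis. (\<integral>\<^sup>+x. ennreal ((b \<bullet> x)\<^sup>2) \<partial>N))"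
      by (rule nn_integral_sum) measurable
    also have "\<dots> = (\<Sum>b\<in>(Basis::(real^'n) set). (\<integral>\<^sup>+x. ennreal ((a \<bullet> x)\<^sup>2) \<partial>N))"
      by (intro sum.cong refl unit a) simp
    finally show ?thesis by simp
  qed
  have "h = norm h *\<^sub>R sgn h" by (cases "h = 0") (simp_all add: sgn_div_norm)
  then have hx: "h \<bullet> x = norm h * (sgn h \<bullet> x)" for x
    by (metis inner_scaleR_left)
  have "(\<integral>\<^sup>+x. ennreal ((h \<bullet> x)\<^sup>2) \<partial>N) = (\<integral>\<^sup>+x. ennreal ((norm h)\<^sup>2) * ennreal ((sgn h \<bullet> x)\<^sup>2) \<partial>N)"
    by (intro nn_integral_cong) (simp only: hx power_mult_distrib ennreal_mult zero_le_power2)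
  also have "\<dots> = ennreal ((norm h)\<^sup>2) * (\<integral>\<^sup>+x. ennreal ((sgn h \<bullet> x)\<^sup>2) \<partial>N)"
    by (rule nn_integral_cmult) measurable
  finally have "(\<integral>\<^sup>+x. ennreal ((h \<bullet> x)\<^sup>2) \<partial>N)
      = ennreal ((norm h)\<^sup>2) * (\<integral>\<^sup>+x. ennreal ((sgn h \<bullet> x)\<^sup>2) \<partial>N)" .
  then have "of_nat CARD('n) * (\<integral>\<^sup>+x. ennreal ((h \<bullet> x)\<^sup>2) \<partial>N)
      = ennreal ((norm h)\<^sup>2) * (of_nat CARD('n) * (\<integral>\<^sup>+x. ennreal ((sgn h \<bullet> x)\<^sup>2) \<partial>N))"
    by (simp only: mult.left_commute)
  also have "\<dots> = ennreal ((norm h)\<^sup>2) * (\<integral>\<^sup>+x. ennreal ((norm x)\<^sup>2) \<partial>N)"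
  proof (cases "h = 0")
    case False
    then show ?thesis by (subst norm2) (simp_all add: norm_sgn)
  qed simp
  finally show ?thesis .
qed

lemma sphere_second_moment:
  fixes h :: "real^'n"
  shows "integrable sphere_measure (\<lambda>t. (h \<bullet> t)\<^sup>2)"
    and "(\<integral>t. (h \<bullet> t)\<^sup>2 \<partial>sphere_measure) = (norm h)\<^sup>2 / CARD('n)"
proof -
  interpret prob_space "sphere_measure :: (real^'n) measure" by (rule prob_space_sphere)
  have "(\<integral>\<^sup>+x. ennreal ((norm x)\<^sup>2) \<partial>(sphere_measure :: (real^'n) measure)) = (\<integral>\<^sup>+x. 1 \<partial>(sphere_measure :: (real^'n) measure))"
    by (intro nn_integral_cong_AE) (use AE_sphere_measure in eventually_elim, simp)
  also have "\<dots> = 1" using emeasure_space_1 by simp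
  finally have e: "(\<integral>\<^sup>+x. ennreal ((norm x)\<^sup>2) \<partial>(sphere_measure :: (real^'n) measure)) = 1" .
  have m: "of_nat CARD('n) * (\<integral>\<^sup>+x. ennreal ((h \<bullet> x)\<^sup>2) \<partial>sphere_measure) = ennreal ((norm h)\<^sup>2)"
    using rotation_invariant_second_moment[OF rotation_invariant_sphere, of h]
    by (simp only: e mult_1_right)
  show i: "integrable sphere_measure (\<lambda>t. (h \<bullet> t)\<^sup>2)"
  proof (rule integrable_const_bound[where B="(norm h)\<^sup>2"])
    show "AE t in sphere_measure. norm ((h \<bullet> t)\<^sup>2) \<le> (norm h)\<^sup>2"
      using AE_sphere_measure
    proof eventually_elim
      case (elim t)
      then have "\<bar>h \<bullet> t\<bar> \<le> norm h" using Cauchy_Schwarz_ineq2[of h t] by simp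
      from power_mono[OF this, of 2] show ?case by simp
    qed
  qed measurable
  have "ennreal (CARD('n) * (\<integral>t. (h \<bullet> t)\<^sup>2 \<partial>sphere_measure)) = ennreal ((norm h)\<^sup>2)"
  proof -
    have "ennreal (CARD('n) * (\<integral>t. (h \<bullet> t)\<^sup>2 \<partial>sphere_measure))
        = of_nat CARD('n) * ennreal (\<integral>t. (h \<bullet> t)\<^sup>2 \<partial>sphere_measure)"
      by (simp add: ennreal_mult ennreal_of_nat_eq_real_of_nat)
    also have "ennreal (\<integral>t. (h \<bullet> t)\<^sup>2 \<partial>sphere_measure) = (\<integral>\<^sup>+x. ennreal ((h \<bullet> x)\<^sup>2) \<partial>sphere_measure)"
      by (rule nn_integral_eq_integral[OF i, symmetric]) simp
    finally show ?thesis unfolding m .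
  qed
  then have "CARD('n) * (\<integral>t. (h \<bullet> t)\<^sup>2 \<partial>sphere_measure) = (norm h)\<^sup>2"
    by (subst (asm) ennreal_inj) auto
  then show "(\<integral>t. (h \<bullet> t)\<^sup>2 \<partial>sphere_measure) = (norm h)\<^sup>2 / CARD('n)"
    by (simp add: field_simps)
qed

text \<open>Polar coordinates: norm and direction separate. The radial law weighted by
  \<open>k\<close> of the direction (\<open>M1\<close>) and the plain radial law times the mean of
  \<open>k\<close> (\<open>M2\<close>) both scale like \<open>r^n\<close> on balls and agree on the
  unit ball, hence they coincide. The bound on \<open>k\<close> keeps the masses of balls finite, as
  the uniqueness of measures demands.\<close>

lemma polar_nn_integral_bounded:
  fixes k :: "real^'n \<Rightarrow> ennreal" and w :: "real \<Rightarrow> ennreal"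
  assumes k[measurable]: "k \<in> borel_measurable borel" and kb: "\<And>x. k x \<le> 1"
    and w[measurable]: "w \<in> borel_measurable borel"
  shows "(\<integral>\<^sup>+u. w (norm u) * k (sgn u) \<partial>lborel)
    = (\<integral>\<^sup>+u. w (norm (u::real^'n)) \<partial>lborel) * (\<integral>\<^sup>+t. k t \<partial>sphere_measure)"
proof -
  let ?c = "\<integral>\<^sup>+t. k t \<partial>sphere_measure"
  let ?v = "emeasure lborel (cball (0::real^'n) 1)"
  define M1 where "M1 = distr (density lborel (\<lambda>u. k (sgn u))) borel (norm :: real^'n \<Rightarrow> real)"
  define M2 where "M2 = scale_measure ?c (distr lborel borel (norm :: real^'n \<Rightarrow> real))"
  have c1: "?c \<le> 1"
  proof -
    have "?c \<le> (\<integral>\<^sup>+t. 1 \<partial>(sphere_measure :: (real^'n) measure))" by (intro nn_integral_mono kb)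
    then show ?thesis by (simp add: prob_space.emeasure_space_1[OF prob_space_sphere, simplified])
  qed
  have A: "emeasure M1 {..r} = (\<integral>\<^sup>+u. indicator (cball 0 r) u * k (sgn u) \<partial>lborel)" for r
    unfolding M1_def
    by (subst emeasure_distr, measurable, subst emeasure_density, measurable)
       (auto intro!: nn_integral_cong simp: indicator_def)
  have B: "emeasure M2 {..r} = ?c * emeasure lborel (cball (0::real^'n) r)" for r
  proof -
    have "norm -` {..r} = cball (0::real^'n) r" by auto
    then show ?thesis unfolding M2_def by (simp add: emeasure_distr)
  qed
  have v: "(\<integral>\<^sup>+u. indicator (cball 0 1) u * k (sgn u) \<partial>lborel) = ?v * ?c"
  proof -
    have "?c = (\<integral>\<^sup>+u. k (sgn u) * indicator (cball 0 1) u \<partial>lborel) / ?v"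
      unfolding sphere_measure_def
      by (subst nn_integral_distr, measurable, subst nn_integral_uniform_measure, auto)
    then have "?v * ?c = (\<integral>\<^sup>+u. k (sgn u) * indicator (cball 0 1) u \<partial>lborel) * ?v / ?v"
      by (simp add: ennreal_times_divide mult.commute)
    also have "\<dots> = (\<integral>\<^sup>+u. k (sgn u) * indicator (cball 0 1) u \<partial>lborel)"
      using emeasure_cball_pos_finite[where 'a="real^'n"] by (intro mult_divide_eq_ennreal) auto
    finally show ?thesis by (simp add: mult.commute)
  qed
  have "M1 = M2"
  proof (rule measure_eqI_generator_eq[where E="range atMost" and \<Omega>=UNIV and A="\<lambda>i. {..real i}"])
    show "Int_stable (range (atMost :: real \<Rightarrow> real set))" by (auto simp: Int_stable_def)
    show "sets M1 = sigma_sets UNIV (range atMost)" "sets M2 = sigma_sets UNIV (range atMost)"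
      by (simp_all add: M1_def M2_def borel_eq_atMost)
    show "(\<Union>i. {..real i}) = UNIV" using real_arch_simple by auto
    show "emeasure M1 {..real i} \<noteq> \<infinity>" for i
    proof -
      have "emeasure M1 {..real i} \<le> (\<integral>\<^sup>+u. indicator (cball (0::real^'n) (real i)) u * 1 \<partial>lborel)"
        unfolding A by (intro nn_integral_mono mult_left_mono kb) simp
      also have "\<dots> < \<infinity>" by (simp add: emeasure_cball)
      finally show ?thesis by simp
    qed
    fix Y :: "real set" assume "Y \<in> range atMost"
    then obtain r where Y: "Y = {..r}" by auto
    show "emeasure M1 Y = emeasure M2 Y"
    \<comment> \<open>For \<open>r \<le> 0\<close> the ball contains at most the origin and is a
      null set; the scaling argument concerns positive radii.\<close>
    proof (cases "r > 0")
      case False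
      then have "cball (0::real^'n) r \<subseteq> {0}"
        by (auto simp: not_less simp flip: norm_le_zero_iff)
      then have n: "cball (0::real^'n) r \<in> null_sets lborel"
        by (intro null_sets_subset[of "{0::real^'n}" lborel "cball 0 r"] countable_imp_null_set_lborel) auto
      then have "AE u in lborel. u \<notin> cball (0::real^'n) r" by (rule AE_not_in)
      then have "(\<integral>\<^sup>+u. indicator (cball (0::real^'n) r) u * k (sgn u) \<partial>lborel) = (\<integral>\<^sup>+(u::real^'n). 0 \<partial>lborel)"
        by (intro nn_integral_cong_AE) (auto elim!: eventually_mono)
      then show ?thesis using n unfolding Y A B by (simp add: null_sets_def)
    next
      case True
      have e: "(\<integral>\<^sup>+u. h u \<partial>lborel) = ennreal (r ^ CARD('n)) * (\<integral>\<^sup>+u. h (r *\<^sub>R u) \<partial>lborel)"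
        if [measurable]: "h \<in> borel_measurable borel" for h :: "real^'n \<Rightarrow> ennreal"
        using True
        by (subst lborel_affine[of r 0])
           (simp_all add: nn_integral_density nn_integral_distr nn_integral_cmult ennreal_power)
      have [measurable]: "cball (0::real^'n) r \<in> sets borel" by simp
      have i: "indicator (cball 0 r) (r *\<^sub>R u) = (indicator (cball 0 1) u :: ennreal)" for u :: "real^'n"
        using True by (auto simp: indicator_def field_simps)
      have "emeasure M1 {..r} = ennreal (r ^ CARD('n)) *
          (\<integral>\<^sup>+u. indicator (cball 0 r) (r *\<^sub>R u) * k (sgn (r *\<^sub>R u)) \<partial>lborel)"
        unfolding A by (rule e) measurable
      then have "emeasure M1 {..r} = ennreal (r ^ CARD('n)) * (?v * ?c)"
        unfolding v[symmetric] using True by (simp add: i sgn_scaleR)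
      moreover have "emeasure lborel (cball (0::real^'n) r) = ennreal (r ^ CARD('n)) * ?v"
        using e[of "indicator (cball 0 r)"] by (simp add: i)
      ultimately show ?thesis unfolding Y B by (simp add: ac_simps)
    qed
  qed auto
  then have "(\<integral>\<^sup>+s. w s \<partial>M1) = (\<integral>\<^sup>+s. w s \<partial>M2)" by simp
  moreover have "(\<integral>\<^sup>+s. w s \<partial>M1) = (\<integral>\<^sup>+u. w (norm u) * k (sgn u) \<partial>lborel)"
    unfolding M1_def by (simp add: nn_integral_distr nn_integral_density ac_simps)
  moreover have "(\<integral>\<^sup>+s. w s \<partial>M2) = ?c * (\<integral>\<^sup>+u. w (norm (u::real^'n)) \<partial>lborel)"
    unfolding M2_def by (simp add: nn_integral_distr nn_integral_scale_measure)
  ultimately show ?thesis by (simp add: ac_simps)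
qed

text \<open>For indicators the separation becomes an identity of measures, from which the integrals
  of unbounded and of vector-valued functions of the direction follow at once.\<close>

lemma polar_distr:
  fixes w :: "real \<Rightarrow> real"
  assumes w[measurable]: "w \<in> borel_measurable borel" and w0: "\<And>r. 0 \<le> w r"
    and wi: "integrable lborel (\<lambda>u::real^'n. w (norm u))"
  shows "distr (density lborel (\<lambda>u. ennreal (w (norm u)))) borel sgn
      = density (sphere_measure :: (real^'n) measure) (\<lambda>_. ennreal (\<integral>u. w (norm (u::real^'n)) \<partial>lborel))"
    (is "_ = density _ (\<lambda>_. ennreal ?c)")
proof (rule measure_eqI)
  have c: "(\<integral>\<^sup>+u. ennreal (w (norm (u::real^'n))) \<partial>lborel) = ennreal ?c"
    using wi w0 by (intro nn_integral_eq_integral) auto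
  fix A assume "A \<in> sets (distr (density lborel (\<lambda>u::real^'n. ennreal (w (norm u)))) borel sgn)"
  then have [measurable]: "A \<in> sets borel" by simp
  have "emeasure (distr (density lborel (\<lambda>u::real^'n. ennreal (w (norm u)))) borel sgn) A
     = (\<integral>\<^sup>+u. ennreal (w (norm u)) * indicator A (sgn u) \<partial>lborel)"
    by (subst emeasure_distr, measurable, subst emeasure_density, measurable)
       (auto intro!: nn_integral_cong simp: indicator_def)
  also have "\<dots> = ennreal ?c * emeasure sphere_measure A"
    using polar_nn_integral_bounded[of "indicator A" "\<lambda>r. ennreal (w r)"]
    by (simp add: c) (simp add: indicator_def)
  also have "\<dots> = emeasure (density (sphere_measure :: (real^'n) measure) (\<lambda>_. ennreal ?c)) A"
    by (simp add: emeasure_density nn_integral_cmult)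
  finally show "emeasure (distr (density lborel (\<lambda>u::real^'n. ennreal (w (norm u)))) borel sgn) A
    = emeasure (density (sphere_measure :: (real^'n) measure) (\<lambda>_. ennreal ?c)) A" .
qed simp

lemma polar_nn_integral:
  fixes k :: "real^'n \<Rightarrow> ennreal" and w :: "real \<Rightarrow> real"
  assumes k[measurable]: "k \<in> borel_measurable borel"
    and w[measurable]: "w \<in> borel_measurable borel" and w0: "\<And>r. 0 \<le> w r"
    and wi: "integrable lborel (\<lambda>u::real^'n. w (norm u))"
  shows "(\<integral>\<^sup>+u. ennreal (w (norm u)) * k (sgn u) \<partial>lborel)
    = (\<integral>\<^sup>+u. ennreal (w (norm (u::real^'n))) \<partial>lborel) * (\<integral>\<^sup>+t. k t \<partial>sphere_measure)"
proof -
  let ?c = "\<integral>u. w (norm (u::real^'n)) \<partial>lborel"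
  have c: "(\<integral>\<^sup>+u. ennreal (w (norm (u::real^'n))) \<partial>lborel) = ennreal ?c"
    using wi w0 by (intro nn_integral_eq_integral) auto
  have "(\<integral>\<^sup>+u. ennreal (w (norm u)) * k (sgn u) \<partial>lborel)
      = (\<integral>\<^sup>+t. k t \<partial>distr (density lborel (\<lambda>u. ennreal (w (norm u)))) borel sgn)"
    by (subst nn_integral_distr, measurable, subst nn_integral_density, auto)
  also have "\<dots> = ennreal ?c * (\<integral>\<^sup>+t. k t \<partial>sphere_measure)"
    unfolding polar_distr[OF w w0 wi] by (subst nn_integral_density) (auto simp: nn_integral_cmult)
  finally show ?thesis unfolding c .
qed

lemma polar_integral:
  fixes k :: "real^'n \<Rightarrow> 'b::{banach, second_countable_topology}" and w :: "real \<Rightarrow> real"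
  assumes k[measurable]: "k \<in> borel_measurable borel"
    and w[measurable]: "w \<in> borel_measurable borel" and w0: "\<And>r. 0 \<le> w r"
    and wi: "integrable lborel (\<lambda>u::real^'n. w (norm u))"
  shows "(\<integral>u. w (norm u) *\<^sub>R k (sgn u) \<partial>lborel)
    = (\<integral>u. w (norm (u::real^'n)) \<partial>lborel) *\<^sub>R (\<integral>t. k t \<partial>sphere_measure)"
proof -
  have "(\<integral>u. w (norm u) *\<^sub>R k (sgn u) \<partial>lborel)
      = (\<integral>t. k t \<partial>distr (density lborel (\<lambda>u. ennreal (w (norm u)))) borel sgn)"
    by (subst integral_distr, measurable, subst integral_density, auto simp: w0)
  also have "\<dots> = (\<integral>u. w (norm (u::real^'n)) \<partial>lborel) *\<^sub>R (\<integral>t. k t \<partial>sphere_measure)"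
    unfolding polar_distr[OF w w0 wi] by (subst integral_density) (auto simp: w0)
  finally show ?thesis .
qed

subsection \<open>Differentiating averages over balls\<close>

text \<open>The second part passes to the gauge integral over a box, the form in which
  differentiation under the integral sign is carried out below.\<close>

lemma continuous_compact_support:
  fixes k :: "'a::euclidean_space \<Rightarrow> real"
  assumes k: "continuous_on UNIV k" and 0: "\<And>u. u \<notin> cbox a b \<Longrightarrow> k u = 0"
  shows "integrable lborel k" and "(\<integral>u. k u \<partial>lborel) = integral (cbox a b) k"
proof -
  have i: "integrable lborel (\<lambda>x. indicator (cbox a b) x *\<^sub>R k x)"
    by (rule borel_integrable_compact[OF compact_cbox continuous_on_subset[OF k]]) simp
  have eq: "indicator (cbox a b) x *\<^sub>R k x = k x" for x
    using 0[of x] by (auto simp: indicator_def)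
  show "integrable lborel k" using i unfolding eq .
  have "set_integrable lborel (cbox a b) k" using i by (simp add: set_integrable_def)
  from set_borel_integral_eq_integral(2)[OF this]
  show "(\<integral>u. k u \<partial>lborel) = integral (cbox a b) k"
    unfolding set_lebesgue_integral_def eq .
qed

lemma continuous_ball_support:
  fixes k :: "'a::euclidean_space \<Rightarrow> real"
  assumes k: "continuous_on UNIV k" and 0: "\<And>u. norm u > r \<Longrightarrow> k u = 0"
  shows "integrable lborel k"
proof -
  obtain a b where ab: "cball (0::'a) r \<subseteq> cbox a b"
    using bounded_subset_cbox_symmetric[OF bounded_cball] by metis
  show ?thesis
    by (rule continuous_compact_support(1)[OF k, of a b]) (use ab 0 in \<open>force simp: subset_iff\<close>)
qed

text \<open>A \<open>C\<^sup>1\<close> spline equal to \<open>1\<close> on \<open>(-\<infinity>, 0]\<close> and to \<open>0\<close> on \<open>[1, \<infinity>)\<close>, with derivative \<open>bump'\<close>.\<close>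

definition bump :: "real \<Rightarrow> real" where
  "bump s = 1 - 2 * (max 0 s)\<^sup>2 + 4 * (max 0 (s - 1/2))\<^sup>2 - 2 * (max 0 (s - 1))\<^sup>2"

definition bump' :: "real \<Rightarrow> real" where
  "bump' s = - 4 * max 0 s + 8 * max 0 (s - 1/2) - 4 * max 0 (s - 1)"

lemma DERIV_pos_part_square: "((\<lambda>t. (max 0 t)\<^sup>2) has_real_derivative 2 * max 0 t) (at t)" for t :: real
proof (cases t "0::real" rule: linorder_cases)
  case greater
  have "((\<lambda>t. t\<^sup>2) has_real_derivative 2 * t) (at t)"
    by (auto intro!: derivative_eq_intros)
  then have "((\<lambda>t. (max 0 t)\<^sup>2) has_real_derivative 2 * t) (at t)"
    by (rule DERIV_cong_ev[THEN iffD1, rotated -1, OF _ refl _ refl])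
       (use greater in \<open>auto intro!: eventually_mono[OF eventually_gt_at_top] simp: eventually_nhds intro!: exI[of _ "{0<..}"]\<close>)
  then show ?thesis using greater by simp
next
  case less
  have "((\<lambda>t. 0) has_real_derivative 0) (at t)" by simp
  then have "((\<lambda>t. (max 0 t)\<^sup>2) has_real_derivative 0) (at t)"
    by (rule DERIV_cong_ev[THEN iffD1, rotated -1, OF _ refl _ refl])
       (use less in \<open>auto simp: eventually_nhds intro!: exI[of _ "{..<0}"]\<close>)
  then show ?thesis using less by simp
next
  case equal
  have "((\<lambda>h. ((max 0 (0 + h))\<^sup>2 - (max 0 (0::real))\<^sup>2) / h) \<longlongrightarrow> 0) (at 0)"
  proof (rule Lim_null_comparison)
    show "\<forall>\<^sub>F h in at 0. norm (((max 0 (0 + h))\<^sup>2 - (max 0 (0::real))\<^sup>2) / h) \<le> \<bar>h\<bar>"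
      by (rule always_eventually) (auto simp: max_def power2_eq_square)
    show "((\<lambda>h. \<bar>h\<bar>) \<longlongrightarrow> 0) (at (0::real))"
      by (intro tendsto_eq_intros) auto
  qed
  then show ?thesis using equal by (simp add: DERIV_def)
qed

lemma DERIV_bump: "(bump has_real_derivative bump' s) (at s)"
  unfolding bump_def[abs_def] bump'_def
  by (rule derivative_eq_intros DERIV_pos_part_square
      DERIV_chain2[OF DERIV_pos_part_square, where g="\<lambda>s. s - 1/2"]
      DERIV_chain2[OF DERIV_pos_part_square, where g="\<lambda>s. s - 1"] refl)+ simp

lemma bump_eq_1: "s \<le> 0 \<Longrightarrow> bump s = 1" and bump'_eq_0: "s \<le> 0 \<Longrightarrow> bump' s = 0"
  and bump_eq_0: "1 \<le> s \<Longrightarrow> bump s = 0" and bump'_eq_0': "1 \<le> s \<Longrightarrow> bump' s = 0"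
  and bump'_le: "bump' s \<le> 0"
  by (auto simp: bump_def bump'_def max_def power2_eq_square algebra_simps)

lemma bump_bounds: "0 \<le> bump s" "bump s \<le> 1"
proof -
  have mono: "bump t \<le> bump s" if "s \<le> t" for s t
    by (rule DERIV_nonpos_imp_nonincreasing[OF that]) (use DERIV_bump bump'_le in blast)
  show "0 \<le> bump s" using mono[of s "max s 1"] bump_eq_0[of "max s 1"] by simp
  show "bump s \<le> 1" using mono[of "min s 0" s] bump_eq_1[of "min s 0"] by simp
qed

lemma continuous_bump[continuous_intros]: "continuous_on S f \<Longrightarrow> continuous_on S (\<lambda>x. bump (f x))"
  unfolding bump_def by (intro continuous_intros)

lemma continuous_bump'[continuous_intros]: "continuous_on S f \<Longrightarrow> continuous_on S (\<lambda>x. bump' (f x))"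
  unfolding bump'_def by (intro continuous_intros)

text \<open>Written with \<open>u \<bullet> u\<close> instead of the norm, so that it is
  \<open>C^1\<close> at the origin too. It is 1 on the unit ball and 0 beyond radius
  \<open>1 + e\<close>.\<close>

definition cutoff :: "real \<Rightarrow> real^'n \<Rightarrow> real" where
  "cutoff e u = bump ((u \<bullet> u - 1) / e)"

text \<open>The negative gradient of the cutoff is \<open>shell e (norm u) *\<^sub>R sgn u\<close>.\<close>

definition shell :: "real \<Rightarrow> real \<Rightarrow> real" where
  "shell e r = - (2 / e) * bump' ((r\<^sup>2 - 1) / e) * \<bar>r\<bar>"

text \<open>The right-hand side is visibly continuous, also at the origin where \<open>sgn\<close>
  jumps. Continuity and the Leibniz rule use that side, polar coordinates the other one.\<close>

lemma shell_sgn: "shell e (norm u) * (sgn u \<bullet> h) = - (2 / e) * bump' ((u \<bullet> u - 1) / e) * (u \<bullet> h)" for u :: "real^'n"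
  by (cases "u = 0") (simp_all add: shell_def sgn_div_norm power2_norm_eq_inner)

lemma shell_nonneg: "0 < e \<Longrightarrow> 0 \<le> shell e r"
  using bump'_le[of "(r\<^sup>2 - 1) / e"]
  by (simp add: shell_def zero_le_mult_iff mult_le_0_iff divide_le_0_iff)

lemma shell_support: "shell e r = 0" if "0 < e" "0 \<le> r" "r < 1 \<or> 1 + e < r"
proof -
  have "(r\<^sup>2 - 1) / e \<le> 0 \<or> 1 \<le> (r\<^sup>2 - 1) / e"
    using that(3)
  proof
    assume "r < 1" then have "r\<^sup>2 \<le> 1" using that(2) by (simp add: power_le_one)
    then show ?thesis using that by (simp add: divide_le_0_iff)
  next
    assume "1 + e < r"
    then have "1 + e \<le> r * 1" "r * 1 \<le> r * r" using that by (auto intro!: mult_left_mono)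
    then have "1 + e \<le> r\<^sup>2" by (simp add: power2_eq_square)
    then show ?thesis using that by (simp add: field_simps)
  qed
  then show ?thesis using bump'_eq_0 bump'_eq_0' by (auto simp: shell_def)
qed

lemma shell_measurable[measurable]: "shell e \<in> borel_measurable borel"
  unfolding shell_def[abs_def] bump'_def by measurable

lemma cutoff_support: "cutoff e u = 0" if "0 < e" "1 + e < norm u"
proof -
  have "1 + e \<le> norm u * 1" "norm u * 1 \<le> norm u * norm u" using that by (auto simp: mult_left_le intro!: mult_left_mono[of 1 "norm u" "norm u", simplified])
  then have "1 + e \<le> u \<bullet> u" by (simp add: dot_square_norm power2_eq_square)
  then show ?thesis using that by (auto simp: cutoff_def field_simps intro!: bump_eq_0)
qed

lemma continuous_cutoff[continuous_intros]: "e \<noteq> 0 \<Longrightarrow> continuous_on S f \<Longrightarrow> continuous_on S (\<lambda>x. cutoff e (f x))"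
  unfolding cutoff_def by (intro continuous_intros) auto

lemma continuous_shell_sgn: "e \<noteq> 0 \<Longrightarrow> continuous_on UNIV (\<lambda>u::real^'n. shell e (norm u) * (sgn u \<bullet> h))"
  unfolding shell_sgn by (intro continuous_intros) auto

lemma continuous_shell: "e \<noteq> 0 \<Longrightarrow> continuous_on UNIV (\<lambda>u::real^'n. shell e (norm u))"
  unfolding shell_def by (intro continuous_intros) auto

lemma integrable_shell:
  assumes "0 < e" "continuous_on UNIV k"
  shows "integrable lborel (\<lambda>u::real^'n. shell e (norm u) * k u)"
    and "integrable lborel (\<lambda>u::real^'n. shell e (norm u) * (sgn u \<bullet> h) * k u)"
    and "integrable lborel (\<lambda>u::real^'n. cutoff e u * k u)"
proof -
  show "integrable lborel (\<lambda>u::real^'n. shell e (norm u) * k u)"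
    by (rule continuous_ball_support[where r="1+e"])
       (use assms shell_support in \<open>auto intro!: continuous_on_mult continuous_shell\<close>)
  show "integrable lborel (\<lambda>u::real^'n. shell e (norm u) * (sgn u \<bullet> h) * k u)"
    by (rule continuous_ball_support[where r="1+e"])
       (use assms shell_support in \<open>auto intro!: continuous_on_mult continuous_shell_sgn\<close>)
  show "integrable lborel (\<lambda>u::real^'n. cutoff e u * k u)"
    by (rule continuous_ball_support[where r="1+e"])
       (use assms cutoff_support in \<open>auto intro!: continuous_intros\<close>)
qed

lemma integral_lborel_translate:
  fixes k :: "'a::euclidean_space \<Rightarrow> real"
  assumes [measurable]: "k \<in> borel_measurable borel"
  shows "(\<integral>x. k (a + x) \<partial>lborel) = (\<integral>x. k x \<partial>lborel)"
proof -
  have "(\<integral>x. k x \<partial>lborel) = (\<integral>x. k x \<partial>distr lborel borel ((+) a))"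
    by (simp add: lborel_distr_plus)
  then show ?thesis by (simp add: integral_distr)
qed

text \<open>\<open>F\<close> is only continuous, so the derivative has to fall on the cutoff: the
  substitution \<open>z = x + s *\<^sub>R h + u\<close> moves the parameter into the kernel, and a
  fixed box contains the supports for all parameters considered.\<close>

lemma DERIV_cutoff_average:
  fixes F :: "real^'n \<Rightarrow> real"
  assumes e: "0 < e" and F: "continuous_on UNIV F" and t: "0 \<le> t" "t \<le> 1"
  shows "((\<lambda>t. \<integral>u. cutoff e u * F (x + t *\<^sub>R h + u) \<partial>lborel) has_real_derivative
      (\<integral>u. shell e (norm u) * (sgn u \<bullet> h) * F (x + t *\<^sub>R h + u) \<partial>lborel)) (at t)"
proof -
  \<comment> \<open>An open interval around \<open>[0, 1]\<close>, so that the derivatives at both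
    end points are two-sided; its parameters are bounded by 2, which is the 2 in the radius of the
    box.\<close>
  define U where "U = {-1<..<2::real}"
  have U: "t \<in> U" "convex U" "open U" using t by (auto simp: U_def)
  obtain a b where ab: "cball (0::real^'n) (norm x + 2 * norm h + 1 + e) \<subseteq> cbox a b"
    using bounded_subset_cbox_symmetric[OF bounded_cball] by metis
  have out: "norm (z - x - s *\<^sub>R h) > 1 + e" if "s \<in> U" "z \<notin> cbox a b" for s z
  proof -
    have "norm z > norm x + 2 * norm h + 1 + e" using that ab by (force simp: subset_iff)
    moreover have "norm (s *\<^sub>R h) \<le> 2 * norm h" using that by (auto simp: U_def intro!: mult_right_mono)
    moreover have "norm z \<le> norm (z - x - s *\<^sub>R h) + norm x + norm (s *\<^sub>R h)"
      using norm_triangle_ineq[of "z - x - s *\<^sub>R h" "x + s *\<^sub>R h"] norm_triangle_ineq[of x "s *\<^sub>R h"] by simp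
    ultimately show ?thesis by simp
  qed
  have [measurable]: "F \<in> borel_measurable borel" using F by (rule borel_measurable_continuous_onI)
  have cm[measurable]: "cutoff e \<in> borel_measurable borel"
    by (rule borel_measurable_continuous_onI) (use e in \<open>auto intro!: continuous_intros\<close>)
  have sm[measurable]: "(\<lambda>u. shell e (norm u) * (sgn u \<bullet> h)) \<in> borel_measurable borel"
    by (rule borel_measurable_continuous_onI) (use e in \<open>auto intro!: continuous_shell_sgn\<close>)
  have shift: "(\<integral>u. k u * F (x + s *\<^sub>R h + u) \<partial>lborel) = integral (cbox a b) (\<lambda>z. k (z - x - s *\<^sub>R h) * F z)"
    if k: "continuous_on UNIV k" and k0: "\<And>u. norm u > 1 + e \<Longrightarrow> k u = 0" and s: "s \<in> U" for k :: "real^'n \<Rightarrow> real" and s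
  proof -
    have [measurable]: "k \<in> borel_measurable borel" using k by (rule borel_measurable_continuous_onI)
    have "(\<integral>u. k u * F (x + s *\<^sub>R h + u) \<partial>lborel)
        = (\<integral>u. (\<lambda>z. k (z - x - s *\<^sub>R h) * F z) (x + s *\<^sub>R h + u) \<partial>lborel)"
      by (simp add: algebra_simps)
    also have "\<dots> = (\<integral>z. k (z - x - s *\<^sub>R h) * F z \<partial>lborel)"
      by (rule integral_lborel_translate) measurable
    also have "\<dots> = integral (cbox a b) (\<lambda>z. k (z - x - s *\<^sub>R h) * F z)"
    proof (rule continuous_compact_support(2))
      show "continuous_on UNIV (\<lambda>z. k (z - x - s *\<^sub>R h) * F z)"
        by (intro continuous_intros F continuous_on_compose2[OF k]) auto
    qed (use k0 out s in auto)
    finally show ?thesis .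
  qed
  let ?f = "\<lambda>s z. cutoff e (z - x - s *\<^sub>R h) * F z"
  let ?f' = "\<lambda>s z. - (2 / e) * bump' (((z - x - s *\<^sub>R h) \<bullet> (z - x - s *\<^sub>R h) - 1) / e) * ((z - x - s *\<^sub>R h) \<bullet> h) * F z"
  have "((\<lambda>s. integral (cbox a b) (?f s)) has_real_derivative integral (cbox a b) (?f' t)) (at t within U)"
  proof (rule leibniz_rule_field_derivative[OF _ _ _ U(1,2)])
    fix s z assume "s \<in> U" "z \<in> cbox a b"
    let ?q = "\<lambda>s. (z - x - s *\<^sub>R h) \<bullet> (z - x - s *\<^sub>R h)"
    have q: "?q = (\<lambda>s. (z - x) \<bullet> (z - x) - 2 * s * ((z - x) \<bullet> h) + s\<^sup>2 * (h \<bullet> h))"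
      by (simp add: fun_eq_iff inner_diff_left inner_diff_right inner_commute power2_eq_square algebra_simps)
    have "(?q has_real_derivative - 2 * ((z - x - s *\<^sub>R h) \<bullet> h)) (at s)"
      unfolding q by (auto intro!: derivative_eq_intros simp: inner_diff_left)
    then have "((\<lambda>s. (?q s - 1) / e) has_real_derivative - 2 * ((z - x - s *\<^sub>R h) \<bullet> h) / e) (at s)"
      using DERIV_cdivide[OF DERIV_diff[OF _ DERIV_const]] by fastforce
    from DERIV_cmult_right[OF DERIV_chain2[OF DERIV_bump this], of "F z"]
    have "((\<lambda>s. ?f s z) has_real_derivative ?f' s z) (at s)"
      unfolding cutoff_def by (rule DERIV_cong) (use e in \<open>simp add: field_simps\<close>)
    then show "((\<lambda>s. ?f s z) has_real_derivative ?f' s z) (at s within U)"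
      by (rule has_field_derivative_at_within)
  next
    fix s assume "s \<in> U"
    show "?f s integrable_on cbox a b"
      by (rule integrable_continuous) (use e in \<open>auto intro!: continuous_intros continuous_on_subset[OF F]\<close>)
  next
    show "continuous_on (U \<times> cbox a b) (\<lambda>(s, z). ?f' s z)"
      unfolding split_beta
      by (use e in \<open>auto intro!: continuous_intros continuous_on_compose2[OF F]\<close>)
  qed
  then have "((\<lambda>s. integral (cbox a b) (?f s)) has_real_derivative integral (cbox a b) (?f' t)) (at t)"
    by (simp only: at_within_open[OF U(1,3)])
  moreover have "(\<integral>u. shell e (norm u) * (sgn u \<bullet> h) * F (x + t *\<^sub>R h + u) \<partial>lborel)
      = integral (cbox a b) (\<lambda>z. shell e (norm (z - x - t *\<^sub>R h)) * (sgn (z - x - t *\<^sub>R h) \<bullet> h) * F z)"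
  proof (rule shift[OF _ _ U(1)])
    show "continuous_on UNIV (\<lambda>u. shell e (norm u) * (sgn u \<bullet> h))"
      using e by (intro continuous_shell_sgn) simp
    show "shell e (norm u) * (sgn u \<bullet> h) = 0" if "1 + e < norm u" for u
      using that e by (simp add: shell_support)
  qed
  then have "(\<integral>u. shell e (norm u) * (sgn u \<bullet> h) * F (x + t *\<^sub>R h + u) \<partial>lborel) = integral (cbox a b) (?f' t)"
    by (simp only: shell_sgn)
  moreover have "\<forall>\<^sub>F s in nhds t. integral (cbox a b) (?f s) = (\<integral>u. cutoff e u * F (x + s *\<^sub>R h + u) \<partial>lborel)"
    unfolding eventually_nhds
  proof (intro exI[of _ U] conjI ballI)
    fix s assume s: "s \<in> U"
    have "continuous_on UNIV (cutoff e :: real^'n \<Rightarrow> real)"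
      by (rule continuous_cutoff[OF _ continuous_on_id]) (use e in simp)
    then show "integral (cbox a b) (?f s) = (\<integral>u. cutoff e u * F (x + s *\<^sub>R h + u) \<partial>lborel)"
      by (rule shift[symmetric]) (use e s cutoff_support in auto)
  qed (use U in auto)
  ultimately show ?thesis
    by (subst DERIV_cong_ev[OF refl _ refl, symmetric]) auto
qed

text \<open>For either sign \<open>c\<close> the function
  \<open>c * \<phi> t - c * t * \<phi>' 0 - M * t^2 / 2\<close> has nonpositive derivative. The mean
  value theorem thus suffices, and no integral of \<open>\<phi>'\<close> is formed.\<close>

lemma taylor_bound_real:
  fixes \<phi> :: "real \<Rightarrow> real"
  assumes d: "\<And>t. 0 \<le> t \<Longrightarrow> t \<le> 1 \<Longrightarrow> (\<phi> has_real_derivative \<phi>' t) (at t)"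
    and M: "\<And>t. 0 \<le> t \<Longrightarrow> t \<le> 1 \<Longrightarrow> \<bar>\<phi>' t - \<phi>' 0\<bar> \<le> M * t"
  shows "\<bar>\<phi> 1 - \<phi> 0 - \<phi>' 0\<bar> \<le> M / 2"
proof -
  let ?f = "\<lambda>c t. c * \<phi> t - c * t * \<phi>' 0 - M * t\<^sup>2 / 2"
  have *: "?f c 1 \<le> ?f c 0" if c: "\<bar>c\<bar> = 1" for c :: real
  proof (rule DERIV_nonpos_imp_nonincreasing[where f="?f c"])
    fix t :: real assume t: "0 \<le> t" "t \<le> 1"
    have "(?f c has_real_derivative c * (\<phi>' t - \<phi>' 0) - M * t) (at t)"
      by (auto intro!: derivative_eq_intros d[OF t] simp: algebra_simps)
    moreover have "c * (\<phi>' t - \<phi>' 0) \<le> \<bar>\<phi>' t - \<phi>' 0\<bar>"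
      using abs_ge_self[of "c * (\<phi>' t - \<phi>' 0)"] c by (simp add: abs_mult)
    ultimately show "\<exists>y. (?f c has_real_derivative y) (at t) \<and> y \<le> 0"
      using M[OF t] by (intro exI conjI) auto
  qed simp
  show ?thesis using *[of 1] *[of "-1"] by (auto simp: abs_if field_simps)
qed

text \<open>Jensen's inequality in the guise of a nonnegative variance. This root of the second
  moment is the reason for \<open>sqrt n\<close> in the smoothness constant, where the trivial bound
  \<open>norm h\<close> would give \<open>n\<close>.\<close>

lemma sphere_first_moment_le:
  fixes h :: "real^'n"
  shows "(\<integral>t. \<bar>h \<bullet> t\<bar> \<partial>sphere_measure) \<le> norm h / sqrt CARD('n)"
proof -
  interpret prob_space "sphere_measure :: (real^'n) measure" by (rule prob_space_sphere)
  have i: "integrable sphere_measure (\<lambda>t. \<bar>h \<bullet> t\<bar>)"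
  proof (rule integrable_const_bound[where B="norm h"])
    show "AE t in sphere_measure. norm \<bar>h \<bullet> t\<bar> \<le> norm h"
      using AE_sphere_measure
    proof eventually_elim
      case (elim t)
      then show ?case using Cauchy_Schwarz_ineq2[of h t] by simp
    qed
  qed measurable
  have "0 \<le> variance (\<lambda>t. \<bar>h \<bullet> t\<bar>)" by simp
  also have "\<dots> = (norm h)\<^sup>2 / CARD('n) - (\<integral>t. \<bar>h \<bullet> t\<bar> \<partial>sphere_measure)\<^sup>2"
    using sphere_second_moment[of h] by (subst variance_eq) (simp_all add: i)
  finally have "(\<integral>t. \<bar>h \<bullet> t\<bar> \<partial>sphere_measure)\<^sup>2 \<le> (norm h / sqrt CARD('n))\<^sup>2"
    by (simp add: power_divide)
  then show ?thesis by (rule power2_le_imp_le) simp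
qed

text \<open>The divergence theorem for the identity field, whose divergence is \<open>n\<close>: the
  cutoff average of a coordinate function is differentiated along that coordinate, once directly and
  once by \<open>DERIV_cutoff_average\<close>. This calibrates the mass of the shell.\<close>

lemma shell_mass:
  fixes e :: real
  assumes e: "0 < e"
  shows "(\<integral>u. shell e (norm u) * norm u \<partial>(lborel::(real^'n) measure)) = CARD('n) * (\<integral>u. cutoff e (u::real^'n) \<partial>lborel)"
proof -
  have b: "(\<integral>u. shell e (norm u) * (sgn u \<bullet> b) * (u \<bullet> b) \<partial>lborel) = (\<integral>u. cutoff e (u::real^'n) \<partial>lborel)"
    if b: "b \<in> Basis" for b :: "real^'n"
  proof -
    have i: "integrable lborel (\<lambda>u::real^'n. cutoff e u * 1)" "integrable lborel (\<lambda>u::real^'n. cutoff e u * (u \<bullet> b))"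
      by (rule integrable_shell[OF e], intro continuous_intros)+
    have "((\<lambda>t. \<integral>u. cutoff e u * ((0 + t *\<^sub>R b + u) \<bullet> b) \<partial>lborel) has_real_derivative
        (\<integral>u. shell e (norm u) * (sgn u \<bullet> b) * ((0 + 0 *\<^sub>R b + u) \<bullet> b) \<partial>lborel)) (at 0)"
      by (rule DERIV_cutoff_average[OF e]) (auto intro!: continuous_intros)
    moreover have "(\<lambda>t. \<integral>u. cutoff e u * ((0 + t *\<^sub>R b + u) \<bullet> b) \<partial>lborel)
        = (\<lambda>t. t * (\<integral>u. cutoff e (u::real^'n) \<partial>lborel) + (\<integral>u. cutoff e u * (u \<bullet> b) \<partial>lborel))"
      using i b by (simp add: inner_add_left distrib_left mult.commute)
    moreover have "((\<lambda>t. t * (\<integral>u. cutoff e (u::real^'n) \<partial>lborel) + (\<integral>u. cutoff e u * (u \<bullet> b) \<partial>lborel)) has_real_derivative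
       (\<integral>u. cutoff e (u::real^'n) \<partial>lborel)) (at 0)"
      by (auto intro!: derivative_eq_intros)
    ultimately show ?thesis by (simp add: DERIV_unique)
  qed
  have "norm u = (\<Sum>b\<in>Basis. (sgn u \<bullet> b) * (u \<bullet> b))" for u :: "real^'n"
    unfolding euclidean_inner[symmetric]
    by (cases "u = 0") (simp_all add: sgn_div_norm dot_square_norm power2_eq_square)
  then have "(\<integral>u. shell e (norm u) * norm u \<partial>(lborel::(real^'n) measure))
      = (\<integral>u. (\<Sum>b\<in>Basis. shell e (norm u) * (sgn u \<bullet> b) * (u \<bullet> b)) \<partial>(lborel::(real^'n) measure))"
    by (simp add: sum_distrib_left mult.assoc)
  also have "\<dots> = (\<Sum>b\<in>Basis. (\<integral>u. shell e (norm u) * (sgn u \<bullet> b) * (u \<bullet> b) \<partial>(lborel::(real^'n) measure)))"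
    by (rule Bochner_Integration.integral_sum) (rule integrable_shell[OF e], intro continuous_intros)
  also have "\<dots> = CARD('n) * (\<integral>u. cutoff e (u::real^'n) \<partial>lborel)"
    by (simp add: b)
  finally show ?thesis .
qed

text \<open>Quantitative form of the divergence theorem for the ball, at positive cutoff width.\<close>

lemma cutoff_taylor:
  fixes F :: "real^'n \<Rightarrow> real"
  assumes e: "0 < e" and F: "L-lipschitz_on UNIV F"
  shows "\<bar>(\<integral>u. cutoff e u * F (x + h + u) \<partial>lborel) - (\<integral>u. cutoff e u * F (x + u) \<partial>lborel)
      - (\<integral>u. shell e (norm u) * (sgn u \<bullet> h) * F (x + u) \<partial>lborel)\<bar>
    \<le> (L * (norm h)\<^sup>2 / sqrt CARD('n) * (\<integral>u. shell e (norm u) \<partial>(lborel::(real^'n) measure))) / 2"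
proof -
  have L0: "0 \<le> L" using F by (rule lipschitz_on_nonneg)
  have cF: "continuous_on UNIV F" using F by (rule lipschitz_on_continuous_on)
  let ?c = "\<integral>u. shell e (norm u) \<partial>(lborel::(real^'n) measure)"
  have ci: "integrable lborel (\<lambda>u::real^'n. shell e (norm u))"
    using integrable_shell(1)[OF e, of "\<lambda>_. 1"] by simp
  let ?d = "\<lambda>t. \<integral>u. shell e (norm u) * (sgn u \<bullet> h) * F (x + t *\<^sub>R h + u) \<partial>lborel"
  have cont: "continuous_on UNIV (\<lambda>u. F (a + u))" for a
    by (rule continuous_on_compose2[OF cF]) (auto intro!: continuous_intros)
  have "\<bar>?d t - ?d 0\<bar> \<le> (L * (norm h)\<^sup>2 / sqrt CARD('n) * ?c) * t" if t: "0 \<le> t" "t \<le> 1" for t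
  proof -
    have i1: "integrable lborel (\<lambda>u. shell e (norm u) * (sgn u \<bullet> h) * F (x + s *\<^sub>R h + u))" for s
      by (rule integrable_shell(2)[OF e cont])
    have i2: "integrable lborel (\<lambda>u. shell e (norm u) * \<bar>h \<bullet> sgn u\<bar>)"
    proof -
      have "integrable lborel (\<lambda>u. shell e (norm u) * (sgn u \<bullet> h) * 1)"
        by (rule integrable_shell(2)[OF e continuous_on_const])
      from integrable_abs[OF this] show ?thesis
        using shell_nonneg[OF e] by (simp add: abs_mult inner_commute)
    qed
    have "?d t - ?d 0 = (\<integral>u. shell e (norm u) * (sgn u \<bullet> h) * (F (x + t *\<^sub>R h + u) - F (x + 0 *\<^sub>R h + u)) \<partial>lborel)"
      by (subst Bochner_Integration.integral_diff[symmetric]) (auto simp only: i1 right_diff_distrib)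
    also have "\<bar>\<dots>\<bar> \<le> (\<integral>u. L * t * norm h * (shell e (norm u) * \<bar>h \<bullet> sgn u\<bar>) \<partial>lborel)"
    proof (rule integral_abs_bound_integral)
      show "integrable lborel (\<lambda>u. shell e (norm u) * (sgn u \<bullet> h) * (F (x + t *\<^sub>R h + u) - F (x + 0 *\<^sub>R h + u)))"
        unfolding right_diff_distrib by (intro Bochner_Integration.integrable_diff i1)
      show "integrable lborel (\<lambda>u. L * t * norm h * (shell e (norm u) * \<bar>h \<bullet> sgn u\<bar>))"
        by (intro integrable_mult_right i2)
      fix u :: "real^'n"
      have "\<bar>F (x + t *\<^sub>R h + u) - F (x + 0 *\<^sub>R h + u)\<bar> \<le> L * (t * norm h)"
        using lipschitz_onD[OF F, of "x + t *\<^sub>R h + u" "x + 0 *\<^sub>R h + u"] t by (simp add: dist_norm)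
      then have "\<bar>sgn u \<bullet> h\<bar> * \<bar>F (x + t *\<^sub>R h + u) - F (x + 0 *\<^sub>R h + u)\<bar> \<le> \<bar>sgn u \<bullet> h\<bar> * (L * (t * norm h))"
        by (rule mult_left_mono) simp
      then have "shell e (norm u) * (\<bar>sgn u \<bullet> h\<bar> * \<bar>F (x + t *\<^sub>R h + u) - F (x + 0 *\<^sub>R h + u)\<bar>)
         \<le> shell e (norm u) * (\<bar>sgn u \<bullet> h\<bar> * (L * (t * norm h)))"
        by (rule mult_left_mono) (rule shell_nonneg[OF e])
      then show "\<bar>shell e (norm u) * (sgn u \<bullet> h) * (F (x + t *\<^sub>R h + u) - F (x + 0 *\<^sub>R h + u))\<bar>
          \<le> L * t * norm h * (shell e (norm u) * \<bar>h \<bullet> sgn u\<bar>)"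
        using shell_nonneg[OF e, of "norm u"] by (simp add: abs_mult inner_commute ac_simps)
    qed
    \<comment> \<open>Polar coordinates leave the mass of the shell times the mean absolute value of
      one coordinate of the direction.\<close>
    also have "\<dots> = L * t * norm h * (?c * (\<integral>s. \<bar>h \<bullet> s\<bar> \<partial>sphere_measure))"
      using polar_integral[of "\<lambda>s. \<bar>h \<bullet> s\<bar>" "shell e"] ci shell_nonneg[OF e] by simp
    also have "\<dots> \<le> L * t * norm h * (?c * (norm h / sqrt CARD('n)))"
      using L0 t shell_nonneg[OF e] by (intro mult_left_mono sphere_first_moment_le) auto
    finally show ?thesis by (simp add: power2_eq_square ac_simps)
  qed
  from taylor_bound_real[OF DERIV_cutoff_average[OF e cF, where x=x and h=h] this]
  show ?thesis by simp
qed

section \<open>Passage from the cutoff to the ball\<close>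

lemma integral_uball:
  fixes k :: "real^'n \<Rightarrow> 'b::{banach, second_countable_topology}"
  assumes [measurable]: "k \<in> borel_measurable borel"
  shows "(\<integral>u. k u \<partial>uball)
    = (\<integral>u. indicator (cball 0 1) u *\<^sub>R k u \<partial>lborel) /\<^sub>R measure lborel (cball (0::real^'n) 1)"
proof -
  let ?v = "measure lborel (cball (0::real^'n) 1)"
  have v: "?v > 0" by simp
  have [measurable]: "cball (0::real^'n) 1 \<in> sets borel" by simp
  have "(uball :: (real^'n) measure) = density lborel (\<lambda>u. ennreal (indicator (cball 0 1) u / ?v))"
    unfolding uniform_measure_def
  proof (intro density_cong AE_I2)
    fix u :: "real^'n"
    have "emeasure lborel (cball (0::real^'n) 1) = ennreal ?v"
      using emeasure_cball_pos_finite[where 'a="real^'n"] by (intro emeasure_eq_ennreal_measure) auto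
    then show "indicator (cball 0 1) u / emeasure lborel (cball (0::real^'n) 1) = ennreal (indicator (cball 0 1) u / ?v)"
      using v by (simp add: divide_ennreal[symmetric] ennreal_indicator)
  qed measurable
  then have "(\<integral>u. k u \<partial>uball) = (\<integral>u. (indicator (cball 0 1) u / ?v) *\<^sub>R k u \<partial>lborel)"
    by (simp add: integral_density)
  also have "\<dots> = (\<integral>u. (1 / ?v) *\<^sub>R (indicator (cball 0 1) u *\<^sub>R k u) \<partial>lborel)"
    by (intro Bochner_Integration.integral_cong) simp_all
  also have "\<dots> = (1 / ?v) *\<^sub>R (\<integral>u. indicator (cball 0 1) u *\<^sub>R k u \<partial>lborel)"
    by (rule integral_scaleR_right)
  finally show ?thesis by (simp only: inverse_eq_divide)
qed

text \<open>Dominated convergence: the widths \<open>1 / (m + 1)\<close> are at most 1, so all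
  supports lie in the ball of radius 2, on which the continuous \<open>k\<close> is
  integrable.\<close>

lemma cutoff_limit:
  fixes k :: "real^'n \<Rightarrow> real"
  assumes k: "continuous_on UNIV k"
  shows "(\<lambda>m. \<integral>u. cutoff (1 / (real m + 1)) u * k u \<partial>lborel)
    \<longlonglongrightarrow> measure lborel (cball (0::real^'n) 1) * (\<integral>u. k u \<partial>uball)"
proof -
  let ?v = "measure lborel (cball (0::real^'n) 1)"
  have [measurable]: "k \<in> borel_measurable borel" using k by (rule borel_measurable_continuous_onI)
  have [measurable]: "cutoff (1 / (real m + 1)) \<in> borel_measurable borel" for m
    by (rule borel_measurable_continuous_onI) (auto intro!: continuous_intros)
  have [measurable]: "cball (0::real^'n) r \<in> sets borel" for r by simp
  have v: "?v > 0" by simp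
  have "(\<lambda>m. \<integral>u. cutoff (1 / (real m + 1)) u * k u \<partial>lborel) \<longlonglongrightarrow> (\<integral>u. indicator (cball 0 1) u * k u \<partial>lborel)"
  proof (rule integral_dominated_convergence[where w="\<lambda>u. indicator (cball 0 2) u * \<bar>k u\<bar>"])
    show "integrable lborel (\<lambda>u. indicator (cball 0 2) u * \<bar>k u\<bar>)"
      using borel_integrable_compact[of "cball 0 2" "\<lambda>u. \<bar>k u\<bar>"]
      by (simp add: continuous_on_subset[OF k] continuous_intros)
    show "AE u in lborel. (\<lambda>m. cutoff (1 / (real m + 1)) u * k u) \<longlonglongrightarrow> indicator (cball 0 1) u * k u"
    proof (intro AE_I2 tendsto_mult_right)
      fix u :: "real^'n"
      show "(\<lambda>m. cutoff (1 / (real m + 1)) u) \<longlonglongrightarrow> indicator (cball 0 1) u"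
      proof (cases "norm u \<le> 1")
        case True
        then have "u \<bullet> u \<le> 1" by (simp add: dot_square_norm power_le_one)
        then have "(u \<bullet> u - 1) * (real m + 1) \<le> 0" for m by (simp add: mult_le_0_iff)
        then have "cutoff (1 / (real m + 1)) u = 1" for m
          by (simp add: cutoff_def bump_eq_1)
        then show ?thesis using True by simp
      next
        case False
        obtain N where N: "1 / (norm u - 1) < real N" using reals_Archimedean2 by blast
        have "cutoff (1 / (real m + 1)) u = 0" if "m \<ge> N" for m
        proof (rule cutoff_support)
          have "1 / (norm u - 1) < real m + 1" using N that by simp
          then show "1 + 1 / (real m + 1) < norm u" using False by (simp add: field_simps)
        qed simp
        then have "\<forall>\<^sub>F m in sequentially. cutoff (1 / (real m + 1)) u = 0"
          by (auto simp: eventually_sequentially)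
        then show ?thesis using False by (simp add: tendsto_eventually)
      qed
    qed
    show "AE u in lborel. norm (cutoff (1 / (real m + 1)) u * k u) \<le> indicator (cball 0 2) u * \<bar>k u\<bar>" for m
    proof (rule AE_I2)
      fix u :: "real^'n"
      show "norm (cutoff (1 / (real m + 1)) u * k u) \<le> indicator (cball 0 2) u * \<bar>k u\<bar>"
      proof (cases "norm u \<le> 2")
        case True
        have "\<bar>cutoff (1 / (real m + 1)) u\<bar> \<le> 1" using bump_bounds by (simp add: cutoff_def)
        then show ?thesis using True by (simp add: abs_mult mult_left_le_one_le)
      next
        case False
        have "1 / (real m + 1) \<le> 1" by simp
        then have "1 + 1 / (real m + 1) < norm u" using False by linarith
        then show ?thesis using False by (simp add: cutoff_support)
      qed
    qed
  qed measurable
  also have "(\<integral>u. indicator (cball 0 1) u * k u \<partial>lborel) = ?v * (\<integral>u. k u \<partial>uball)"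
    using v by (simp add: integral_uball)
  finally show ?thesis .
qed


text \<open>At positive width the remainder contains the mass of the shell and the linear term is an
  integral over the shell. They converge to the surface area, which is \<open>n\<close> times the
  volume of the ball, and to a sphere integral; \<open>n / sqrt n\<close> then gives the
  constant.\<close>

lemma ball_average_taylor:
  fixes F :: "real^'n \<Rightarrow> real"
  assumes F: "L-lipschitz_on UNIV F"
  shows "\<bar>(\<integral>u. F (x + h + u) \<partial>uball) - (\<integral>u. F (x + u) \<partial>uball)
      - CARD('n) * (\<integral>t. (t \<bullet> h) * F (x + t) \<partial>sphere_measure)\<bar> \<le> sqrt CARD('n) * L * (norm h)\<^sup>2 / 2"
proof -
  let ?n = "real CARD('n)"
  let ?v = "measure lborel (cball (0::real^'n) 1)"
  have v: "?v > 0" by simp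
  have n: "?n > 0" by simp
  have L0: "0 \<le> L" using F by (rule lipschitz_on_nonneg)
  have cF: "continuous_on UNIV F" using F by (rule lipschitz_on_continuous_on)
  have Fm[measurable]: "F \<in> borel_measurable borel" using cF by (rule borel_measurable_continuous_onI)
  have cont: "continuous_on UNIV (\<lambda>u. F (a + u))" for a
    by (rule continuous_on_compose2[OF cF]) (auto intro!: continuous_intros)
  define e where "e m = 1 / (real m + 1)" for m :: nat
  have e: "0 < e m" for m by (simp add: e_def)
  have e0: "e \<longlonglongrightarrow> 0"
    unfolding e_def using LIMSEQ_inverse_real_of_nat by (simp add: inverse_eq_divide add.commute)
  define c where "c m = (\<integral>u. shell (e m) (norm u) \<partial>(lborel::(real^'n) measure))" for m
  define r where "r m = (\<integral>u. shell (e m) (norm u) * norm u \<partial>(lborel::(real^'n) measure))" for m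
  have ci: "integrable lborel (\<lambda>u::real^'n. shell (e m) (norm u))" for m
    using integrable_shell(1)[OF e, of "\<lambda>_. 1"] by simp
  have ri: "integrable lborel (\<lambda>u::real^'n. shell (e m) (norm u) * norm u)" for m
    by (rule integrable_shell(1)[OF e]) (intro continuous_intros)
  have c0: "0 \<le> c m" for m unfolding c_def using shell_nonneg[OF e] by simp
  \<comment> \<open>On the shell \<open>1 \<le> norm u \<le> 1 + e\<close>, so its mass
    \<open>c\<close> and its weighted mass \<open>r\<close> differ at most by the factor
    \<open>1 + e\<close>. As \<open>r\<close> is known from \<open>shell_mass\<close>, the limit of
    \<open>c\<close> follows by squeezing.\<close>
  have cr: "c m \<le> r m" "r m \<le> (1 + e m) * c m" for m
  proof -
    have *: "shell (e m) (norm u) \<le> shell (e m) (norm u) * norm u \<and>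
        shell (e m) (norm u) * norm u \<le> (1 + e m) * shell (e m) (norm u)" for u :: "real^'n"
    proof (cases "1 \<le> norm u \<and> norm u \<le> 1 + e m")
      case True
      then show ?thesis
        using mult_left_mono[of 1 "norm u" "shell (e m) (norm u)"]
          mult_left_mono[of "norm u" "1 + e m" "shell (e m) (norm u)"] shell_nonneg[OF e]
        by (auto simp: mult.commute)
    next
      case False
      then show ?thesis using shell_support[OF e, of "norm u" m] by auto
    qed
    show "c m \<le> r m" unfolding c_def r_def by (rule integral_mono[OF ci ri]) (use * in auto)
    have "r m \<le> (\<integral>u. (1 + e m) * shell (e m) (norm u) \<partial>(lborel::(real^'n) measure))"
      unfolding r_def by (rule integral_mono[OF ri]) (use * ci in auto)
    then show "r m \<le> (1 + e m) * c m" by (simp add: c_def)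
  qed
  have r: "r \<longlonglongrightarrow> ?n * ?v"
  proof -
    have "r = (\<lambda>m. ?n * (\<integral>u. cutoff (1 / (real m + 1)) (u::real^'n) * 1 \<partial>lborel))"
      unfolding r_def shell_mass[OF e] by (simp add: e_def)
    moreover have "(\<integral>u. 1 \<partial>(uball :: (real^'n) measure)) = (1::real)"
      using prob_space.prob_space[OF prob_space_uball[where 'n='n]] by simp
    ultimately show ?thesis
      using tendsto_mult[OF tendsto_const[of ?n] cutoff_limit[OF continuous_on_const[of "UNIV :: (real^'n) set" "1::real"]]]
      by (simp only: mult_1_right)
  qed
  have c: "c \<longlonglongrightarrow> ?n * ?v"
  proof (rule tendsto_sandwich[OF _ _ _ r])
    have "(\<lambda>m. r m / (1 + e m)) \<longlonglongrightarrow> ?n * ?v / (1 + 0)"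
      by (intro tendsto_intros r e0) simp
    then show "(\<lambda>m. r m / (1 + e m)) \<longlonglongrightarrow> ?n * ?v" by simp
    have "r m / (1 + e m) \<le> c m" for m
      using cr(2)[of m] e[of m] by (simp add: divide_le_eq mult.commute add_pos_pos)
    then show "\<forall>\<^sub>F m in sequentially. r m / (1 + e m) \<le> c m" by simp
  qed (use cr in auto)
  define S where "S = (\<integral>t. (t \<bullet> h) * F (x + t) \<partial>sphere_measure)"
  define g where "g m = (\<integral>u. shell (e m) (norm u) * (sgn u \<bullet> h) * F (x + u) \<partial>lborel)" for m
  have gi: "integrable lborel (\<lambda>u. shell (e m) (norm u) * (sgn u \<bullet> h) * F (x + u))" for m
    by (rule integrable_shell(2)[OF e cont])
  \<comment> \<open>Replacing \<open>F (x + u)\<close> by \<open>F (x + sgn u)\<close> costs at most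
    \<open>L * (norm u - 1)\<close>, with total weight \<open>r - c\<close> on the shell; after the
    replacement polar coordinates produce the sphere integral exactly.\<close>
  have gb: "\<bar>g m - c m * S\<bar> \<le> norm h * L * (r m - c m)" for m
  proof -
    let ?w = "\<lambda>u::real^'n. shell (e m) (norm u) * ((sgn u \<bullet> h) * F (x + sgn u))"
    have S: "c m * S = (\<integral>u. ?w u \<partial>lborel)"
      using polar_integral[of "\<lambda>t. (t \<bullet> h) * F (x + t)" "shell (e m)"] ci shell_nonneg[OF e]
      by (simp add: S_def c_def)
    have wi: "integrable lborel ?w"
    proof (rule Bochner_Integration.integrable_bound)
      let ?C = "norm h * (\<bar>F x\<bar> + L)"
      show "integrable lborel (\<lambda>u::real^'n. ?C * shell (e m) (norm u))"
        by (intro integrable_mult_right ci)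
      show "AE u in lborel. norm (?w u) \<le> norm (?C * shell (e m) (norm u))"
      proof (rule AE_I2)
        fix u :: "real^'n"
        have a: "\<bar>sgn u \<bullet> h\<bar> \<le> norm h"
          using Cauchy_Schwarz_ineq2[of "sgn u" h] by (cases "u = 0") (simp_all add: norm_sgn)
        have "\<bar>F (x + sgn u) - F x\<bar> \<le> L * norm (sgn u)"
          using lipschitz_onD[OF F, of "x + sgn u" x] by (simp add: dist_norm)
        moreover have "L * norm (sgn u) \<le> L" using L0 by (simp add: norm_sgn)
        ultimately have "\<bar>F (x + sgn u)\<bar> \<le> \<bar>F x\<bar> + L" by linarith
        with a have "\<bar>sgn u \<bullet> h\<bar> * \<bar>F (x + sgn u)\<bar> \<le> ?C" by (intro mult_mono) auto
        then have "shell (e m) (norm u) * (\<bar>sgn u \<bullet> h\<bar> * \<bar>F (x + sgn u)\<bar>) \<le> shell (e m) (norm u) * ?C"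
          by (rule mult_left_mono) (rule shell_nonneg[OF e])
        then show "norm (?w u) \<le> norm (?C * shell (e m) (norm u))"
          using shell_nonneg[OF e, of m "norm u"] L0 by (simp add: abs_mult ac_simps)
      qed
    qed measurable
    have "g m - c m * S = (\<integral>u. shell (e m) (norm u) * (sgn u \<bullet> h) * F (x + u) - ?w u \<partial>lborel)"
      unfolding g_def S by (rule Bochner_Integration.integral_diff[symmetric, OF gi wi])
    also have "\<bar>\<dots>\<bar> \<le> (\<integral>u. norm h * L * (shell (e m) (norm u) * norm u - shell (e m) (norm u)) \<partial>(lborel :: (real^'n) measure))"
    proof (rule integral_abs_bound_integral)
      fix u :: "real^'n"
      show "\<bar>shell (e m) (norm u) * (sgn u \<bullet> h) * F (x + u) - ?w u\<bar>
          \<le> norm h * L * (shell (e m) (norm u) * norm u - shell (e m) (norm u))"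
      proof (cases "1 \<le> norm u")
        case True
        then have "u \<noteq> 0" by auto
        then have "u = norm u *\<^sub>R sgn u" by (simp add: sgn_div_norm)
        then have "u - sgn u = (norm u - 1) *\<^sub>R sgn u" by (metis scaleR_left_diff_distrib scaleR_one)
        moreover have ns: "norm (sgn u) = 1" using True by (auto simp: norm_sgn)
        ultimately have "norm (u - sgn u) = norm u - 1" using True by simp
        then have 1: "\<bar>F (x + u) - F (x + sgn u)\<bar> \<le> L * (norm u - 1)"
          using lipschitz_onD[OF F, of "x + u" "x + sgn u"] by (simp add: dist_norm)
        have 2: "\<bar>sgn u \<bullet> h\<bar> \<le> norm h"
          using Cauchy_Schwarz_ineq2[of "sgn u" h] ns by simp
        have "\<bar>sgn u \<bullet> h\<bar> * \<bar>F (x + u) - F (x + sgn u)\<bar> \<le> norm h * (L * (norm u - 1))"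
          by (rule mult_mono[OF 2 1]) auto
        then have "shell (e m) (norm u) * (\<bar>sgn u \<bullet> h\<bar> * \<bar>F (x + u) - F (x + sgn u)\<bar>)
            \<le> shell (e m) (norm u) * (norm h * (L * (norm u - 1)))"
          by (rule mult_left_mono) (rule shell_nonneg[OF e])
        moreover have "\<bar>shell (e m) (norm u) * (sgn u \<bullet> h) * F (x + u) - ?w u\<bar>
            = shell (e m) (norm u) * (\<bar>sgn u \<bullet> h\<bar> * \<bar>F (x + u) - F (x + sgn u)\<bar>)"
        proof -
          have eq: "shell (e m) (norm u) * (sgn u \<bullet> h) * F (x + u) - ?w u
              = shell (e m) (norm u) * ((sgn u \<bullet> h) * (F (x + u) - F (x + sgn u)))"
            by (simp add: algebra_simps)
          show ?thesis
            unfolding eq using shell_nonneg[OF e, of m "norm u"] by (simp add: abs_mult)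
        qed
        ultimately show ?thesis by (simp add: algebra_simps)
      next
        case False
        then show ?thesis using shell_support[OF e, of "norm u" m] by simp
      qed
    qed (auto intro!: gi wi ci ri)
    also have "\<dots> = norm h * L * (r m - c m)"
      unfolding r_def c_def using ci ri by simp
    finally show ?thesis .
  qed
  have g: "g \<longlonglongrightarrow> ?n * ?v * S"
  proof -
    have "(\<lambda>m. g m - c m * S) \<longlonglongrightarrow> 0"
    proof (rule Lim_null_comparison)
      show "\<forall>\<^sub>F m in sequentially. norm (g m - c m * S) \<le> norm h * L * (r m - c m)"
        using gb by simp
      have "(\<lambda>m. norm h * L * (r m - c m)) \<longlonglongrightarrow> norm h * L * (?n * ?v - ?n * ?v)"
        by (intro tendsto_intros r c)
      then show "(\<lambda>m. norm h * L * (r m - c m)) \<longlonglongrightarrow> 0" by simp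
    qed
    then have "(\<lambda>m. (g m - c m * S) + c m * S) \<longlonglongrightarrow> 0 + ?n * ?v * S"
      by (intro tendsto_intros c)
    then show ?thesis by simp
  qed
  have "\<bar>?v * (\<integral>u. F (x + h + u) \<partial>uball) - ?v * (\<integral>u. F (x + u) \<partial>uball) - ?n * ?v * S\<bar>
      \<le> (L * (norm h)\<^sup>2 / sqrt ?n * (?n * ?v)) / 2"
  proof (rule LIMSEQ_le)
    show "(\<lambda>m. \<bar>(\<integral>u. cutoff (1 / (real m + 1)) u * F (x + h + u) \<partial>lborel)
        - (\<integral>u. cutoff (1 / (real m + 1)) u * F (x + u) \<partial>lborel) - g m\<bar>)
      \<longlonglongrightarrow> \<bar>?v * (\<integral>u. F (x + h + u) \<partial>uball) - ?v * (\<integral>u. F (x + u) \<partial>uball) - ?n * ?v * S\<bar>"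
      by (intro tendsto_intros cutoff_limit g cont)
    show "(\<lambda>m. (L * (norm h)\<^sup>2 / sqrt ?n * c m) / 2) \<longlonglongrightarrow> (L * (norm h)\<^sup>2 / sqrt ?n * (?n * ?v)) / 2"
      by (intro tendsto_intros c) simp
    show "\<exists>N. \<forall>m\<ge>N. \<bar>(\<integral>u. cutoff (1 / (real m + 1)) u * F (x + h + u) \<partial>lborel)
        - (\<integral>u. cutoff (1 / (real m + 1)) u * F (x + u) \<partial>lborel) - g m\<bar> \<le> (L * (norm h)\<^sup>2 / sqrt ?n * c m) / 2"
      using cutoff_taylor[OF e F] by (auto simp: g_def c_def e_def)
  qed
  also have "\<dots> = ?v * (sqrt ?n * L * (norm h)\<^sup>2 / 2)"
    using n real_sqrt_mult_self[of ?n] by (simp add: field_simps)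
  also have "?v * (\<integral>u. F (x + h + u) \<partial>uball) - ?v * (\<integral>u. F (x + u) \<partial>uball) - ?n * ?v * S
      = ?v * ((\<integral>u. F (x + h + u) \<partial>uball) - (\<integral>u. F (x + u) \<partial>uball) - ?n * S)"
    by (simp add: algebra_simps)
  finally show ?thesis using v unfolding S_def[symmetric] by (simp add: abs_mult)
qed

section \<open>Smoothing at radius eta: Taylor estimate, gradient, comparison with the original
  function\<close>

lemma lipschitz_on_rescale:
  fixes F :: "'a::real_normed_vector \<Rightarrow> real"
  assumes "L-lipschitz_on UNIV F" "0 \<le> c"
  shows "(c * L)-lipschitz_on UNIV (\<lambda>x. F (c *\<^sub>R x))"
proof (rule lipschitz_onI)
  fix x y
  have "dist (F (c *\<^sub>R x)) (F (c *\<^sub>R y)) \<le> L * dist (c *\<^sub>R x) (c *\<^sub>R y)"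
    using assms by (auto intro: lipschitz_onD)
  also have "dist (c *\<^sub>R x) (c *\<^sub>R y) = c * dist x y"
    using assms(2) by (simp add: dist_norm flip: scaleR_diff_right)
  finally show "dist (F (c *\<^sub>R x)) (F (c *\<^sub>R y)) \<le> c * L * dist x y" by (simp add: ac_simps)
qed (use assms lipschitz_on_nonneg[OF assms(1)] in simp)

definition ball_gradient :: "(real^'n \<Rightarrow> real) \<Rightarrow> real \<Rightarrow> real^'n \<Rightarrow> real^'n" where
  "ball_gradient F eta x = (CARD('n) / eta) *\<^sub>R (\<integral>t. F (x + eta *\<^sub>R t) *\<^sub>R t \<partial>sphere_measure)"

lemma integrable_sphere_continuous:
  fixes k :: "real^'n \<Rightarrow> 'b::{banach, second_countable_topology}"
  assumes "continuous_on UNIV k"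
  shows "integrable sphere_measure k"
proof -
  interpret prob_space "sphere_measure :: (real^'n) measure" by (rule prob_space_sphere)
  have "compact (k ` cball 0 1)"
    by (intro compact_continuous_image continuous_on_subset[OF assms]) auto
  then obtain B where B: "\<And>t. t \<in> cball 0 1 \<Longrightarrow> norm (k t) \<le> B"
    by (metis bounded_iff compact_imp_bounded imageI)
  show ?thesis
  proof (rule integrable_const_bound[where B=B])
    show "AE t in sphere_measure. norm (k t) \<le> B"
      using AE_sphere_measure by eventually_elim (use B in auto)
    show "k \<in> borel_measurable sphere_measure"
      using borel_measurable_continuous_onI[OF assms] by simp
  qed
qed

text \<open>The unit-ball estimate for \<open>F (eta *\<^sub>R z)\<close>: rescaling multiplies the
  Lipschitz constant by \<open>eta\<close> and the squared increment by
  \<open>1 / eta^2\<close>.\<close>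

lemma smoothed_taylor:
  fixes F :: "real^'n \<Rightarrow> real"
  assumes F: "L-lipschitz_on UNIV F" and eta: "0 < eta"
  shows "\<bar>smoothed F eta y - smoothed F eta x - ball_gradient F eta x \<bullet> (y - x)\<bar>
    \<le> sqrt CARD('n) * L / eta * (norm (y - x))\<^sup>2 / 2"
proof -
  let ?G = "\<lambda>z. F (eta *\<^sub>R z)"
  have cF: "continuous_on UNIV F" using F by (rule lipschitz_on_continuous_on)
  have sm: "smoothed F eta z = (\<integral>u. ?G ((1/eta) *\<^sub>R z + u) \<partial>uball)" for z
    using eta by (simp add: smoothed_def scaleR_add_right)
  have i: "integrable sphere_measure (\<lambda>t. F (x + eta *\<^sub>R t) *\<^sub>R t)"
    by (rule integrable_sphere_continuous) (auto intro!: continuous_intros continuous_on_compose2[OF cF])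
  have "ball_gradient F eta x \<bullet> (y - x) = CARD('n) / eta * (\<integral>t. F (x + eta *\<^sub>R t) * (t \<bullet> (y - x)) \<partial>sphere_measure)"
    unfolding ball_gradient_def using i by (simp flip: integral_inner_left)
  also have "\<dots> = CARD('n) * (\<integral>t. (t \<bullet> (1/eta) *\<^sub>R (y - x)) * ?G ((1/eta) *\<^sub>R x + t) \<partial>sphere_measure)"
    using eta by (simp add: scaleR_add_right mult.commute)
  finally have g: "ball_gradient F eta x \<bullet> (y - x)
    = CARD('n) * (\<integral>t. (t \<bullet> (1/eta) *\<^sub>R (y - x)) * ?G ((1/eta) *\<^sub>R x + t) \<partial>sphere_measure)" .
  have y: "(1/eta) *\<^sub>R y = (1/eta) *\<^sub>R x + (1/eta) *\<^sub>R (y - x)"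
    by (simp add: scaleR_diff_right)
  have "\<bar>smoothed F eta y - smoothed F eta x - ball_gradient F eta x \<bullet> (y - x)\<bar>
    \<le> sqrt CARD('n) * (eta * L) * (norm ((1/eta) *\<^sub>R (y - x)))\<^sup>2 / 2"
    unfolding sm g y
    by (rule ball_average_taylor) (use lipschitz_on_rescale[OF F] eta in auto)
  also have "\<dots> = sqrt CARD('n) * L / eta * (norm (y - x))\<^sup>2 / 2"
    using eta by (simp only: norm_scaleR) (simp add: power2_eq_square field_simps)
  finally show ?thesis .
qed

lemma integrable_uball_continuous:
  fixes k :: "real^'n \<Rightarrow> 'b::{banach, second_countable_topology}"
  assumes "continuous_on UNIV k"
  shows "integrable uball k"
proof -
  interpret prob_space "uball :: (real^'n) measure" by (rule prob_space_uball)
  have "compact (k ` cball 0 1)"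
    by (intro compact_continuous_image continuous_on_subset[OF assms]) auto
  then obtain B where B: "\<And>t. t \<in> cball 0 1 \<Longrightarrow> norm (k t) \<le> B"
    by (metis bounded_iff compact_imp_bounded imageI)
  show ?thesis
  proof (rule integrable_const_bound[where B=B])
    show "AE t in uball. norm (k t) \<le> B"
      using AE_uball by eventually_elim (use B in auto)
    show "k \<in> borel_measurable uball"
      using borel_measurable_continuous_onI[OF assms] by (simp add: uniform_measure_def)
  qed
qed

lemma (in prob_space) integral_diff_le:
  fixes f g :: "'a \<Rightarrow> real"
  assumes "integrable M f" "integrable M g" "AE x in M. \<bar>f x - g x\<bar> \<le> B"
  shows "\<bar>(\<integral>x. f x \<partial>M) - (\<integral>x. g x \<partial>M)\<bar> \<le> B"
proof -
  have "\<bar>(\<integral>x. f x \<partial>M) - (\<integral>x. g x \<partial>M)\<bar> = \<bar>\<integral>x. f x - g x \<partial>M\<bar>"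
    using assms by simp
  also have "\<dots> \<le> (\<integral>x. \<bar>f x - g x\<bar> \<partial>M)"
    by (rule integral_abs_bound)
  also have "\<dots> \<le> (\<integral>x. B \<partial>M)"
    using assms by (intro integral_mono_AE) auto
  finally show ?thesis by (simp add: prob_space)
qed

lemma smoothed_lipschitz:
  fixes F :: "real^'n \<Rightarrow> real"
  assumes F: "L-lipschitz_on UNIV F"
  shows "L-lipschitz_on UNIV (smoothed F eta)"
proof (rule lipschitz_onI)
  interpret prob_space "uball :: (real^'n) measure" by (rule prob_space_uball)
  have cF: "continuous_on UNIV F" using F by (rule lipschitz_on_continuous_on)
  have i: "integrable uball (\<lambda>u. F (x + eta *\<^sub>R u))" for x
    by (rule integrable_uball_continuous) (auto intro!: continuous_intros continuous_on_compose2[OF cF])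
  show "0 \<le> L" using F by (rule lipschitz_on_nonneg)
  fix x y :: "real^'n"
  show "dist (smoothed F eta x) (smoothed F eta y) \<le> L * dist x y"
    unfolding dist_real_def smoothed_def
  proof (rule integral_diff_le[OF i i], rule AE_I2)
    fix u :: "real^'n"
    show "\<bar>F (x + eta *\<^sub>R u) - F (y + eta *\<^sub>R u)\<bar> \<le> L * dist x y"
      using lipschitz_onD[OF F, of "x + eta *\<^sub>R u" "y + eta *\<^sub>R u"] by (simp add: dist_norm)
  qed
qed

lemma smoothed_close:
  fixes F :: "real^'n \<Rightarrow> real"
  assumes F: "L-lipschitz_on UNIV F" and eta: "0 \<le> eta"
  shows "\<bar>smoothed F eta x - F x\<bar> \<le> L * eta"
proof -
  interpret prob_space "uball :: (real^'n) measure" by (rule prob_space_uball)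
  have cF: "continuous_on UNIV F" using F by (rule lipschitz_on_continuous_on)
  have i: "integrable uball (\<lambda>u. F (x + eta *\<^sub>R u))"
    by (rule integrable_uball_continuous) (auto intro!: continuous_intros continuous_on_compose2[OF cF])
  have "\<bar>smoothed F eta x - (\<integral>u. F x \<partial>(uball :: (real^'n) measure))\<bar> \<le> L * eta"
    unfolding smoothed_def
  proof (rule integral_diff_le[OF i])
    show "AE u in uball. \<bar>F (x + eta *\<^sub>R u) - F x\<bar> \<le> L * eta"
      using AE_uball
    proof eventually_elim
      case (elim u)
      have "\<bar>F (x + eta *\<^sub>R u) - F x\<bar> \<le> L * (eta * norm u)"
        using lipschitz_onD[OF F, of "x + eta *\<^sub>R u" x] eta by (simp add: dist_norm)
      also have "\<dots> \<le> L * (eta * 1)"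
        using elim eta lipschitz_on_nonneg[OF F] by (intro mult_left_mono) auto
      finally show ?case by simp
    qed
  qed simp
  then show ?thesis using prob_space by simp
qed

text \<open>Serves for the continuity and hence measurability of the gradient field; the smoothness
  constant of the descent estimate comes from \<open>smoothed_taylor\<close>.\<close>

lemma ball_gradient_lipschitz:
  fixes F :: "real^'n \<Rightarrow> real"
  assumes F: "L-lipschitz_on UNIV F" and eta: "0 < eta"
  shows "(CARD('n) / eta * L)-lipschitz_on UNIV (ball_gradient F eta)"
proof (rule lipschitz_onI)
  interpret prob_space "sphere_measure :: (real^'n) measure" by (rule prob_space_sphere)
  have cF: "continuous_on UNIV F" using F by (rule lipschitz_on_continuous_on)
  have L0: "0 \<le> L" using F by (rule lipschitz_on_nonneg)
  show "0 \<le> CARD('n) / eta * L" using eta L0 by simp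
  fix x y :: "real^'n"
  have i: "integrable sphere_measure (\<lambda>t. F (x + eta *\<^sub>R t) *\<^sub>R t)" for x
    by (rule integrable_sphere_continuous) (auto intro!: continuous_intros continuous_on_compose2[OF cF])
  have "norm ((\<integral>t. F (x + eta *\<^sub>R t) *\<^sub>R t \<partial>sphere_measure) - (\<integral>t. F (y + eta *\<^sub>R t) *\<^sub>R t \<partial>sphere_measure))
      = norm (\<integral>t. F (x + eta *\<^sub>R t) *\<^sub>R t - F (y + eta *\<^sub>R t) *\<^sub>R t \<partial>sphere_measure)"
    using i by simp
  also have "\<dots> \<le> (\<integral>t. norm (F (x + eta *\<^sub>R t) *\<^sub>R t - F (y + eta *\<^sub>R t) *\<^sub>R t) \<partial>sphere_measure)"
    by (rule integral_norm_bound)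
  also have "\<dots> \<le> (\<integral>t. L * dist x y \<partial>(sphere_measure :: (real^'n) measure))"
  proof (rule integral_mono_AE)
    show "AE t in sphere_measure. norm (F (x + eta *\<^sub>R t) *\<^sub>R t - F (y + eta *\<^sub>R t) *\<^sub>R t) \<le> L * dist x y"
      using AE_sphere_measure
    proof eventually_elim
      case (elim t)
      then show ?case
        using lipschitz_onD[OF F, of "x + eta *\<^sub>R t" "y + eta *\<^sub>R t"]
        by (simp add: dist_norm flip: scaleR_diff_left)
    qed
  qed (use i in auto)
  also have "\<dots> = L * dist x y" using prob_space by simp
  finally have *: "norm ((\<integral>t. F (x + eta *\<^sub>R t) *\<^sub>R t \<partial>sphere_measure) - (\<integral>t. F (y + eta *\<^sub>R t) *\<^sub>R t \<partial>sphere_measure))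
      \<le> L * dist x y" .
  have "dist (ball_gradient F eta x) (ball_gradient F eta y) = CARD('n) / eta *
     norm ((\<integral>t. F (x + eta *\<^sub>R t) *\<^sub>R t \<partial>sphere_measure) - (\<integral>t. F (y + eta *\<^sub>R t) *\<^sub>R t \<partial>sphere_measure))"
    unfolding ball_gradient_def dist_norm scaleR_diff_right[symmetric] using eta by simp
  also have "\<dots> \<le> CARD('n) / eta * (L * dist x y)"
    using eta by (intro mult_left_mono *) simp
  finally show "dist (ball_gradient F eta x) (ball_gradient F eta y) \<le> CARD('n) / eta * L * dist x y"
    by simp
qed

lemma taylor_imp_has_derivative:
  fixes G :: "'a::real_inner \<Rightarrow> real"
  assumes "\<And>y. y \<in> S \<Longrightarrow> \<bar>G y - G x - g \<bullet> (y - x)\<bar> \<le> C * (norm (y - x))\<^sup>2"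
  shows "(G has_derivative (\<lambda>h. g \<bullet> h)) (at x within S)"
proof -
  have "((\<lambda>y. (G y - (G x + g \<bullet> (y - x))) / norm (y - x)) \<longlongrightarrow> 0) (at x within S)"
  proof (rule Lim_null_comparison)
    show "\<forall>\<^sub>F y in at x within S. norm ((G y - (G x + g \<bullet> (y - x))) / norm (y - x)) \<le> C * norm (y - x)"
      unfolding eventually_at_topological
    proof (intro exI[of _ UNIV] conjI ballI impI)
      fix y assume "y \<noteq> x" "y \<in> S"
      then show "norm ((G y - (G x + g \<bullet> (y - x))) / norm (y - x)) \<le> C * norm (y - x)"
        using assms[of y] by (simp add: divide_le_eq power2_eq_square diff_diff_eq)
    qed auto
    have "((\<lambda>y. C * norm (y - x)) \<longlongrightarrow> C * norm (x - x)) (at x within S)"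
      by (intro tendsto_intros)
    then show "((\<lambda>y. C * norm (y - x)) \<longlongrightarrow> 0) (at x within S)" by simp
  qed
  then show ?thesis
    unfolding has_derivative_within
    by (simp add: bounded_linear_inner_right)
qed

lemma smoothed_has_derivative:
  fixes F :: "real^'n \<Rightarrow> real"
  assumes F: "L-lipschitz_on UNIV F" and eta: "0 < eta"
  shows "(smoothed F eta has_derivative (\<lambda>h. ball_gradient F eta x \<bullet> h)) (at x within S)"
  by (rule taylor_imp_has_derivative[where C="sqrt CARD('n) * L / eta / 2"])
     (use smoothed_taylor[OF F eta] in simp)

text \<open>Estimating the sphere integral directly would bring in the dimension. Instead, a short
  step along the gradient raises the smoothing, itself \<open>L\<close>-Lipschitz, by
  \<open>norm g\<close> per unit length up to the quadratic remainder.\<close>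

lemma norm_ball_gradient_le:
  fixes F :: "real^'n \<Rightarrow> real"
  assumes F: "L-lipschitz_on UNIV F" and eta: "0 < eta"
  shows "norm (ball_gradient F eta x) \<le> L"
proof (rule field_le_epsilon)
  fix e :: real assume e: "0 < e"
  let ?g = "ball_gradient F eta x"
  define C where "C = sqrt CARD('n) * L / eta / 2"
  have L0: "0 \<le> L" using F by (rule lipschitz_on_nonneg)
  have C0: "0 \<le> C" using L0 eta by (simp add: C_def)
  show "norm ?g \<le> L + e"
  proof (cases "?g = 0")
    case False
    \<comment> \<open>Short enough for the quadratic remainder to contribute at most
      \<open>e\<close>; \<open>C + 1\<close> in place of \<open>C\<close> avoids a zero
      denominator.\<close>
    define s where "s = e / ((C + 1) * norm ?g)"
    have s: "0 < s" using e C0 False by (auto simp: s_def intro!: divide_pos_pos mult_pos_pos)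
    have "?g \<bullet> (s *\<^sub>R ?g) \<le> \<bar>smoothed F eta (x + s *\<^sub>R ?g) - smoothed F eta x\<bar> + C * (norm (s *\<^sub>R ?g))\<^sup>2"
      using smoothed_taylor[OF F eta, of "x + s *\<^sub>R ?g" x] by (simp add: C_def)
    also have "\<bar>smoothed F eta (x + s *\<^sub>R ?g) - smoothed F eta x\<bar> \<le> L * norm (s *\<^sub>R ?g)"
      using lipschitz_onD[OF smoothed_lipschitz[OF F], of "x + s *\<^sub>R ?g" x eta] by (simp add: dist_norm)
    finally have "s * norm ?g * norm ?g \<le> s * norm ?g * (L + C * s * norm ?g)"
      using s by (simp add: dot_square_norm power2_eq_square algebra_simps)
    then have "norm ?g \<le> L + C * s * norm ?g"
      using s False by simp
    also have "C * s * norm ?g = C / (C + 1) * e"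
      using False C0 by (simp add: s_def add_nonneg_eq_0_iff)
    also have "\<dots> \<le> 1 * e"
      using C0 e by (intro mult_right_mono) (auto simp: divide_le_eq)
    finally show ?thesis by simp
  qed (use L0 e in simp)
qed

subsection \<open>Odd functions on the sphere\<close>

text \<open>Cauchy-Schwarz against a constant, from integrating \<open>(f t - c)^2 \<ge> 0\<close>
  with \<open>c\<close> the mean of \<open>f\<close>.\<close>

lemma integral_square_le:
  fixes f :: "real \<Rightarrow> real"
  assumes f: "continuous_on {a..b} f" and ab: "a < b"
  shows "(integral {a..b} f)\<^sup>2 \<le> (b - a) * integral {a..b} (\<lambda>t. (f t)\<^sup>2)"
proof -
  define c where "c = integral {a..b} f / (b - a)"
  have i: "f integrable_on {a..b}" "(\<lambda>t. (f t)\<^sup>2) integrable_on {a..b}"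
    using f by (auto intro!: integrable_continuous_real continuous_intros)
  have "integral {a..b} (\<lambda>t. 2 * c * f t - c\<^sup>2) \<le> integral {a..b} (\<lambda>t. (f t)\<^sup>2)"
  proof (rule integral_le)
    show "(\<lambda>t. 2 * c * f t - c\<^sup>2) integrable_on {a..b}"
      using f by (auto intro!: integrable_continuous_real continuous_intros)
    show "2 * c * f t - c\<^sup>2 \<le> (f t)\<^sup>2" for t
      using zero_le_power2[of "f t - c"] unfolding power2_diff by (simp add: algebra_simps)
  qed (rule i)
  also have "integral {a..b} (\<lambda>t. 2 * c * f t - c\<^sup>2) = 2 * c * integral {a..b} f - c\<^sup>2 * (b - a)"
  proof -
    have "(\<lambda>t. 2 * c * f t) integrable_on {a..b}"
      using f by (auto intro!: integrable_continuous_real continuous_intros)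
    from Henstock_Kurzweil_Integration.integral_diff[OF this integrable_const_ivl[of "c\<^sup>2"]]
    show ?thesis using ab by simp
  qed
  also have "\<dots> = (integral {a..b} f)\<^sup>2 / (b - a)"
  proof -
    have cb: "c * (b - a) = integral {a..b} f" using ab by (simp add: c_def)
    have "2 * c * integral {a..b} f - c\<^sup>2 * (b - a) = c * integral {a..b} f"
      unfolding power2_eq_square mult.assoc cb by simp
    then show ?thesis by (simp add: c_def power2_eq_square)
  qed
  finally show ?thesis using ab by (simp add: field_simps)
qed

text \<open>The second component is the time derivative of the first, so that \<open>rot t z\<close>
  carries position and velocity of the path.\<close>

definition rot :: "real \<Rightarrow> 'a::euclidean_space \<times> 'a \<Rightarrow> 'a \<times> 'a" where
  "rot t z = (cos t *\<^sub>R fst z + sin t *\<^sub>R snd z, cos t *\<^sub>R snd z - sin t *\<^sub>R fst z)"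

lemma orthogonal_transformation_rot: "orthogonal_transformation (rot t)"
  unfolding orthogonal_transformation
proof (intro conjI allI)
  show "linear (rot t)"
    by (rule linearI) (auto simp: rot_def algebra_simps)
  fix z :: "'a \<times> 'a"
  have "(c *\<^sub>R x + s *\<^sub>R y) \<bullet> (c *\<^sub>R x + s *\<^sub>R y) + (c *\<^sub>R y - s *\<^sub>R x) \<bullet> (c *\<^sub>R y - s *\<^sub>R x)
      = (c\<^sup>2 + s\<^sup>2) * (x \<bullet> x + y \<bullet> y)" for x y :: 'a and c s :: real
    by (simp add: inner_add_left inner_add_right inner_diff_left inner_diff_right
        inner_commute power2_eq_square algebra_simps)
  from this[of "cos t" "fst z" "sin t" "snd z"]
  show "norm (rot t z) = norm z"
    by (simp add: rot_def norm_eq_sqrt_inner inner_prod_def)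
qed

text \<open>The fundamental theorem of calculus along the path, then Cauchy-Schwarz on
  \<open>[0, pi]\<close>, which costs one factor \<open>pi\<close>; the second one in
  \<open>pi^2\<close> is the length of the time interval when the average no longer depends on
  time.\<close>

lemma rotation_path_bound:
  fixes G :: "'a::euclidean_space \<Rightarrow> real"
  assumes d: "\<And>x. (G has_derivative (\<lambda>h. g x \<bullet> h)) (at x)" and g: "continuous_on UNIV g"
  shows "ennreal ((G (- fst z) - G (fst z))\<^sup>2)
    \<le> ennreal pi * (\<integral>\<^sup>+t. indicator {0..pi} t * ennreal ((g (fst (rot t z)) \<bullet> snd (rot t z))\<^sup>2) \<partial>lborel)"
proof -
  let ?f = "\<lambda>t. g (fst (rot t z)) \<bullet> snd (rot t z)"
  have cf: "continuous_on UNIV ?f"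
    unfolding rot_def by (auto intro!: continuous_intros continuous_on_compose2[OF g])
  have "(?f has_integral (G (fst (rot pi z)) - G (fst (rot 0 z)))) {0..pi}"
  proof (rule fundamental_theorem_of_calculus)
    fix t :: real
    have "((\<lambda>t. fst (rot t z)) has_derivative (\<lambda>s. s *\<^sub>R snd (rot t z))) (at t within {0..pi})"
      unfolding rot_def fst_conv snd_conv by (auto intro!: derivative_eq_intros simp: algebra_simps)
    from has_derivative_compose[OF this d]
    show "((\<lambda>t. G (fst (rot t z))) has_vector_derivative ?f t) (at t within {0..pi})"
      by (simp add: has_vector_derivative_def)
  qed simp
  then have "integral {0..pi} ?f = G (- fst z) - G (fst z)"
    by (simp add: integral_unique rot_def)
  then have le: "(G (- fst z) - G (fst z))\<^sup>2 \<le> pi * integral {0..pi} (\<lambda>t. (?f t)\<^sup>2)"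
    using integral_square_le[OF continuous_on_subset[OF cf], of 0 pi] by simp
  have eq: "ennreal (integral {0..pi} (\<lambda>t. (?f t)\<^sup>2)) = (\<integral>\<^sup>+t. indicator {0..pi} t * ennreal ((?f t)\<^sup>2) \<partial>lborel)"
  proof -
    have i: "integrable lborel (\<lambda>t. indicator {0..pi} t *\<^sub>R (?f t)\<^sup>2)"
      by (rule borel_integrable_compact) (auto intro!: continuous_on_subset[OF cf] continuous_intros)
    have "integral {0..pi} (\<lambda>t. (?f t)\<^sup>2) = (\<integral>t. indicator {0..pi} t *\<^sub>R (?f t)\<^sup>2 \<partial>lborel)"
      using i set_borel_integral_eq_integral(2)[of "{0..pi}" "\<lambda>t. (?f t)\<^sup>2"]
      by (simp add: set_integrable_def set_lebesgue_integral_def)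
    also have "ennreal \<dots> = (\<integral>\<^sup>+t. ennreal (indicator {0..pi} t *\<^sub>R (?f t)\<^sup>2) \<partial>lborel)"
      by (rule nn_integral_eq_integral[OF i, symmetric]) simp
    also have "\<dots> = (\<integral>\<^sup>+t. indicator {0..pi} t * ennreal ((?f t)\<^sup>2) \<partial>lborel)"
      by (intro nn_integral_cong) (simp add: indicator_def)
    finally show ?thesis .
  qed
  show ?thesis
    using ennreal_leI[OF le] unfolding ennreal_mult'[OF pi_ge_zero] eq .
qed

section \<open>Averages over the ball of the product space\<close>

lemma borel_fst_snd[measurable]:
  "fst \<in> borel_measurable (borel :: ('a::topological_space \<times> 'b::topological_space) measure)"
  "snd \<in> borel_measurable (borel :: ('a::topological_space \<times> 'b::topological_space) measure)"
  by (auto intro!: borel_measurable_continuous_onI continuous_intros)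

text \<open>A ball of the product, and not a product of balls, because \<open>rot t\<close> mixes
  the two components. It stays unnormalised: both sides of the estimates are linear in the
  measure.\<close>

abbreviation pairball :: "'a::euclidean_space \<times> 'a \<Rightarrow> ennreal" where
  "pairball \<equiv> indicator (cball 0 1)"

lemma pairball_swap: "(\<integral>\<^sup>+z. pairball z * k (snd z) \<partial>lborel) = (\<integral>\<^sup>+z. pairball z * k (fst z) \<partial>lborel)"
  if [measurable]: "k \<in> borel_measurable borel" for k :: "'a::euclidean_space \<Rightarrow> ennreal"
proof -
  have [measurable]: "cball (0::'a \<times> 'a) 1 \<in> sets borel" by simp
  let ?s = "\<lambda>z::'a \<times> 'a. (snd z, fst z)"
  have ns: "norm (?s z) = norm z" for z by (simp add: norm_prod_def add.commute)
  have "orthogonal_transformation ?s"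
    unfolding orthogonal_transformation using ns by (auto intro!: linearI simp: prod_eq_iff)
  then have "(\<integral>\<^sup>+z. pairball (?s z) * k (fst (?s z)) \<partial>lborel) = (\<integral>\<^sup>+z. pairball z * k (fst z) \<partial>lborel)"
    by (rule nn_integral_lborel_orthogonal) measurable
  then show ?thesis by (simp add: indicator_def ns)
qed

text \<open>The rotation \<open>rot t\<close> preserves the uniform distribution on the ball of the product space and
  moves \<open>x\<close> to \<open>- x\<close> as \<open>t\<close> runs through \<open>[0, \<pi>]\<close>; given \<open>x\<close>, the velocity \<open>y\<close> has a rotation
  invariant distribution, so that only the fraction \<open>1/n\<close> of its square is seen by the gradient.\<close>

lemma odd_part_gradient_bound:
  fixes G :: "real^'n \<Rightarrow> real"
  assumes d: "\<And>x. (G has_derivative (\<lambda>h. g x \<bullet> h)) (at x)" and g: "continuous_on UNIV g"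
    and gM: "\<And>x. norm (g x) \<le> M"
  shows "of_nat CARD('n) * (\<integral>\<^sup>+z. pairball z * ennreal ((G (- fst z) - G (fst z))\<^sup>2) \<partial>lborel)
    \<le> ennreal (pi\<^sup>2 * M\<^sup>2) * (\<integral>\<^sup>+z. pairball (z::(real^'n) \<times> (real^'n)) * ennreal ((norm (fst z))\<^sup>2) \<partial>lborel)"
proof -
  let ?n = "of_nat CARD('n) :: ennreal"
  let ?J = "\<integral>\<^sup>+z. pairball (z::(real^'n) \<times> (real^'n)) * ennreal ((norm (fst z))\<^sup>2) \<partial>lborel"
  have [measurable]: "cball (0::(real^'n) \<times> (real^'n)) 1 \<in> sets borel" by simp
  have [measurable]: "g \<in> borel_measurable borel" using g by (rule borel_measurable_continuous_onI)
  have "continuous_on UNIV G"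
    using d has_derivative_continuous continuous_at_imp_continuous_on by blast
  then have [measurable]: "G \<in> borel_measurable borel" by (rule borel_measurable_continuous_onI)
  let ?k = "\<lambda>z::(real^'n) \<times> (real^'n). ennreal ((g (fst z) \<bullet> snd z)\<^sup>2)"
  have km[measurable]: "?k \<in> borel_measurable borel"
    by (simp add: borel_prod[symmetric])
  have fm[measurable]: "(\<lambda>z::(real^'n) \<times> (real^'n). ennreal ((G (- fst z) - G (fst z))\<^sup>2)) \<in> borel_measurable borel"
    by (simp add: borel_prod[symmetric])
  have rm: "(\<lambda>(z, t). ?k (rot t z)) \<in> borel_measurable (borel \<Otimes>\<^sub>M borel)"
  proof -
    have "continuous_on UNIV (\<lambda>w::((real^'n) \<times> (real^'n)) \<times> real. rot (snd w) (fst w))"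
      unfolding rot_def by (intro continuous_intros)
    then have "(\<lambda>w::((real^'n) \<times> (real^'n)) \<times> real. rot (snd w) (fst w)) \<in> borel_measurable (borel \<Otimes>\<^sub>M borel)"
      unfolding borel_prod by (rule borel_measurable_continuous_onI)
    from measurable_compose[OF this km] show ?thesis by (simp add: split_beta)
  qed
  have inner: "(\<integral>\<^sup>+z. pairball z * ?k (rot t z) \<partial>lborel) = (\<integral>\<^sup>+z. pairball z * ?k z \<partial>lborel)" for t
  proof -
    have n: "norm (rot t z) = norm z" for z :: "(real^'n) \<times> (real^'n)"
      using orthogonal_transformation_rot by (rule orthogonal_transformation_norm)
    show ?thesis
      using nn_integral_lborel_orthogonal[OF orthogonal_transformation_rot, of "\<lambda>z. pairball z * ?k z" t]
      by (simp add: indicator_def n)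
  qed
  have "(\<integral>\<^sup>+z. pairball z * ennreal ((G (- fst z) - G (fst z))\<^sup>2) \<partial>lborel)
      \<le> (\<integral>\<^sup>+z. pairball z * (ennreal pi * (\<integral>\<^sup>+t. indicator {0..pi} t * ?k (rot t z) \<partial>lborel)) \<partial>lborel)"
    by (intro nn_integral_mono mult_left_mono rotation_path_bound[OF d g]) simp
  also have "\<dots> = (\<integral>\<^sup>+z. (\<integral>\<^sup>+t. ennreal pi * (indicator {0..pi} t * (pairball z * ?k (rot t z))) \<partial>lborel) \<partial>lborel)"
  proof (rule nn_integral_cong)
    fix z :: "(real^'n) \<times> (real^'n)"
    have [measurable]: "(\<lambda>t. ?k (rot t z)) \<in> borel_measurable borel"
      using measurable_compose[OF measurable_Pair1' rm, of z] by simp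
    have "pairball z * (ennreal pi * (\<integral>\<^sup>+t. indicator {0..pi} t * ?k (rot t z) \<partial>lborel))
      = (pairball z * ennreal pi) * (\<integral>\<^sup>+t. indicator {0..pi} t * ?k (rot t z) \<partial>lborel)"
      by (simp only: mult.assoc)
    also have "\<dots> = (\<integral>\<^sup>+t. (pairball z * ennreal pi) * (indicator {0..pi} t * ?k (rot t z)) \<partial>lborel)"
      by (rule nn_integral_cmult[symmetric]) measurable
    finally show "pairball z * (ennreal pi * (\<integral>\<^sup>+t. indicator {0..pi} t * ?k (rot t z) \<partial>lborel))
      = (\<integral>\<^sup>+t. ennreal pi * (indicator {0..pi} t * (pairball z * ?k (rot t z))) \<partial>lborel)"
      by (simp only: ac_simps)
  qed
  also have "\<dots> = (\<integral>\<^sup>+t. (\<integral>\<^sup>+z. ennreal pi * (indicator {0..pi} t * (pairball z * ?k (rot t z))) \<partial>lborel) \<partial>lborel)"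
    using rm by (intro lborel_pair.Fubini') (simp add: split_beta)
  \<comment> \<open>For each time, \<open>rot t\<close> is an isometry preserving the ball, so the
    inner integral equals its value at time 0.\<close>
  also have "\<dots> = (\<integral>\<^sup>+t. ennreal pi * (indicator {0..pi} t * (\<integral>\<^sup>+z. pairball z * ?k z \<partial>lborel)) \<partial>lborel)"
  proof (rule nn_integral_cong)
    fix t :: real
    have [measurable]: "(\<lambda>z. ?k (rot t z)) \<in> borel_measurable borel"
      using measurable_compose[OF measurable_Pair2' rm, of t] by simp
    have "(\<integral>\<^sup>+z. ennreal pi * (indicator {0..pi} t * (pairball z * ?k (rot t z))) \<partial>lborel)
        = ennreal pi * (indicator {0..pi} t * (\<integral>\<^sup>+z. pairball z * ?k (rot t z) \<partial>lborel))"
      by (subst nn_integral_cmult, measurable, subst nn_integral_cmult, measurable)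
    then show "(\<integral>\<^sup>+z. ennreal pi * (indicator {0..pi} t * (pairball z * ?k (rot t z))) \<partial>lborel)
        = ennreal pi * (indicator {0..pi} t * (\<integral>\<^sup>+z. pairball z * ?k z \<partial>lborel))"
      unfolding inner .
  qed
  also have "\<dots> = ennreal pi * (ennreal pi * (\<integral>\<^sup>+z. pairball z * ?k z \<partial>lborel))"
  proof -
    have "(\<integral>\<^sup>+t. ennreal pi * (indicator {0..pi} t * K) \<partial>lborel) = ennreal pi * ((\<integral>\<^sup>+t. indicator {0..pi} t \<partial>lborel) * K)" for K
      by (subst nn_integral_cmult, measurable, subst nn_integral_multc, measurable)
    also have "(\<integral>\<^sup>+t. indicator {0..pi} t \<partial>lborel) = ennreal pi"
      by (subst nn_integral_indicator) (simp_all only: emeasure_lborel_Icc pi_ge_zero sets_lborel atLeastAtMost_borel diff_zero)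
    finally show ?thesis .
  qed
  finally have A: "(\<integral>\<^sup>+z. pairball z * ennreal ((G (- fst z) - G (fst z))\<^sup>2) \<partial>lborel)
      \<le> ennreal (pi\<^sup>2) * (\<integral>\<^sup>+z. pairball z * ?k z \<partial>lborel)"
    unfolding power2_eq_square[of pi] ennreal_mult'[OF pi_ge_zero] mult.assoc .
  \<comment> \<open>With \<open>x\<close> frozen, \<open>y\<close> ranges over a ball centred at 0,
    and the square of its component along \<open>g x\<close> averages to the fraction
    \<open>1/n\<close>. Exchanging the components at the end turns the second moment of
    \<open>y\<close> into that of \<open>x\<close>.\<close>
  have B: "?n * (\<integral>\<^sup>+z. pairball z * ?k z \<partial>lborel) \<le> ennreal (M\<^sup>2) * ?J"
  proof -
    have pm[measurable]: "(\<lambda>y. pairball (x, y)) \<in> borel_measurable borel" for x :: "real^'n"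
    proof -
      have "(\<lambda>y. (x, y)) \<in> measurable borel (borel :: ((real^'n) \<times> (real^'n)) measure)"
        by (simp add: borel_prod[symmetric])
      then show ?thesis by (rule measurable_compose) measurable
    qed
    have i: "?n * (\<integral>\<^sup>+y. pairball (x, y) * ennreal ((g x \<bullet> y)\<^sup>2) \<partial>lborel)
        \<le> ennreal (M\<^sup>2) * (\<integral>\<^sup>+y. pairball (x, y) * ennreal ((norm y)\<^sup>2) \<partial>lborel)" for x :: "real^'n"
    proof -
      have "rotation_invariant (density lborel (\<lambda>y. pairball (x, y)))"
        by (intro rotation_invariant_density rotation_invariant_lborel pm)
           (simp add: indicator_def norm_prod_def orthogonal_transformation)
      from rotation_invariant_second_moment[OF this, of "g x"]
      have "?n * (\<integral>\<^sup>+y. pairball (x, y) * ennreal ((g x \<bullet> y)\<^sup>2) \<partial>lborel)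
          = ennreal ((norm (g x))\<^sup>2) * (\<integral>\<^sup>+y. pairball (x, y) * ennreal ((norm y)\<^sup>2) \<partial>lborel)"
        by (simp add: nn_integral_density)
      also have "\<dots> \<le> ennreal (M\<^sup>2) * (\<integral>\<^sup>+y. pairball (x, y) * ennreal ((norm y)\<^sup>2) \<partial>lborel)"
        by (intro mult_right_mono ennreal_leI power_mono gM) auto
      finally show ?thesis .
    qed
    have split: "(\<integral>\<^sup>+z. k z \<partial>lborel) = (\<integral>\<^sup>+x. (\<integral>\<^sup>+y. k (x, y) \<partial>lborel) \<partial>lborel)"
      if "k \<in> borel_measurable borel" for k :: "(real^'n) \<times> (real^'n) \<Rightarrow> ennreal"
    proof -
      have "k \<in> borel_measurable (lborel \<Otimes>\<^sub>M lborel)"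
        using that by (simp add: lborel_prod)
      from lborel.nn_integral_fst[OF this] show ?thesis by (simp add: lborel_prod)
    qed
    have m2: "(\<lambda>z::(real^'n) \<times> (real^'n). ennreal ((norm (snd z))\<^sup>2)) \<in> borel_measurable borel"
      by (simp add: borel_prod[symmetric])
    have mi: "(\<lambda>x. \<integral>\<^sup>+y. k (x, y) \<partial>lborel) \<in> borel_measurable lborel"
      if "k \<in> borel_measurable borel" for k :: "(real^'n) \<times> (real^'n) \<Rightarrow> ennreal"
      by (rule lborel.borel_measurable_nn_integral_fst) (use that in \<open>simp add: lborel_prod\<close>)
    have pk: "(\<lambda>z. pairball z * ?k z) \<in> borel_measurable borel"
      by measurable
    have pk2: "(\<lambda>z::(real^'n) \<times> (real^'n). pairball z * ennreal ((norm (snd z))\<^sup>2)) \<in> borel_measurable borel"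
      using m2 by measurable
    have "?n * (\<integral>\<^sup>+z. pairball z * ?k z \<partial>lborel)
        = (\<integral>\<^sup>+x. ?n * (\<integral>\<^sup>+y. pairball (x, y) * ennreal ((g x \<bullet> y)\<^sup>2) \<partial>lborel) \<partial>lborel)"
      unfolding split[OF pk] using nn_integral_cmult[OF mi[OF pk], of ?n] by simp
    also have "\<dots> \<le> (\<integral>\<^sup>+x. ennreal (M\<^sup>2) * (\<integral>\<^sup>+y. pairball (x, y) * ennreal ((norm y)\<^sup>2) \<partial>lborel) \<partial>(lborel :: (real^'n) measure))"
      by (intro nn_integral_mono i)
    also have "\<dots> = ennreal (M\<^sup>2) * (\<integral>\<^sup>+z. pairball (z::(real^'n) \<times> (real^'n)) * ennreal ((norm (snd z))\<^sup>2) \<partial>lborel)"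
      unfolding split[OF pk2] using nn_integral_cmult[OF mi[OF pk2], of "ennreal (M\<^sup>2)"] by simp
    also have "\<dots> = ennreal (M\<^sup>2) * ?J"
      by (subst pairball_swap) auto
    finally show ?thesis .
  qed
  have "?n * (\<integral>\<^sup>+z. pairball z * ennreal ((G (- fst z) - G (fst z))\<^sup>2) \<partial>lborel)
      \<le> ?n * (ennreal (pi\<^sup>2) * (\<integral>\<^sup>+z. pairball z * ?k z \<partial>lborel))"
    by (intro mult_left_mono A) simp
  also have "\<dots> = ennreal (pi\<^sup>2) * (?n * (\<integral>\<^sup>+z. pairball z * ?k z \<partial>lborel))"
    by (simp only: mult.left_commute)
  also have "\<dots> \<le> ennreal (pi\<^sup>2) * (ennreal (M\<^sup>2) * ?J)"
    by (intro mult_left_mono B) simp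
  also have "\<dots> = ennreal (pi\<^sup>2 * M\<^sup>2) * ?J"
    by (simp add: ennreal_mult mult.assoc)
  finally show ?thesis .
qed

text \<open>The homogeneous extension of the values on the sphere: it is Lipschitz on the whole space, and the
  second moment of the norm that it introduces cancels in the end.\<close>

definition hom_ext :: "('a::real_normed_vector \<Rightarrow> real) \<Rightarrow> 'a \<Rightarrow> real" where
  "hom_ext F x = norm x * (F (sgn x) - F 0)"

text \<open>One \<open>L\<close> comes from the change of direction and one from the change of
  length; the latter is finite because \<open>F 0\<close> is subtracted, so that the values on the
  sphere are bounded by \<open>L\<close>.\<close>

lemma hom_ext_lipschitz:
  fixes F :: "'a::euclidean_space \<Rightarrow> real"
  assumes F: "L-lipschitz_on (cball 0 1) F"
  shows "(2 * L)-lipschitz_on UNIV (hom_ext F)"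
proof (rule lipschitz_onI)
  have L0: "0 \<le> L" using F by (rule lipschitz_on_nonneg)
  show "0 \<le> 2 * L" using L0 by simp
  have le: "\<bar>hom_ext F x - hom_ext F y\<bar> \<le> 2 * L * norm (x - y)" if xy: "norm x \<le> norm y" for x y :: 'a
  proof -
    have in_ball: "sgn z \<in> cball 0 1" for z :: 'a by (simp add: norm_sgn)
    have b: "\<bar>F (sgn y) - F 0\<bar> \<le> L"
    proof -
      have "\<bar>F (sgn y) - F 0\<bar> \<le> L * norm (sgn y)"
        using lipschitz_onD[OF F in_ball, of 0 y] by (simp add: dist_norm)
      also have "\<dots> \<le> L * 1" using L0 by (intro mult_left_mono) (simp_all add: norm_sgn)
      finally show ?thesis by simp
    qed
    \<comment> \<open>Retracting the longer vector \<open>y\<close> radially to length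
      \<open>norm x\<close> is the projection onto a ball that contains \<open>x\<close>, and
      projections do not increase distances.\<close>
    have c: "norm x * norm (sgn x - sgn y) \<le> norm (x - y)"
    proof (cases "x = 0")
      case False
      then have y: "y \<noteq> 0" using xy by auto
      define p where "p = closest_point (cball 0 (norm x)) y"
      have x: "norm x *\<^sub>R sgn x = x" using False by (simp add: sgn_div_norm)
      have py: "norm x *\<^sub>R sgn y = p"
        unfolding p_def
      proof (rule closest_point_unique)
        show "norm x *\<^sub>R sgn y \<in> cball 0 (norm x)" by (simp add: norm_sgn)
        show "\<forall>z\<in>cball 0 (norm x). dist y (norm x *\<^sub>R sgn y) \<le> dist y z"
        proof
          fix z assume z: "z \<in> cball (0::'a) (norm x)"
          have "y - norm x *\<^sub>R sgn y = (norm y - norm x) *\<^sub>R sgn y"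
            using y by (simp add: sgn_div_norm scaleR_diff_left left_diff_distrib)
          then have "dist y (norm x *\<^sub>R sgn y) = norm y - norm x"
            using xy y by (simp add: dist_norm norm_sgn)
          also have "\<dots> \<le> norm y - norm z" using z by simp
          also have "\<dots> \<le> dist y z" by (simp add: dist_norm norm_triangle_ineq2)
          finally show "dist y (norm x *\<^sub>R sgn y) \<le> dist y z" .
        qed
      qed auto
      have px: "closest_point (cball 0 (norm x)) x = x" by (rule closest_point_self) simp
      have "norm x * norm (sgn x - sgn y) = norm (norm x *\<^sub>R sgn x - norm x *\<^sub>R sgn y)"
        by (simp flip: scaleR_diff_right)
      also have "\<dots> = dist (closest_point (cball 0 (norm x)) x) (closest_point (cball 0 (norm x)) y)"
        unfolding px p_def[symmetric] x py by (simp add: dist_norm)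
      also have "\<dots> \<le> dist x y"
        by (rule closest_point_lipschitz) auto
      finally show ?thesis by (simp add: dist_norm)
    qed simp
    have "\<bar>F (sgn x) - F (sgn y)\<bar> \<le> L * norm (sgn x - sgn y)"
      using lipschitz_onD[OF F in_ball in_ball, of x y] by (simp add: dist_norm)
    then have "norm x * \<bar>F (sgn x) - F (sgn y)\<bar> \<le> norm x * (L * norm (sgn x - sgn y))"
      by (rule mult_left_mono) simp
    also have "\<dots> \<le> L * norm (x - y)"
      using mult_left_mono[OF c L0] by (simp add: mult.left_commute)
    finally have 1: "norm x * \<bar>F (sgn x) - F (sgn y)\<bar> \<le> L * norm (x - y)" .
    have "\<bar>norm x - norm y\<bar> * \<bar>F (sgn y) - F 0\<bar> \<le> L * norm (x - y)"
      by (subst (2) mult.commute) (intro mult_mono b norm_triangle_ineq3, auto)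
    moreover have "hom_ext F x - hom_ext F y = norm x * (F (sgn x) - F (sgn y)) + (norm x - norm y) * (F (sgn y) - F 0)"
      by (simp add: hom_ext_def algebra_simps)
    ultimately show ?thesis
      using 1 abs_triangle_ineq[of "norm x * (F (sgn x) - F (sgn y))" "(norm x - norm y) * (F (sgn y) - F 0)"]
      unfolding abs_mult abs_norm_cancel by linarith
  qed
  fix x y :: 'a
  show "dist (hom_ext F x) (hom_ext F y) \<le> 2 * L * dist x y"
    using le[of x y] le[of y x] by (cases "norm x \<le> norm y") (auto simp: dist_norm norm_minus_commute abs_minus_commute)
qed

text \<open>Legitimates cancelling this factor in \<open>ennreal\<close>. If it vanished, then by
  exchange both components would be 0 almost everywhere on a ball of positive volume.\<close>

lemma pairball_moment:
  "(\<integral>\<^sup>+z. pairball (z::(real^'n) \<times> (real^'n)) * ennreal ((norm (fst z))\<^sup>2) \<partial>lborel) \<noteq> 0" (is "?J \<noteq> 0")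
  "(\<integral>\<^sup>+z. pairball (z::(real^'n) \<times> (real^'n)) * ennreal ((norm (fst z))\<^sup>2) \<partial>lborel) \<noteq> \<top>"
proof -
  have [measurable]: "cball (0::(real^'n) \<times> (real^'n)) 1 \<in> sets borel" by simp
  let ?B = "cball (0::(real^'n) \<times> (real^'n)) 1"
  note fin = emeasure_cball_pos_finite[where 'a="(real^'n) \<times> (real^'n)"]
  have "?J \<le> (\<integral>\<^sup>+z. pairball (z::(real^'n) \<times> (real^'n)) \<partial>lborel)"
  proof (rule nn_integral_mono)
    fix z :: "(real^'n) \<times> (real^'n)"
    show "pairball z * ennreal ((norm (fst z))\<^sup>2) \<le> pairball z"
    proof (cases "z \<in> ?B")
      case True
      then have "norm (fst z) \<le> 1" using norm_fst_le[of "fst z" "snd z"] by simp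
      then have "(norm (fst z))\<^sup>2 \<le> 1" by (simp add: power_le_one)
      then show ?thesis using True by simp
    qed simp
  qed
  also have "\<dots> < \<infinity>" using fin(2) by simp
  finally show "?J \<noteq> \<top>" by simp
  show "?J \<noteq> 0"
  proof
    assume J: "?J = 0"
    have J2: "(\<integral>\<^sup>+z. pairball (z::(real^'n) \<times> (real^'n)) * ennreal ((norm (snd z))\<^sup>2) \<partial>lborel) = 0"
      by (subst pairball_swap) (simp_all only: J, measurable)
    have "AE z in lborel. pairball (z::(real^'n) \<times> (real^'n)) * ennreal ((norm (fst z))\<^sup>2) = 0"
      by (subst nn_integral_0_iff_AE[symmetric]) (simp_all only: J, measurable)
    moreover have "AE z in lborel. pairball (z::(real^'n) \<times> (real^'n)) * ennreal ((norm (snd z))\<^sup>2) = 0"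
      by (subst nn_integral_0_iff_AE[symmetric]) (simp_all only: J2, measurable)
    moreover have "AE z in lborel. z \<noteq> (0 :: (real^'n) \<times> (real^'n))"
      by (rule AE_lborel_singleton)
    ultimately have "AE z in lborel. z \<notin> ?B"
      by eventually_elim (auto simp: prod_eq_iff indicator_def split: if_splits)
    then have "emeasure lborel ?B = 0"
      by (subst (asm) AE_iff_measurable[where N="?B"]) auto
    then show False using fin(1) by simp
  qed
qed

text \<open>The gradient form applies to the smoothings of \<open>H\<close>, whose gradients are all
  bounded by \<open>M\<close>; they converge pointwise to \<open>H\<close>, and Fatou's lemma
  carries the bound over.\<close>

lemma odd_part_hom_bound:
  fixes H :: "real^'n \<Rightarrow> real"
  assumes H: "M-lipschitz_on UNIV H"
  shows "of_nat CARD('n) * (\<integral>\<^sup>+z. pairball z * ennreal ((H (- fst z) - H (fst z))\<^sup>2) \<partial>lborel)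
    \<le> ennreal (pi\<^sup>2 * M\<^sup>2) * (\<integral>\<^sup>+z. pairball (z::(real^'n) \<times> (real^'n)) * ennreal ((norm (fst z))\<^sup>2) \<partial>lborel)"
    (is "?n * _ \<le> ?b * ?J")
proof -
  have [measurable]: "cball (0::(real^'n) \<times> (real^'n)) 1 \<in> sets borel" by simp
  define e where "e m = 1 / (real m + 1)" for m :: nat
  have e: "0 < e m" for m by (simp add: e_def)
  have e0: "e \<longlonglongrightarrow> 0"
    unfolding e_def using LIMSEQ_inverse_real_of_nat by (simp add: inverse_eq_divide add.commute)
  define G where "G m = smoothed H (e m)" for m
  have [measurable]: "G m \<in> borel_measurable borel" for m
    unfolding G_def
    by (intro borel_measurable_continuous_onI lipschitz_on_continuous_on[OF smoothed_lipschitz[OF H]])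
  have lim: "(\<lambda>m. G m x) \<longlonglongrightarrow> H x" for x
  proof (rule LIM_zero_cancel, rule Lim_null_comparison)
    show "\<forall>\<^sub>F m in sequentially. norm (G m x - H x) \<le> M * e m"
      using smoothed_close[OF H less_imp_le[OF e]] by (simp add: G_def)
    show "(\<lambda>m. M * e m) \<longlonglongrightarrow> 0" using tendsto_mult_right_zero[OF e0] .
  qed
  let ?k = "\<lambda>m z. pairball z * ennreal ((G m (- fst z) - G m (fst z))\<^sup>2)"
  have bound: "?n * (\<integral>\<^sup>+z. ?k m z \<partial>lborel) \<le> ?b * ?J" for m
    unfolding G_def
    by (rule odd_part_gradient_bound[where g="ball_gradient H (e m)"])
       (auto intro!: smoothed_has_derivative[OF H e] norm_ball_gradient_le[OF H e]
          lipschitz_on_continuous_on[OF ball_gradient_lipschitz[OF H e]])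
  have "(\<integral>\<^sup>+z. pairball z * ennreal ((H (- fst z) - H (fst z))\<^sup>2) \<partial>lborel)
      = (\<integral>\<^sup>+z. liminf (\<lambda>m. ?k m z) \<partial>lborel)"
  proof (intro nn_integral_cong lim_imp_Liminf[symmetric])
    fix z :: "(real^'n) \<times> (real^'n)"
    show "(\<lambda>m. ?k m z) \<longlonglongrightarrow> pairball z * ennreal ((H (- fst z) - H (fst z))\<^sup>2)"
      by (intro ennreal_tendsto_cmult tendsto_ennrealI tendsto_intros lim) (simp add: indicator_def)
  qed simp
  also have "\<dots> \<le> liminf (\<lambda>m. \<integral>\<^sup>+z. ?k m z \<partial>lborel)"
    by (rule nn_integral_liminf) measurable
  finally have "?n * (\<integral>\<^sup>+z. pairball z * ennreal ((H (- fst z) - H (fst z))\<^sup>2) \<partial>lborel)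
      \<le> ?n * liminf (\<lambda>m. \<integral>\<^sup>+z. ?k m z \<partial>lborel)"
    by (rule mult_left_mono) simp
  also have "liminf (\<lambda>m. \<integral>\<^sup>+z. ?k m z \<partial>lborel) \<le> ?b * ?J / ?n"
  proof -
    have "(\<integral>\<^sup>+z. ?k m z \<partial>lborel) \<le> ?b * ?J / ?n" for m
    proof -
      have "(\<integral>\<^sup>+z. ?k m z \<partial>lborel) = (\<integral>\<^sup>+z. ?k m z \<partial>lborel) * ?n / ?n"
        by (rule mult_divide_eq_ennreal[symmetric]) auto
      also have "\<dots> \<le> ?b * ?J / ?n"
        using bound[of m] by (intro divide_right_mono_ennreal) (simp add: mult.commute)
      finally show ?thesis .
    qed
    then have "liminf (\<lambda>m. \<integral>\<^sup>+z. ?k m z \<partial>lborel) \<le> liminf (\<lambda>m. ?b * ?J / ?n)"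
      by (intro Liminf_mono) simp
    then show ?thesis by (simp add: Liminf_const)
  qed
  then have "?n * liminf (\<lambda>m. \<integral>\<^sup>+z. ?k m z \<partial>lborel) \<le> ?n * (?b * ?J / ?n)"
    by (rule mult_left_mono) simp
  also have "?n * (?b * ?J / ?n) = ?b * ?J * ?n / ?n"
    by (simp only: ennreal_times_divide mult.commute)
  also have "\<dots> = ?b * ?J"
    by (rule mult_divide_eq_ennreal) auto
  finally show ?thesis .
qed

text \<open>For fixed \<open>y\<close> the slice of the product ball is radial in \<open>x\<close>,
  so polar coordinates split the odd part of \<open>hom_ext F\<close> into \<open>(norm x)^2\<close>
  and the odd part of \<open>F\<close> on the sphere. Only the unit ball occurs in the hypothesis,
  since samples are Lipschitz near \<open>X\<close> only.\<close>

theorem sphere_odd_variance: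
  fixes F :: "real^'n \<Rightarrow> real"
  assumes F: "L-lipschitz_on (cball 0 1) F" and Fm[measurable]: "F \<in> borel_measurable borel"
  shows "(\<integral>t. (F t - F (- t))\<^sup>2 \<partial>sphere_measure) \<le> 4 * pi\<^sup>2 * L\<^sup>2 / CARD('n)"
    and "integrable sphere_measure (\<lambda>t. (F t - F (- t))\<^sup>2)"
proof -
  let ?n = "of_nat CARD('n) :: ennreal"
  let ?J = "\<integral>\<^sup>+z. pairball (z::(real^'n) \<times> (real^'n)) * ennreal ((norm (fst z))\<^sup>2) \<partial>lborel"
  have [measurable]: "cball (0::(real^'n) \<times> (real^'n)) 1 \<in> sets borel" by simp
  let ?k = "\<lambda>t. ennreal ((F (- t) - F t)\<^sup>2)"
  have split: "(\<integral>\<^sup>+z. k z \<partial>lborel) = (\<integral>\<^sup>+y. (\<integral>\<^sup>+x. k (x, y) \<partial>lborel) \<partial>lborel)"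
    if "k \<in> borel_measurable borel" for k :: "(real^'n) \<times> (real^'n) \<Rightarrow> ennreal"
  proof -
    have "k \<in> borel_measurable (lborel \<Otimes>\<^sub>M lborel)"
      using that by (simp add: lborel_prod)
    from lborel_pair.nn_integral_snd[OF this] show ?thesis by (simp add: lborel_prod)
  qed
  have H: "hom_ext F (- x) - hom_ext F x = norm x * (F (- sgn x) - F (sgn x))" for x
    by (simp add: hom_ext_def sgn_minus algebra_simps)
  have "(\<integral>\<^sup>+z. pairball z * ennreal ((hom_ext F (- fst z) - hom_ext F (fst z))\<^sup>2) \<partial>lborel)
    = (\<integral>\<^sup>+z. pairball z * ennreal ((norm (fst z))\<^sup>2) * ?k (sgn (fst z)) \<partial>lborel)"
    by (intro nn_integral_cong) (simp add: H power_mult_distrib ennreal_mult mult.assoc)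
  also have "\<dots> = (\<integral>\<^sup>+y. (\<integral>\<^sup>+x. pairball (x, y) * ennreal ((norm x)\<^sup>2) * ?k (sgn x) \<partial>lborel) \<partial>lborel)"
    by (subst split) (simp_all, measurable)
  also have "\<dots> = (\<integral>\<^sup>+y. (\<integral>\<^sup>+x. pairball (x::real^'n, y::real^'n) * ennreal ((norm x)\<^sup>2) \<partial>lborel) * (\<integral>\<^sup>+t. ?k t \<partial>sphere_measure) \<partial>lborel)"
  proof (rule nn_integral_cong)
    fix y :: "real^'n"
    define w where "w r = (if r\<^sup>2 + (norm y)\<^sup>2 \<le> 1 then r\<^sup>2 else 0)" for r :: real
    have w: "pairball (x, y) * ennreal ((norm x)\<^sup>2) = ennreal (w (norm x))" for x :: "real^'n"
      by (simp add: w_def indicator_def norm_prod_def real_sqrt_le_1_iff)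
    have [measurable]: "w \<in> borel_measurable borel" unfolding w_def by measurable
    have "integrable lborel (\<lambda>x::real^'n. w (norm x))"
    proof (rule Bochner_Integration.integrable_bound)
      show "integrable lborel (indicator (cball (0::real^'n) 1) :: _ \<Rightarrow> real)"
        using emeasure_cball_pos_finite[where 'a="real^'n"] by simp
      show "AE x in lborel. norm (w (norm (x::real^'n))) \<le> norm (indicator (cball (0::real^'n) 1) x :: real)"
      proof (rule AE_I2)
        fix x :: "real^'n"
        have "norm x \<le> 1" if "(norm x)\<^sup>2 + (norm y)\<^sup>2 \<le> 1"
        proof -
          have "(norm x)\<^sup>2 \<le> 1\<^sup>2" using that zero_le_power2[of "norm y"] unfolding one_power2 by linarith
          then show ?thesis by (rule power2_le_imp_le) simp
        qed
        then show "norm (w (norm x)) \<le> norm (indicator (cball (0::real^'n) 1) x :: real)"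
          by (auto simp: w_def power_le_one)
      qed
    qed measurable
    from polar_nn_integral[OF _ _ _ this, of ?k]
    show "(\<integral>\<^sup>+x. pairball (x, y) * ennreal ((norm x)\<^sup>2) * ?k (sgn x) \<partial>lborel)
        = (\<integral>\<^sup>+x. pairball (x::real^'n, y::real^'n) * ennreal ((norm x)\<^sup>2) \<partial>lborel) * (\<integral>\<^sup>+t. ?k t \<partial>sphere_measure)"
      unfolding w by (simp add: w_def)
  qed
  also have "\<dots> = ?J * (\<integral>\<^sup>+t. ?k t \<partial>sphere_measure)"
  proof -
    have J: "(\<lambda>z::(real^'n) \<times> (real^'n). pairball z * ennreal ((norm (fst z))\<^sup>2)) \<in> borel_measurable borel"
      by measurable
    have "(\<lambda>y. \<integral>\<^sup>+x. pairball (x::real^'n, y::real^'n) * ennreal ((norm (fst (x, y)))\<^sup>2) \<partial>lborel) \<in> borel_measurable lborel"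
    proof (rule lborel.borel_measurable_nn_integral)
      have "(\<lambda>(y, x). (x, y)) \<in> measurable (lborel \<Otimes>\<^sub>M lborel) (borel :: ((real^'n) \<times> (real^'n)) measure)"
        unfolding borel_prod[symmetric] by measurable
      from measurable_compose[OF this J]
      show "(\<lambda>(y, x). pairball (x::real^'n, y::real^'n) * ennreal ((norm (fst (x, y)))\<^sup>2)) \<in> borel_measurable (lborel \<Otimes>\<^sub>M lborel)"
        by (simp add: split_beta)
    qed
    from nn_integral_multc[OF this] show ?thesis
      unfolding split[OF J] by simp
  qed
  finally have eq: "(\<integral>\<^sup>+z. pairball z * ennreal ((hom_ext F (- fst z) - hom_ext F (fst z))\<^sup>2) \<partial>lborel)
      = ?J * (\<integral>\<^sup>+t. ?k t \<partial>sphere_measure)" .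
  \<comment> \<open>The \<open>4\<close> of the final constant is the square of the Lipschitz
    constant \<open>2 * L\<close> of the homogeneous extension.\<close>
  have "?n * (?J * (\<integral>\<^sup>+t. ?k t \<partial>sphere_measure)) \<le> ennreal (pi\<^sup>2 * (2 * L)\<^sup>2) * ?J"
    using odd_part_hom_bound[OF hom_ext_lipschitz[OF F]] unfolding eq .
  then have *: "?n * (\<integral>\<^sup>+t. ?k t \<partial>sphere_measure) * ?J \<le> ennreal (pi\<^sup>2 * (2 * L)\<^sup>2) * ?J"
    by (simp only: ac_simps)
  have "?n * (\<integral>\<^sup>+t. ?k t \<partial>sphere_measure) = ?n * (\<integral>\<^sup>+t. ?k t \<partial>sphere_measure) * ?J / ?J"
    by (rule mult_divide_eq_ennreal[symmetric]) (rule pairball_moment)+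
  also have "\<dots> \<le> ennreal (pi\<^sup>2 * (2 * L)\<^sup>2) * ?J / ?J"
    by (rule divide_right_mono_ennreal[OF *])
  also have "\<dots> = ennreal (pi\<^sup>2 * (2 * L)\<^sup>2)"
    by (rule mult_divide_eq_ennreal) (rule pairball_moment)+
  finally have b: "?n * (\<integral>\<^sup>+t. ?k t \<partial>sphere_measure) \<le> ennreal (4 * pi\<^sup>2 * L\<^sup>2)"
    by (simp add: power_mult_distrib mult.assoc mult.left_commute)
  have fin: "(\<integral>\<^sup>+t. ?k t \<partial>sphere_measure) \<noteq> \<top>"
    using b by (auto simp: ennreal_mult_eq_top_iff top_unique)
  have sq: "(F t - F (- t))\<^sup>2 = (F (- t) - F t)\<^sup>2" for t by (rule power2_commute)
  show i: "integrable sphere_measure (\<lambda>t. (F t - F (- t))\<^sup>2)"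
    unfolding sq using fin by (intro integrableI_nonneg) (auto simp: less_top)
  have "ennreal (CARD('n) * (\<integral>t. (F t - F (- t))\<^sup>2 \<partial>sphere_measure)) = ?n * (\<integral>\<^sup>+t. ?k t \<partial>sphere_measure)"
    using nn_integral_eq_integral[OF i] unfolding sq by (simp add: ennreal_mult ennreal_of_nat_eq_real_of_nat)
  with b have "ennreal (CARD('n) * (\<integral>t. (F t - F (- t))\<^sup>2 \<partial>sphere_measure)) \<le> ennreal (4 * pi\<^sup>2 * L\<^sup>2)"
    by (simp only:)
  then have "CARD('n) * (\<integral>t. (F t - F (- t))\<^sup>2 \<partial>sphere_measure) \<le> 4 * pi\<^sup>2 * L\<^sup>2"
    by (rule ennreal_le_iff[THEN iffD1, rotated]) simp
  then show "(\<integral>t. (F t - F (- t))\<^sup>2 \<partial>sphere_measure) \<le> 4 * pi\<^sup>2 * L\<^sup>2 / CARD('n)"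
    by (simp add: field_simps)
qed

subsection \<open>Projected steps and the residual\<close>

text \<open>McShane's extension, the lower envelope of the cones \<open>f y + L * dist x y\<close>;
  comparison with one point of \<open>S\<close> shows that it is finite.\<close>

lemma lipschitz_extension:
  fixes f :: "'a::metric_space \<Rightarrow> real"
  assumes f: "L-lipschitz_on S f"
  obtains F where "L-lipschitz_on UNIV F" "\<And>x. x \<in> S \<Longrightarrow> F x = f x"
proof (cases "S = {}")
  case True
  then show ?thesis using that[of "\<lambda>_. 0"] lipschitz_on_nonneg[OF f] by (auto simp: lipschitz_on_def)
next
  case False
  then obtain s0 where s0: "s0 \<in> S" by auto
  have L0: "0 \<le> L" using f by (rule lipschitz_on_nonneg)
  define F where "F x = (INF y\<in>S. f y + L * dist x y)" for x
  have low: "f s0 - L * dist x s0 \<le> f y + L * dist x y" if "y \<in> S" for x y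
  proof -
    have "f s0 - f y \<le> L * dist s0 y" using lipschitz_onD[OF f s0 that] by (simp add: dist_real_def)
    also have "\<dots> \<le> L * (dist x s0 + dist x y)"
      using L0 by (intro mult_left_mono) (metis dist_commute dist_triangle)
    finally show ?thesis by (simp add: algebra_simps)
  qed
  have bdd: "bdd_below ((\<lambda>y. f y + L * dist x y) ` S)" for x
    using low by (auto intro!: bdd_belowI)
  have le: "F x \<le> F x' + L * dist x x'" for x x'
  proof -
    have "F x - L * dist x x' \<le> F x'"
      unfolding F_def[of x']
    proof (rule cINF_greatest[OF False])
      fix y assume y: "y \<in> S"
      have "F x \<le> f y + L * dist x y" unfolding F_def by (rule cINF_lower[OF bdd y])
      also have "\<dots> \<le> f y + L * (dist x x' + dist x' y)"
        using L0 by (intro add_left_mono mult_left_mono dist_triangle)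
      finally show "F x - L * dist x x' \<le> f y + L * dist x' y" by (simp add: algebra_simps)
    qed
    then show ?thesis by simp
  qed
  show ?thesis
  proof (rule that)
    show "L-lipschitz_on UNIV F"
    proof (rule lipschitz_onI[OF _ L0])
      fix x y
      show "dist (F x) (F y) \<le> L * dist x y"
        using le[of x y] le[of y x] by (simp add: dist_real_def dist_commute abs_le_iff)
    qed
    fix x assume x: "x \<in> S"
    show "F x = f x"
    proof (rule antisym)
      show "F x \<le> f x" unfolding F_def using cINF_lower[OF bdd x, of x] by simp
      show "f x \<le> F x" unfolding F_def
      proof (rule cINF_greatest[OF False])
        fix y assume "y \<in> S"
        then show "f x \<le> f y + L * dist x y"
          using lipschitz_onD[OF f x, of y] by (simp add: dist_real_def)
      qed
    qed
  qed
qed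

text \<open>The noisy step is tested against the exact one \<open>xh\<close>, and \<open>xh\<close>
  against \<open>x\<close>. Comparing with \<open>xh\<close>, and not only with \<open>x\<close>, is
  what brings in the exact residual, with its full coefficient \<open>1 / (2 * gam)\<close>.\<close>

lemma projected_step_inequality:
  fixes X :: "'a::euclidean_space set"
  assumes X: "convex X" "closed X" and x: "x \<in> X" and gam: "0 < gam"
    and xh: "xh = closest_point X (x - gam *\<^sub>R g)"
    and xn: "xn = closest_point X (x - gam *\<^sub>R (g + e))"
  shows "g \<bullet> (xn - x) \<le> - (norm (xh - x))\<^sup>2 / (2 * gam) - (norm (xn - x))\<^sup>2 / (2 * gam) + gam / 2 * (norm e)\<^sup>2"
proof -
  have ne: "X \<noteq> {}" using x by auto
  have xhX: "xh \<in> X" unfolding xh by (rule closest_point_in_set[OF X(2) ne])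
  define d where "d = xn - x"
  define dh where "dh = xh - x"
  have i: "(- (gam *\<^sub>R (g + e)) - d) \<bullet> (dh - d) \<le> 0"
    using closest_point_dot[OF X xhX, of "x - gam *\<^sub>R (g + e)"]
    unfolding xn[symmetric] d_def dh_def by (simp add: algebra_simps)
  have ii: "(- (gam *\<^sub>R g) - dh) \<bullet> (- dh) \<le> 0"
    using closest_point_dot[OF X x, of "x - gam *\<^sub>R g"]
    unfolding xh[symmetric] dh_def by (simp add: algebra_simps)
  \<comment> \<open>Completing the square: twice the cross term of the error
    \<open>gam *\<^sub>R e\<close> with \<open>dh - d\<close> is bounded by
    \<open>gam^2 * |e|^2 + |dh - d|^2\<close>.\<close>
  have iii: "0 \<le> (gam *\<^sub>R e - (dh - d)) \<bullet> (gam *\<^sub>R e - (dh - d))" by (rule inner_ge_zero)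
  have "2 * (gam * (g \<bullet> d)) \<le> - (dh \<bullet> dh) - d \<bullet> d + gam * gam * (e \<bullet> e)"
    using i ii iii
    by (simp add: inner_add_left inner_add_right inner_diff_left inner_diff_right inner_commute algebra_simps)
  then have "(g \<bullet> d) * (2 * gam) \<le> (- (norm dh)\<^sup>2 - (norm d)\<^sup>2 + gam * gam * (norm e)\<^sup>2)"
    by (simp add: power2_norm_eq_inner algebra_simps)
  then have "g \<bullet> d \<le> (- (norm dh)\<^sup>2 - (norm d)\<^sup>2 + gam * gam * (norm e)\<^sup>2) / (2 * gam)"
    using gam by (simp add: pos_le_divide_eq)
  also have "\<dots> = - (norm dh)\<^sup>2 / (2 * gam) - (norm d)\<^sup>2 / (2 * gam) + gam / 2 * (norm e)\<^sup>2"
    using gam by (simp add: add_divide_distrib diff_divide_distrib)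
  finally show ?thesis unfolding d_def dh_def .
qed

text \<open>With diminishing steps, descent is measured at the current step \<open>gam\<close>,
  while the claim is about the residual at the initial step; this monotonicity connects the
  two.\<close>

lemma scaled_projection_residual_antimono:
  fixes X :: "'a::euclidean_space set"
  assumes X: "convex X" "closed X" and x: "x \<in> X" and gam: "0 < gam" "gam \<le> gam0"
  shows "norm (x - closest_point X (x - gam0 *\<^sub>R g)) / gam0 \<le> norm (x - closest_point X (x - gam *\<^sub>R g)) / gam"
proof -
  have ne: "X \<noteq> {}" using x by auto
  define u where "u = x - closest_point X (x - gam *\<^sub>R g)"
  define v where "v = x - closest_point X (x - gam0 *\<^sub>R g)"
  have 1: "(u - gam *\<^sub>R g) \<bullet> (u - v) \<le> 0"
    using closest_point_dot[OF X closest_point_in_set[OF X(2) ne], of "x - gam *\<^sub>R g" "x - gam0 *\<^sub>R g"]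
    unfolding u_def v_def by (simp add: algebra_simps)
  have 2: "(v - gam0 *\<^sub>R g) \<bullet> (v - u) \<le> 0"
    using closest_point_dot[OF X closest_point_in_set[OF X(2) ne], of "x - gam0 *\<^sub>R g" "x - gam *\<^sub>R g"]
    unfolding u_def v_def by (simp add: algebra_simps)
  \<comment> \<open>The weights make \<open>g\<close> cancel. What remains factors, up to
    Cauchy-Schwarz, into
    \<open>(norm u - norm v) * (gam0 * norm u - gam * norm v) \<le> 0\<close>.\<close>
  have 3: "gam0 * ((u - gam *\<^sub>R g) \<bullet> (u - v)) + gam * ((v - gam0 *\<^sub>R g) \<bullet> (v - u)) \<le> 0"
    using mult_left_mono[OF 1, of gam0] mult_left_mono[OF 2, of gam] gam by simp
  have 4: "gam0 * ((u - gam *\<^sub>R g) \<bullet> (u - v)) + gam * ((v - gam0 *\<^sub>R g) \<bullet> (v - u))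
      = gam0 * (u \<bullet> u) - (gam0 + gam) * (u \<bullet> v) + gam * (v \<bullet> v)"
    by (simp add: inner_diff_left inner_diff_right inner_commute algebra_simps)
  have 5: "(gam0 + gam) * (u \<bullet> v) \<le> (gam0 + gam) * (norm u * norm v)"
    using gam by (intro mult_left_mono norm_cauchy_schwarz) auto
  have "(norm u - norm v) * (gam0 * norm u - gam * norm v)
      = gam0 * (u \<bullet> u) - (gam0 + gam) * (norm u * norm v) + gam * (v \<bullet> v)"
    by (simp add: dot_square_norm power2_eq_square algebra_simps)
  then have 6: "(norm u - norm v) * (gam0 * norm u - gam * norm v) \<le> 0"
    using 3 4 5 by linarith
  have "gam * norm v \<le> gam0 * norm u"
  proof (rule ccontr)
    assume c: "\<not> ?thesis"
    have "gam * norm v \<le> gam0 * norm v" using gam by (intro mult_right_mono) auto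
    then have "gam0 * norm u < gam0 * norm v" using c by linarith
    then have "norm u < norm v" using gam by simp
    then have "(norm u - norm v) * (gam0 * norm u - gam * norm v) > 0"
      using c by (intro mult_neg_neg) auto
    then show False using 6 by simp
  qed
  then show ?thesis using gam unfolding u_def v_def by (simp add: field_simps)
qed

lemma norm_projection_residual_le:
  fixes X :: "'a::euclidean_space set"
  assumes X: "convex X" "closed X" and x: "x \<in> X"
  shows "norm (x - closest_point X (x - h)) \<le> norm h"
proof -
  have "dist (closest_point X x) (closest_point X (x - h)) \<le> dist x (x - h)"
    using x by (intro closest_point_lipschitz X) auto
  then show ?thesis using closest_point_self[OF x] by (simp add: dist_norm)
qed

section \<open>The residual does not depend on the choice made by \<open>gradient_on\<close>\<close>

lemma relative_derivative_unique:
  fixes G :: "'a::real_inner \<Rightarrow> real"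
  assumes X: "convex X" "x \<in> X" "y \<in> X"
    and g: "(G has_derivative (\<lambda>h. g \<bullet> h)) (at x within X)"
    and g': "(G has_derivative (\<lambda>h. g' \<bullet> h)) (at x within X)"
  shows "g \<bullet> (y - x) = g' \<bullet> (y - x)"
proof -
  \<comment> \<open>Along the segment to \<open>y\<close>, both vectors give the one-sided
    derivative of the same function of one variable.\<close>
  let ?p = "\<lambda>t::real. x + t *\<^sub>R (y - x)"
  have pX: "?p ` {0..1} \<subseteq> X"
  proof clarify
    fix t :: real assume "t \<in> {0..1}"
    then have "(1 - t) *\<^sub>R x + t *\<^sub>R y \<in> X" using convexD_alt[OF X(1-3), of t] by simp
    then show "?p t \<in> X" by (simp add: algebra_simps)
  qed
  have dp: "(?p has_derivative (\<lambda>t. t *\<^sub>R (y - x))) (at 0 within {0..1})"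
    by (auto intro!: derivative_eq_intros)
  have *: "((\<lambda>t. G (?p t)) has_vector_derivative k \<bullet> (y - x)) (at 0 within {0..1})"
    if k: "(G has_derivative (\<lambda>h. k \<bullet> h)) (at x within X)" for k
  proof -
    have "(G has_derivative (\<lambda>h. k \<bullet> h)) (at (?p 0) within ?p ` {0..1})"
      using has_derivative_subset[OF k pX] by simp
    from has_derivative_in_compose[OF dp this] show ?thesis
      by (simp add: has_vector_derivative_def mult.commute)
  qed
  show ?thesis
    by (rule vector_derivative_unique_within_closed_interval[where a=0 and b=1 and x=0, OF _ _ *[OF g, unfolded cbox_interval[symmetric]] *[OF g', unfolded cbox_interval[symmetric]]]) auto
qed

text \<open>In the differentiable case the description is justified by representing the derivative
  as an inner product; otherwise the hypothesis supplies a candidate for the choice.\<close>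

lemma gradient_on_has_derivative:
  fixes G :: "real^'n \<Rightarrow> real"
  assumes g: "(G has_derivative (\<lambda>h. g \<bullet> h)) (at x within X)"
  shows "(G has_derivative (\<lambda>h. gradient_on X G x \<bullet> h)) (at x within X)"
proof (cases "G differentiable (at x)")
  case True
  then obtain D where D: "(G has_derivative D) (at x)" by (auto simp: differentiable_def)
  interpret D: bounded_linear D using D by (rule has_derivative_bounded_linear)
  define k where "k = (\<Sum>b\<in>Basis. D b *\<^sub>R b)"
  have "D = (\<lambda>h. k \<bullet> h)"
  proof
    fix h
    have "D h = D (\<Sum>b\<in>Basis. (h \<bullet> b) *\<^sub>R b)" by (simp add: euclidean_representation)
    also have "\<dots> = (\<Sum>b\<in>Basis. (h \<bullet> b) * D b)" by (simp add: D.sum D.scaleR)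
    also have "\<dots> = k \<bullet> h" by (simp add: k_def inner_sum_left inner_commute[of h] mult.commute)
    finally show "D h = k \<bullet> h" .
  qed
  then have k: "(G has_derivative (\<lambda>h. k \<bullet> h)) (at x)" using D by simp
  have "(G has_derivative (\<lambda>h. (THE g. (G has_derivative (\<lambda>h. g \<bullet> h)) (at x)) \<bullet> h)) (at x)"
  proof (rule theI[where P="\<lambda>g. (G has_derivative (\<lambda>h. g \<bullet> h)) (at x)", OF k])
    fix k' assume "(G has_derivative (\<lambda>h. k' \<bullet> h)) (at x)"
    then have "(\<lambda>h. k' \<bullet> h) = (\<lambda>h. k \<bullet> h)" using k by (rule has_derivative_unique)
    then show "k' = k" by (metis vector_eq_rdot)
  qed
  then show ?thesis using True by (simp add: gradient_on_def has_derivative_at_withinI)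
next
  case False
  then show ?thesis
    using someI[where P="\<lambda>g. (G has_derivative (\<lambda>h. g \<bullet> h)) (at x within X)", OF g]
    by (simp add: gradient_on_def)
qed

text \<open>Such a shift changes the squared distances to all points of \<open>X\<close> by the same
  amount, so the minimiser stays.\<close>

lemma closest_point_orthogonal_shift:
  fixes X :: "'a::euclidean_space set"
  assumes X: "convex X" "closed X" "X \<noteq> {}" and w: "\<And>y z. y \<in> X \<Longrightarrow> z \<in> X \<Longrightarrow> w \<bullet> (y - z) = 0"
  shows "closest_point X (a + w) = closest_point X a"
proof (rule closest_point_unique[OF X(1,2), symmetric])
  let ?p = "closest_point X a"
  show p: "?p \<in> X" by (rule closest_point_in_set[OF X(2,3)])
  show "\<forall>z\<in>X. dist (a + w) ?p \<le> dist (a + w) z"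
  proof
    fix z assume z: "z \<in> X"
    have "dist a ?p \<le> dist a z" by (rule closest_point_le[OF X(2) z])
    then have "(a - ?p) \<bullet> (a - ?p) \<le> (a - z) \<bullet> (a - z)" by (simp add: dist_norm norm_le)
    moreover have "w \<bullet> (z - ?p) = 0" by (rule w[OF z p])
    ultimately have "(a + w - ?p) \<bullet> (a + w - ?p) \<le> (a + w - z) \<bullet> (a + w - z)"
      by (simp add: inner_add_left inner_add_right inner_diff_left inner_diff_right inner_commute algebra_simps)
    then show "dist (a + w) ?p \<le> dist (a + w) z" by (simp add: dist_norm norm_le)
  qed
qed

lemma smoothed_cong:
  fixes F :: "real^'n \<Rightarrow> real"
  assumes "\<And>z. norm (z - x) \<le> eta \<Longrightarrow> f z = F z" "0 \<le> eta" and F: "continuous_on UNIV F"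
    and fm[measurable]: "(\<lambda>u. f (x + eta *\<^sub>R u)) \<in> borel_measurable borel"
  shows "smoothed f eta x = smoothed F eta x"
  unfolding smoothed_def
proof (rule integral_cong_AE)
  have "continuous_on UNIV (\<lambda>u. F (x + eta *\<^sub>R u))"
    by (auto intro!: continuous_intros continuous_on_compose2[OF F])
  then show "(\<lambda>u. F (x + eta *\<^sub>R u)) \<in> borel_measurable uball"
    using borel_measurable_continuous_onI by (simp add: uniform_measure_def)
  show "AE u in uball. f (x + eta *\<^sub>R u) = F (x + eta *\<^sub>R u)"
    using AE_uball
  proof eventually_elim
    case (elim u)
    then have "norm (x + eta *\<^sub>R u - x) \<le> eta" using assms(2) by (simp add: mult_left_le)
    then show ?case by (rule assms(1))
  qed
qed (simp add: uniform_measure_def)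

text \<open>The residual for an explicit vector field; with \<open>ball_gradient F eta\<close> it is
  continuous on the whole space, hence measurable along the iterates.\<close>

definition proj_residual :: "(real^'n) set \<Rightarrow> (real^'n \<Rightarrow> real^'n) \<Rightarrow> real \<Rightarrow> real^'n \<Rightarrow> real^'n" where
  "proj_residual X g beta x = beta *\<^sub>R (x - closest_point X (x - (1 / beta) *\<^sub>R g x))"

text \<open>The two smoothings agree on \<open>X\<close>, so only derivatives relative to
  \<open>X\<close> can be compared. These coincide on differences of points of \<open>X\<close>, and
  the rest is invisible to the projection.\<close>

lemma residual_eq_proj_residual:
  fixes F :: "real^'n \<Rightarrow> real"
  assumes X: "convex X" "closed X" and x: "x \<in> X" and F: "L-lipschitz_on UNIV F" and eta: "0 < eta"
    and fF: "\<And>y. y \<in> X \<Longrightarrow> smoothed f eta y = smoothed F eta y"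
  shows "residual X f eta beta x = proj_residual X (ball_gradient F eta) beta x"
proof -
  let ?h = "ball_gradient F eta x"
  let ?G = "gradient_on X (smoothed f eta) x"
  have ne: "X \<noteq> {}" using x by auto
  have h: "(smoothed f eta has_derivative (\<lambda>k. ?h \<bullet> k)) (at x within X)"
    by (rule has_derivative_transform[OF x _ smoothed_has_derivative[OF F eta]]) (rule fF)
  note G = gradient_on_has_derivative[OF h]
  have orth: "?G \<bullet> (y - x) = ?h \<bullet> (y - x)" if "y \<in> X" for y
    by (rule relative_derivative_unique[OF X(1) x that G h])
  let ?w = "(1 / beta) *\<^sub>R (?h - ?G)"
  have "closest_point X (x - (1 / beta) *\<^sub>R ?h + ?w) = closest_point X (x - (1 / beta) *\<^sub>R ?h)"
  proof (rule closest_point_orthogonal_shift[OF X ne])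
    fix y z assume "y \<in> X" "z \<in> X"
    then have "?G \<bullet> y - ?G \<bullet> x = ?h \<bullet> y - ?h \<bullet> x" "?G \<bullet> z - ?G \<bullet> x = ?h \<bullet> z - ?h \<bullet> x"
      using orth by (simp_all add: inner_diff_right)
    then show "?w \<bullet> (y - z) = 0"
      by (simp add: inner_diff_left inner_diff_right)
  qed
  then show ?thesis
    by (simp add: residual_def proj_residual_def scaleR_diff_right)
qed

lemma one_step_descent:
  fixes F :: "real^'n \<Rightarrow> real"
  assumes X: "convex X" "closed X" and x: "x \<in> X" and F: "L-lipschitz_on UNIV F" and eta: "0 < eta"
    and gam: "0 < gam" "gam \<le> gam0" and small: "sqrt CARD('n) * L * gam0 \<le> eta"
  shows "smoothed F eta (closest_point X (x - gam *\<^sub>R v))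
    \<le> smoothed F eta x - gam / 2 * (norm (proj_residual X (ball_gradient F eta) (1 / gam0) x))\<^sup>2
      + gam / 2 * (norm (v - ball_gradient F eta x))\<^sup>2"
proof -
  let ?g = "ball_gradient F eta x"
  let ?xn = "closest_point X (x - gam *\<^sub>R v)"
  let ?xh = "closest_point X (x - gam *\<^sub>R ?g)"
  let ?L1 = "sqrt CARD('n) * L / eta"
  have L0: "0 \<le> L" using F by (rule lipschitz_on_nonneg)
  have t: "smoothed F eta ?xn \<le> smoothed F eta x + ?g \<bullet> (?xn - x) + ?L1 * (norm (?xn - x))\<^sup>2 / 2"
    using smoothed_taylor[OF F eta, of ?xn x] by linarith
  have s: "?g \<bullet> (?xn - x) \<le> - (norm (?xh - x))\<^sup>2 / (2 * gam) - (norm (?xn - x))\<^sup>2 / (2 * gam)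
      + gam / 2 * (norm (v - ?g))\<^sup>2"
    by (rule projected_step_inequality[OF X x gam(1) refl]) simp
  \<comment> \<open>The place where the bound on the steps enters: the quadratic Taylor term is
    dominated by the step term of the three-point inequality.\<close>
  have "?L1 * gam \<le> ?L1 * gam0" using L0 eta gam by (intro mult_left_mono) auto
  also have "\<dots> \<le> 1" using small eta by (simp add: field_simps)
  finally have "?L1 \<le> 1 / gam" using gam by (simp add: pos_le_divide_eq)
  then have "?L1 * (norm (?xn - x))\<^sup>2 \<le> 1 / gam * (norm (?xn - x))\<^sup>2" by (rule mult_right_mono) simp
  then have "?L1 * (norm (?xn - x))\<^sup>2 / 2 \<le> 1 / gam * (norm (?xn - x))\<^sup>2 / 2" by (rule divide_right_mono) simp
  then have l: "?L1 * (norm (?xn - x))\<^sup>2 / 2 \<le> (norm (?xn - x))\<^sup>2 / (2 * gam)" by (simp only: times_divide_eq_left mult_1 divide_divide_eq_left mult.commute)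
  have "norm (proj_residual X (ball_gradient F eta) (1 / gam0) x) = norm (x - closest_point X (x - gam0 *\<^sub>R ?g)) / gam0"
    using gam by (simp add: proj_residual_def)
  also have "\<dots> \<le> norm (x - ?xh) / gam"
    by (rule scaled_projection_residual_antimono[OF X x gam])
  finally have "(norm (proj_residual X (ball_gradient F eta) (1 / gam0) x))\<^sup>2 \<le> (norm (x - ?xh) / gam)\<^sup>2"
    by (rule power_mono) simp
  then have "gam / 2 * (norm (proj_residual X (ball_gradient F eta) (1 / gam0) x))\<^sup>2 \<le> gam / 2 * (norm (x - ?xh) / gam)\<^sup>2"
    using gam by (intro mult_left_mono) auto
  also have "\<dots> = (norm (?xh - x))\<^sup>2 / (2 * gam)"
    using gam by (simp add: power2_eq_square norm_minus_commute)
  finally show ?thesis using t s l by linarith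
qed

text \<open>The projection is nonexpansive and fixes \<open>x\<close>. Besides integrability this
  gives the bound \<open>L0\<close> used for short windows.\<close>

lemma norm_proj_residual_le:
  fixes F :: "real^'n \<Rightarrow> real"
  assumes X: "convex X" "closed X" and x: "x \<in> X" and F: "L-lipschitz_on UNIV F" and eta: "0 < eta" and beta: "0 < beta"
  shows "norm (proj_residual X (ball_gradient F eta) beta x) \<le> L"
proof -
  have "norm (x - closest_point X (x - (1 / beta) *\<^sub>R ball_gradient F eta x)) \<le> norm ((1 / beta) *\<^sub>R ball_gradient F eta x)"
    by (rule norm_projection_residual_le[OF X x])
  also have "\<dots> \<le> 1 / beta * L"
    using norm_ball_gradient_le[OF F eta, of x] beta by (simp add: divide_right_mono)
  finally have "beta * norm (x - closest_point X (x - (1 / beta) *\<^sub>R ball_gradient F eta x)) \<le> beta * (1 / beta * L)"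
    using beta by (intro mult_left_mono) auto
  then show ?thesis using beta by (simp add: proj_residual_def)
qed

lemma continuous_proj_residual:
  fixes F :: "real^'n \<Rightarrow> real"
  assumes X: "convex X" "closed X" "X \<noteq> {}" and F: "L-lipschitz_on UNIV F" and eta: "0 < eta"
  shows "continuous_on UNIV (proj_residual X (ball_gradient F eta) beta)"
  unfolding proj_residual_def
  by (intro continuous_intros continuous_on_compose2[OF continuous_on_closest_point[OF X], of UNIV]
      lipschitz_on_continuous_on[OF ball_gradient_lipschitz[OF F eta]]) auto

subsection \<open>One sample of the gradient estimator\<close>

lemma uniform_sphere_eq: "uniform_sphere r = distr (sphere_measure :: (real^'n) measure) borel (\<lambda>t. r *\<^sub>R t)"
  unfolding uniform_sphere_def sphere_measure_def
  by (subst distr_distr) (auto simp: o_def sgn_div_norm divide_inverse)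

lemma sphere_integral_minus:
  fixes k :: "real^'n \<Rightarrow> 'b::{banach, second_countable_topology}"
  assumes [measurable]: "k \<in> borel_measurable borel"
  shows "(\<integral>t. k (- t) \<partial>sphere_measure) = (\<integral>t. k t \<partial>sphere_measure)"
proof -
  have "orthogonal_transformation (uminus :: real^'n \<Rightarrow> real^'n)"
    by (simp add: orthogonal_transformation_neg[where f="\<lambda>x. x"] orthogonal_transformation_id)
  then have "(\<integral>t. k t \<partial>sphere_measure) = (\<integral>t. k t \<partial>distr sphere_measure borel (uminus :: real^'n \<Rightarrow> real^'n))"
    using rotation_invariant_sphere[where 'n='n] by (simp add: rotation_invariant_def)
  also have "\<dots> = (\<integral>t. k (- t) \<partial>sphere_measure)"
    by (rule integral_distr) auto
  finally show ?thesis by simp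
qed

lemma power2_norm_diff: "(norm (a - b))\<^sup>2 = (norm a)\<^sup>2 - 2 * (a \<bullet> b) + (norm b)\<^sup>2" for a b :: "'a::real_inner"
  by (simp add: power2_norm_eq_inner inner_diff_left inner_diff_right inner_commute)

lemma power2_norm_add: "(norm (a + b))\<^sup>2 = (norm a)\<^sup>2 + 2 * (a \<bullet> b) + (norm b)\<^sup>2" for a b :: "'a::real_inner"
  by (simp add: power2_norm_eq_inner inner_add_left inner_add_right inner_commute)

locale zo_data =
  fixes P :: "'w measure" and xi :: "'w \<Rightarrow> real^'d"
    and X :: "(real^'n) set" and ft :: "real^'n \<Rightarrow> real^'d \<Rightarrow> real" and Lt :: "real^'d \<Rightarrow> real"
    and eta0 eta :: real
  assumes problem: "zo_problem P xi X ft Lt eta0" and eta: "0 < eta" "eta \<le> eta0"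
begin

abbreviation "mu \<equiv> distr P borel xi"
abbreviation "sigma_v \<equiv> (uniform_sphere eta :: (real^'n) measure)"
abbreviation "nu \<equiv> mu \<Otimes>\<^sub>M sigma_v"
abbreviation "f \<equiv> obj P xi ft"
definition "L0 = sqrt (\<integral>w. (Lt (xi w))\<^sup>2 \<partial>P)"

lemma prob_P: "prob_space P" and xi_m[measurable]: "xi \<in> borel_measurable P"
  and ft_m[measurable]: "(\<lambda>(x, z). ft x z) \<in> borel_measurable (borel \<Otimes>\<^sub>M borel)"
  and Lt_m[measurable]: "Lt \<in> borel_measurable borel"
  and lip: "AE z in mu. (Lt z)-lipschitz_on (X + cball 0 eta0) (\<lambda>x. ft x z)"
  and Lt2: "integrable P (\<lambda>w. (Lt (xi w))\<^sup>2)"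
  and X: "convex X" "closed X" and Xne: "X \<noteq> {}"
  and ft_int: "\<And>x. x \<in> X + cball 0 eta0 \<Longrightarrow> integrable P (\<lambda>w. ft x (xi w))"
  and f_bdd: "bdd_below (f ` X)"
  using problem unfolding zo_problem_def by auto

lemma ft_comp[measurable]:
  assumes [measurable]: "a \<in> borel_measurable A" "b \<in> borel_measurable A"
  shows "(\<lambda>w. ft (a w) (b w)) \<in> borel_measurable A"
  using measurable_compose[OF measurable_Pair[OF assms] ft_m] by simp

lemma zo_grad_eq: "zo_grad ft eta x v z = (real CARD('n) / (2 * eta) * (ft (x + v) z - ft (x - v) z)) *\<^sub>R sgn v"
  unfolding zo_grad_def sgn_div_norm by (simp only: inverse_eq_divide)

lemma zo_grad_comp[measurable]:
  assumes [measurable]: "a \<in> borel_measurable A" "b \<in> borel_measurable A" "c \<in> borel_measurable A"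
  shows "(\<lambda>w. zo_grad ft eta (a w) (b w) (c w)) \<in> borel_measurable A"
  unfolding zo_grad_eq by measurable

lemma in_nbhd: "x \<in> X \<Longrightarrow> norm v \<le> eta \<Longrightarrow> x + v \<in> X + cball 0 eta0"
  using eta by (auto intro!: set_plus_intro)

lemma prob_mu: "prob_space mu"
  by (rule prob_space.prob_space_distr[OF prob_P]) simp

lemma prob_sigma: "prob_space sigma_v"
  unfolding uniform_sphere_eq by (rule prob_space.prob_space_distr[OF prob_space_sphere]) simp

lemma sets_sigma_v[simp, measurable_cong]: "sets sigma_v = sets borel"
  by (simp add: uniform_sphere_eq)

lemma space_sigma_v[simp]: "space sigma_v = UNIV"
  by (simp add: uniform_sphere_eq)

lemma AE_sigma: "AE v in sigma_v. norm v = eta"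
  unfolding uniform_sphere_eq
  by (subst AE_distr_iff) (use AE_sphere_measure[where 'n='n] eta in auto)

sublocale PS: pair_sigma_finite mu sigma_v
  by (intro pair_sigma_finite.intro prob_space_imp_sigma_finite prob_mu prob_sigma)

lemma prob_nu: "prob_space nu"
proof -
  interpret m: prob_space mu by (rule prob_mu)
  interpret s: prob_space sigma_v by (rule prob_sigma)
  interpret pp: pair_prob_space mu sigma_v ..
  show ?thesis by (rule pp.P.prob_space_axioms)
qed

text \<open>The almost sure Lipschitz property is pulled back along the first projection, because
  this way asks for no measurability of the set of good \<open>z\<close>.\<close>

lemma AE_nu: "AE w in nu. (Lt (fst w))-lipschitz_on (X + cball 0 eta0) (\<lambda>x. ft x (fst w)) \<and> norm (snd w) = eta"
proof -
  interpret s: prob_space sigma_v by (rule prob_sigma)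
  have "AE z in distr nu mu fst. (Lt z)-lipschitz_on (X + cball 0 eta0) (\<lambda>x. ft x z)"
    unfolding s.distr_pair_fst by (rule lip)
  then have "AE w in nu. (Lt (fst w))-lipschitz_on (X + cball 0 eta0) (\<lambda>x. ft x (fst w))"
    by (rule AE_distrD[rotated]) simp
  moreover have "AE w in nu. norm (snd w) = eta"
  proof (rule PS.AE_pair_measure)
    show "{w \<in> space nu. norm (snd w) = eta} \<in> sets nu" by measurable
  qed (use AE_sigma in simp)
  ultimately show ?thesis by eventually_elim auto
qed

lemma integrable_mu: "integrable mu k \<longleftrightarrow> integrable P (\<lambda>w. k (xi w))"
  if [measurable]: "k \<in> borel_measurable borel" for k :: "real^'d \<Rightarrow> real"
  by (subst integrable_distr_eq) auto

lemma integral_mu: "(\<integral>z. k z \<partial>mu) = (\<integral>w. k (xi w) \<partial>P)"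
  if [measurable]: "k \<in> borel_measurable borel" for k :: "real^'d \<Rightarrow> real"
  by (subst integral_distr) auto

lemma Lt2_mu: "integrable mu (\<lambda>z. (Lt z)\<^sup>2)" "(\<integral>z. (Lt z)\<^sup>2 \<partial>mu) = L0\<^sup>2"
proof -
  show "integrable mu (\<lambda>z. (Lt z)\<^sup>2)" using Lt2 by (subst integrable_mu) auto
  show "(\<integral>z. (Lt z)\<^sup>2 \<partial>mu) = L0\<^sup>2"
    by (subst integral_mu) (auto simp: L0_def)
qed

lemma L0_nonneg: "0 \<le> L0" by (simp add: L0_def)

lemma Lt_mu: "integrable mu Lt" "(\<integral>z. Lt z \<partial>mu) \<le> L0"
proof -
  interpret m: prob_space mu by (rule prob_mu)
  show i: "integrable mu Lt"
  proof (rule Bochner_Integration.integrable_bound)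
    show "integrable mu (\<lambda>z. 1 + (Lt z)\<^sup>2)" using Lt2_mu by simp
    show "AE z in mu. norm (Lt z) \<le> norm (1 + (Lt z)\<^sup>2)"
    proof (rule AE_I2)
      fix z
      have "0 \<le> (\<bar>Lt z\<bar> - 1/2)\<^sup>2" by simp
      then show "norm (Lt z) \<le> norm (1 + (Lt z)\<^sup>2)" by (simp add: power2_diff power_divide)
    qed
  qed simp
  have "0 \<le> m.variance Lt" by simp
  also have "\<dots> = L0\<^sup>2 - (\<integral>z. Lt z \<partial>mu)\<^sup>2"
    using i Lt2_mu by (subst m.variance_eq) auto
  finally have "(\<integral>z. Lt z \<partial>mu)\<^sup>2 \<le> L0\<^sup>2" by simp
  then show "(\<integral>z. Lt z \<partial>mu) \<le> L0" using L0_nonneg by (rule power2_le_imp_le)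
qed

section \<open>The objective and its global Lipschitz extension\<close>

lemma f_eq: "f x = (\<integral>z. ft x z \<partial>mu)"
  unfolding obj_def by (subst integral_mu) auto

lemma ft_int_mu: "x \<in> X + cball 0 eta0 \<Longrightarrow> integrable mu (\<lambda>z. ft x z)"
  using ft_int by (subst integrable_mu) auto

lemma f_lipschitz: "L0-lipschitz_on (X + cball 0 eta0) f"
proof (rule lipschitz_onI[OF _ L0_nonneg])
  fix x y assume xy: "x \<in> X + cball 0 eta0" "y \<in> X + cball 0 eta0"
  have "dist (f x) (f y) = \<bar>\<integral>z. ft x z - ft y z \<partial>mu\<bar>"
    unfolding f_eq dist_real_def using ft_int_mu[OF xy(1)] ft_int_mu[OF xy(2)] by simp
  also have "\<dots> \<le> (\<integral>z. \<bar>ft x z - ft y z\<bar> \<partial>mu)" by (rule integral_abs_bound)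
  also have "\<dots> \<le> (\<integral>z. Lt z * dist x y \<partial>mu)"
  proof (rule integral_mono_AE)
    show "AE z in mu. \<bar>ft x z - ft y z\<bar> \<le> Lt z * dist x y"
      using lip
    proof eventually_elim
      case (elim z)
      from lipschitz_onD[OF elim xy] show ?case by (simp add: dist_real_def)
    qed
  qed (use ft_int_mu[OF xy(1)] ft_int_mu[OF xy(2)] Lt_mu in auto)
  also have "\<dots> \<le> L0 * dist x y" using Lt_mu by (simp add: mult_right_mono)
  finally show "dist (f x) (f y) \<le> L0 * dist x y" .
qed

text \<open>Fixed once by choice, so that the potential and the gradient field of the descent
  argument belong to the same extension.\<close>

definition F :: "real^'n \<Rightarrow> real" where
  "F = (SOME F. L0-lipschitz_on UNIV F \<and> (\<forall>x\<in>X + cball 0 eta0. F x = f x))"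

lemma F_lip: "L0-lipschitz_on UNIV F" and F_eq: "x \<in> X + cball 0 eta0 \<Longrightarrow> F x = f x"
proof -
  obtain F' where "L0-lipschitz_on UNIV F'" "\<And>x. x \<in> X + cball 0 eta0 \<Longrightarrow> F' x = f x"
    using lipschitz_extension[OF f_lipschitz] by blast
  then have "\<exists>F. L0-lipschitz_on UNIV F \<and> (\<forall>x\<in>X + cball 0 eta0. F x = f x)" by blast
  from someI_ex[OF this]
  show "L0-lipschitz_on UNIV F" "x \<in> X + cball 0 eta0 \<Longrightarrow> F x = f x"
    unfolding F_def by auto
qed

lemma F_eq_X: "x \<in> X \<Longrightarrow> F x = f x"
  using F_eq[of x] in_nbhd[of x 0] eta by simp

lemma F_cont: "continuous_on UNIV F"
  using F_lip by (rule lipschitz_on_continuous_on)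

lemma F_m[measurable]: "F \<in> borel_measurable borel"
  using F_cont by (rule borel_measurable_continuous_onI)

text \<open>Measurability on the whole space, including points away from \<open>X\<close> where the
  integrand may fail to be integrable and the integral has its default value.\<close>

lemma f_m[measurable]: "f \<in> borel_measurable borel"
proof -
  interpret m: prob_space mu by (rule prob_mu)
  have "(\<lambda>(x, z). ft x z) \<in> borel_measurable (borel \<Otimes>\<^sub>M mu)"
    by (subst measurable_cong_sets[OF sets_pair_measure_cong[OF refl sets_distr] refl]) (rule ft_m)
  from PS.M1.borel_measurable_lebesgue_integral[OF this] show ?thesis
    by (simp add: f_eq[abs_def])
qed

lemma smoothed_eq: "smoothed f eta x = smoothed F eta x" if x: "x \<in> X" for x
proof (rule smoothed_cong[OF _ _ F_cont])
  fix z assume "norm (z - x) \<le> eta"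
  then show "f z = F z" using F_eq[OF in_nbhd[OF x, of "z - x"]] by simp
qed (use eta in auto)

definition g :: "real^'n \<Rightarrow> real^'n" where "g = ball_gradient F eta"

lemma g_cont: "continuous_on UNIV g"
  unfolding g_def by (rule lipschitz_on_continuous_on[OF ball_gradient_lipschitz[OF F_lip eta(1)]])

lemma g_m[measurable]: "g \<in> borel_measurable borel"
  using g_cont by (rule borel_measurable_continuous_onI)

lemma norm_g: "norm (g x) \<le> L0"
  unfolding g_def by (rule norm_ball_gradient_le[OF F_lip eta(1)])

text \<open>A crude bound, linear in the dimension, for the sake of integrability; the second moment
  that counts is that of \<open>zo_grad_second_moment\<close>.\<close>

lemma zo_grad_bound:
  assumes x: "x \<in> X" and l: "(Lt z)-lipschitz_on (X + cball 0 eta0) (\<lambda>x. ft x z)" and v: "norm v = eta"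
  shows "norm (zo_grad ft eta x v z) \<le> CARD('n) * Lt z"
proof -
  have "x + v - (x + - v) = 2 *\<^sub>R v" by (simp add: scaleR_2)
  then have "dist (x + v) (x + - v) = 2 * eta" unfolding dist_norm using v by simp
  then have "\<bar>ft (x + v) z - ft (x - v) z\<bar> \<le> Lt z * (2 * eta)"
    using lipschitz_onD[OF l in_nbhd[OF x, of v] in_nbhd[OF x, of "- v"]] v
    by (simp add: dist_real_def)
  then have "CARD('n) / (2 * eta) * \<bar>ft (x + v) z - ft (x - v) z\<bar> \<le> CARD('n) / (2 * eta) * (Lt z * (2 * eta))"
    using eta by (intro mult_left_mono) auto
  moreover have "v \<noteq> 0" using v eta by auto
  ultimately show ?thesis
    using eta by (simp add: zo_grad_eq norm_sgn abs_mult)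
qed

lemma AE_zo_grad_bound: "x \<in> X \<Longrightarrow> AE w in nu. norm (zo_grad ft eta x (snd w) (fst w)) \<le> CARD('n) * Lt (fst w)"
  using AE_nu by eventually_elim (use zo_grad_bound in auto)

lemma integrable_fst_nu: "integrable nu (\<lambda>w. k (fst w))" if "integrable mu k" for k :: "real^'d \<Rightarrow> real"
proof -
  interpret s: prob_space sigma_v by (rule prob_sigma)
  have "integrable (distr nu mu fst) k" using that by (simp add: s.distr_pair_fst)
  then show ?thesis by (rule integrable_distr[rotated]) simp
qed

lemma integrable_zo_grad:
  assumes x: "x \<in> X"
  shows "integrable nu (\<lambda>w. zo_grad ft eta x (snd w) (fst w))"
    and "integrable nu (\<lambda>w. (norm (zo_grad ft eta x (snd w) (fst w)))\<^sup>2)"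
proof -
  show "integrable nu (\<lambda>w. zo_grad ft eta x (snd w) (fst w))"
  proof (rule Bochner_Integration.integrable_bound)
    show "integrable nu (\<lambda>w. CARD('n) * Lt (fst w))"
      using integrable_fst_nu[OF Lt_mu(1)] by simp
    show "AE w in nu. norm (zo_grad ft eta x (snd w) (fst w)) \<le> norm (CARD('n) * Lt (fst w))"
      using AE_zo_grad_bound[OF x] by eventually_elim auto
  qed simp
  show "integrable nu (\<lambda>w. (norm (zo_grad ft eta x (snd w) (fst w)))\<^sup>2)"
  proof (rule Bochner_Integration.integrable_bound)
    show "integrable nu (\<lambda>w. (CARD('n))\<^sup>2 * (Lt (fst w))\<^sup>2)"
      using integrable_fst_nu[OF Lt2_mu(1)] by simp
    show "AE w in nu. norm ((norm (zo_grad ft eta x (snd w) (fst w)))\<^sup>2) \<le> norm ((CARD('n))\<^sup>2 * (Lt (fst w))\<^sup>2)"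
      using AE_zo_grad_bound[OF x]
    proof eventually_elim
      case (elim w)
      from power_mono[OF elim, of 2] show ?case by (simp add: power_mult_distrib)
    qed
  qed simp
qed

text \<open>Integrating over the data first turns \<open>ft\<close> into the objective, since
  \<open>x + v\<close> and \<open>x - v\<close> stay in the neighbourhood of \<open>X\<close>. The
  two halves of the symmetric difference then contribute equally.\<close>

lemma zo_grad_unbiased:
  assumes x: "x \<in> X"
  shows "(\<integral>w. zo_grad ft eta x (snd w) (fst w) \<partial>nu) = g x"
proof -
  let ?c = "real CARD('n) / (2 * eta)"
  have "(\<integral>w. zo_grad ft eta x (snd w) (fst w) \<partial>nu) = (\<integral>v. (\<integral>z. zo_grad ft eta x v z \<partial>mu) \<partial>sigma_v)"
    using PS.integral_snd[of "\<lambda>z v. zo_grad ft eta x v z"] integrable_zo_grad(1)[OF x] by (simp add: split_beta')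
  also have "\<dots> = (\<integral>v. (?c * (F (x + v) - F (x - v))) *\<^sub>R sgn v \<partial>sigma_v)"
  proof (rule integral_cong_AE)
    show "AE v in sigma_v. (\<integral>z. zo_grad ft eta x v z \<partial>mu) = (?c * (F (x + v) - F (x - v))) *\<^sub>R sgn v"
      using AE_sigma
    proof eventually_elim
      case (elim v)
      then have p: "x + v \<in> X + cball 0 eta0" "x - v \<in> X + cball 0 eta0"
        using in_nbhd[OF x, of v] in_nbhd[OF x, of "- v"] by auto
      have i: "integrable mu (\<lambda>z. ?c * (ft (x + v) z - ft (x - v) z))"
        using ft_int_mu[OF p(1)] ft_int_mu[OF p(2)] by simp
      have "(\<integral>z. zo_grad ft eta x v z \<partial>mu) = (\<integral>z. ?c * (ft (x + v) z - ft (x - v) z) \<partial>mu) *\<^sub>R sgn v"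
        unfolding zo_grad_eq using i by (intro integral_scaleR_left) auto
      also have "(\<integral>z. ?c * (ft (x + v) z - ft (x - v) z) \<partial>mu) = ?c * (F (x + v) - F (x - v))"
        unfolding F_eq[OF p(1)] F_eq[OF p(2)] f_eq using ft_int_mu[OF p(1)] ft_int_mu[OF p(2)] by simp
      finally show ?case .
    qed
    have "(\<lambda>(z, v). zo_grad ft eta x v z) \<in> borel_measurable (mu \<Otimes>\<^sub>M sigma_v)" by measurable
    then have "(\<lambda>(v, z). zo_grad ft eta x v z) \<in> borel_measurable (sigma_v \<Otimes>\<^sub>M mu)"
      using measurable_pair_swap by fastforce
    then show "(\<lambda>v. \<integral>z. zo_grad ft eta x v z \<partial>mu) \<in> borel_measurable sigma_v"
      by (rule sigma_finite_measure.borel_measurable_lebesgue_integral[OF prob_space_imp_sigma_finite[OF prob_mu]])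
  qed measurable
  also have "\<dots> = (\<integral>t. (?c * (F (x + eta *\<^sub>R t) - F (x - eta *\<^sub>R t))) *\<^sub>R sgn (eta *\<^sub>R t) \<partial>sphere_measure)"
    unfolding uniform_sphere_eq by (rule integral_distr) auto
  also have "\<dots> = (\<integral>t. ?c *\<^sub>R (F (x + eta *\<^sub>R t) *\<^sub>R t + F (x + eta *\<^sub>R (- t)) *\<^sub>R (- t)) \<partial>sphere_measure)"
  proof (rule integral_cong_AE)
    show "AE t in sphere_measure. (?c * (F (x + eta *\<^sub>R t) - F (x - eta *\<^sub>R t))) *\<^sub>R sgn (eta *\<^sub>R t)
        = ?c *\<^sub>R (F (x + eta *\<^sub>R t) *\<^sub>R t + F (x + eta *\<^sub>R (- t)) *\<^sub>R (- t))"
      using AE_sphere_measure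
    proof eventually_elim
      case (elim t)
      then have "sgn (eta *\<^sub>R t) = t" using eta by (simp add: sgn_scaleR sgn_div_norm)
      then show ?case by (simp add: algebra_simps)
    qed
  qed measurable
  also have "\<dots> = ?c *\<^sub>R ((\<integral>t. F (x + eta *\<^sub>R t) *\<^sub>R t \<partial>sphere_measure) + (\<integral>t. F (x + eta *\<^sub>R (- t)) *\<^sub>R (- t) \<partial>sphere_measure))"
  proof -
    have i: "integrable sphere_measure (\<lambda>t. F (x + eta *\<^sub>R t) *\<^sub>R t)"
      "integrable sphere_measure (\<lambda>t. F (x + eta *\<^sub>R (- t)) *\<^sub>R (- t))"
      by (rule integrable_sphere_continuous, auto intro!: continuous_intros continuous_on_compose2[OF F_cont])+
    show ?thesis unfolding integral_scaleR_right Bochner_Integration.integral_add[OF i] ..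
  qed
  \<comment> \<open>Reflection invariance of the sphere; the doubling turns
    \<open>n / (2 * eta)\<close> into the factor \<open>n / eta\<close> of the gradient.\<close>
  also have "(\<integral>t. F (x + eta *\<^sub>R (- t)) *\<^sub>R (- t) \<partial>sphere_measure) = (\<integral>t. F (x + eta *\<^sub>R t) *\<^sub>R t \<partial>sphere_measure)"
    by (rule sphere_integral_minus[of "\<lambda>t. F (x + eta *\<^sub>R t) *\<^sub>R t"]) measurable
  finally show ?thesis
    by (simp add: g_def ball_gradient_def flip: scaleR_2)
qed

definition "V = pi\<^sup>2 * CARD('n) * L0\<^sup>2"

text \<open>Here the directions are integrated first, for a frozen sample:
  \<open>t \<mapsto> ft (x + eta *\<^sub>R t) z\<close> has constant \<open>eta * Lt z\<close> on
  the unit ball, and \<open>(n / (2 * eta))^2 * 4 * pi^2 * (eta * Lt z)^2 / n\<close> is linear in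
  \<open>n\<close>.\<close>

lemma zo_grad_second_moment:
  assumes x: "x \<in> X"
  shows "(\<integral>w. (norm (zo_grad ft eta x (snd w) (fst w)))\<^sup>2 \<partial>nu) \<le> V"
proof -
  let ?n = "real CARD('n)"
  have i2: "integrable nu (\<lambda>(z, v). (norm (zo_grad ft eta x v z))\<^sup>2)"
    using integrable_zo_grad(2)[OF x] by (simp add: split_beta')
  have "(\<integral>w. (norm (zo_grad ft eta x (snd w) (fst w)))\<^sup>2 \<partial>nu)
      = (\<integral>z. (\<integral>v. (norm (zo_grad ft eta x v z))\<^sup>2 \<partial>sigma_v) \<partial>mu)"
    using PS.integral_fst'[OF i2] by (simp add: split_beta')
  also have "\<dots> \<le> (\<integral>z. pi\<^sup>2 * ?n * (Lt z)\<^sup>2 \<partial>mu)"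
  proof (rule integral_mono_AE)
    show "integrable mu (\<lambda>z. \<integral>v. (norm (zo_grad ft eta x v z))\<^sup>2 \<partial>sigma_v)"
      using PS.integrable_fst'[OF i2] by simp
    show "integrable mu (\<lambda>z. pi\<^sup>2 * ?n * (Lt z)\<^sup>2)" using Lt2_mu by simp
    show "AE z in mu. (\<integral>v. (norm (zo_grad ft eta x v z))\<^sup>2 \<partial>sigma_v) \<le> pi\<^sup>2 * ?n * (Lt z)\<^sup>2"
      using lip
    proof eventually_elim
      case (elim z)
      let ?H = "\<lambda>t. ft (x + eta *\<^sub>R t) z"
      have Hm[measurable]: "?H \<in> borel_measurable borel" by measurable
      have H: "(eta * Lt z)-lipschitz_on (cball 0 1) ?H"
      proof (rule lipschitz_onI)
        show "0 \<le> eta * Lt z" using eta lipschitz_on_nonneg[OF elim] by simp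
        fix s t :: "real^'n" assume "s \<in> cball 0 1" "t \<in> cball 0 1"
        then have "x + eta *\<^sub>R s \<in> X + cball 0 eta0" "x + eta *\<^sub>R t \<in> X + cball 0 eta0"
          using eta by (auto intro!: in_nbhd[OF x] simp: mult_left_le)
        from lipschitz_onD[OF elim this] show "dist (?H s) (?H t) \<le> eta * Lt z * dist s t"
          using eta by (simp add: dist_norm mult.assoc mult.left_commute flip: scaleR_diff_right)
      qed
      have "(\<integral>v. (norm (zo_grad ft eta x v z))\<^sup>2 \<partial>sigma_v)
          = (\<integral>t. (norm (zo_grad ft eta x (eta *\<^sub>R t) z))\<^sup>2 \<partial>sphere_measure)"
        unfolding uniform_sphere_eq by (rule integral_distr) auto
      also have "\<dots> = (\<integral>t. (?n / (2 * eta))\<^sup>2 * (?H t - ?H (- t))\<^sup>2 \<partial>sphere_measure)"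
      proof (rule integral_cong_AE)
        show "AE t in sphere_measure. (norm (zo_grad ft eta x (eta *\<^sub>R t) z))\<^sup>2 = (?n / (2 * eta))\<^sup>2 * (?H t - ?H (- t))\<^sup>2"
          using AE_sphere_measure
        proof eventually_elim
          case (elim t)
          then have "norm (sgn (eta *\<^sub>R t)) = 1" using eta by (auto simp: norm_sgn)
          then have "norm (zo_grad ft eta x (eta *\<^sub>R t) z) = \<bar>?n / (2 * eta) * (?H t - ft (x - eta *\<^sub>R t) z)\<bar>"
            by (simp only: zo_grad_eq norm_scaleR mult_1_right real_norm_def)
          then show ?case by (simp only: power2_abs power_mult_distrib) simp
        qed
      qed measurable
      also have "\<dots> = (?n / (2 * eta))\<^sup>2 * (\<integral>t. (?H t - ?H (- t))\<^sup>2 \<partial>sphere_measure)"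
        by simp
      also have "\<dots> \<le> (?n / (2 * eta))\<^sup>2 * (4 * pi\<^sup>2 * (eta * Lt z)\<^sup>2 / ?n)"
        by (intro mult_left_mono sphere_odd_variance(1)[OF H Hm]) simp
      also have "\<dots> = pi\<^sup>2 * ?n * (Lt z)\<^sup>2"
        using eta by (simp add: power2_eq_square field_simps)
      finally show ?case .
    qed
  qed
  also have "\<dots> = V" using Lt2_mu by (simp add: V_def)
  finally show ?thesis .
qed

lemma centered_second_moment:
  assumes x: "x \<in> X"
  shows "integrable nu (\<lambda>w. zo_grad ft eta x (snd w) (fst w) - g x)"
    and "integrable nu (\<lambda>w. (norm (zo_grad ft eta x (snd w) (fst w) - g x))\<^sup>2)"
    and "(\<integral>w. zo_grad ft eta x (snd w) (fst w) - g x \<partial>nu) = 0"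
    and "(\<integral>w. (norm (zo_grad ft eta x (snd w) (fst w) - g x))\<^sup>2 \<partial>nu) \<le> V"
proof -
  interpret prob_space nu by (rule prob_nu)
  note i = integrable_zo_grad[OF x]
  note u = zo_grad_unbiased[OF x]
  let ?z = "\<lambda>w. zo_grad ft eta x (snd w) (fst w)"
  have ii: "integrable nu (\<lambda>w. ?z w \<bullet> g x)" "(\<integral>w. ?z w \<bullet> g x \<partial>nu) = g x \<bullet> g x"
    using i(1) u by (simp_all add: integrable_inner_left integral_inner_left)
  show "integrable nu (\<lambda>w. ?z w - g x)" using i by simp
  show "(\<integral>w. ?z w - g x \<partial>nu) = 0" using i u prob_space by simp
  show "integrable nu (\<lambda>w. (norm (?z w - g x))\<^sup>2)"
    unfolding power2_norm_diff using i ii by simp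
  have "(\<integral>w. (norm (?z w - g x))\<^sup>2 \<partial>nu) = (\<integral>w. (norm (?z w))\<^sup>2 \<partial>nu) - 2 * (g x \<bullet> g x) + (norm (g x))\<^sup>2"
    unfolding power2_norm_diff using i ii prob_space by simp
  also have "\<dots> \<le> V" using zo_grad_second_moment[OF x] zero_le_power2[of "norm (g x)"]
    unfolding dot_square_norm by linarith
  finally show "(\<integral>w. (norm (?z w - g x))\<^sup>2 \<partial>nu) \<le> V" .
qed

end

subsection \<open>The random iterates\<close>

text \<open>Every use of independence passes through this form. Generators stable under intersection
  may be collected into disjoint groups, and functions of different groups then have a product as
  joint law.\<close>

lemma indep_joint_distr:
  assumes M: "prob_space M" and ind: "prob_space.indep_sets M E I"
    and I: "I1 \<subseteq> I" "I2 \<subseteq> I" "I1 \<inter> I2 = {}" and st: "\<And>i. i \<in> I \<Longrightarrow> Int_stable (E i)"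
    and U: "U \<in> measurable (sigma (space M) (\<Union>i\<in>I1. E i)) N1"
    and W: "W \<in> measurable (sigma (space M) (\<Union>i\<in>I2. E i)) N2"
  shows "U \<in> measurable M N1" "W \<in> measurable M N2"
    "distr M (N1 \<Otimes>\<^sub>M N2) (\<lambda>w. (U w, W w)) = distr M N1 U \<Otimes>\<^sub>M distr M N2 W"
proof -
  interpret prob_space M by (rule M)
  have Ev: "E i \<subseteq> events" if "i \<in> I" for i using ind that by (auto simp: indep_sets_def)
  have sub: "(\<Union>i\<in>J. E i) \<subseteq> Pow (space M)" if "J \<subseteq> I" for J
    using Ev that sets.space_closed by blast
  have ss: "sets (sigma (space M) (\<Union>i\<in>J. E i)) \<subseteq> events" if "J \<subseteq> I" for J
    unfolding sets_measure_of[OF sub[OF that]]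
    by (rule sets.sigma_sets_subset) (use Ev that in blast)
  have mono: "Z \<in> measurable M N" if "J \<subseteq> I" "Z \<in> measurable (sigma (space M) (\<Union>i\<in>J. E i)) N" for J Z and N :: "'x measure"
    using that(2) ss[OF that(1)] by (auto simp: measurable_def space_measure_of_conv)
  show Um[measurable]: "U \<in> measurable M N1" by (rule mono[OF I(1) U])
  show Wm[measurable]: "W \<in> measurable M N2"
    using W ss[OF I(2)] by (auto simp: measurable_def space_measure_of_conv)
  have UN: "(\<Union>j\<in>UNIV. case_bool I1 I2 j) \<subseteq> I" using I by (auto split: bool.splits)
  have "indep_sets (\<lambda>j. sigma_sets (space M) (\<Union>i\<in>case_bool I1 I2 j. E i)) UNIV"
  proof (rule indep_sets_collect_sigma)
    show "indep_sets E (\<Union>j\<in>UNIV. case_bool I1 I2 j)" by (rule indep_sets_mono_index[OF UN ind])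
    show "disjoint_family_on (case_bool I1 I2) UNIV"
      using I by (auto simp: disjoint_family_on_def split: bool.splits)
    fix i j assume "i \<in> case_bool I1 I2 j"
    then show "Int_stable (E i)" using I by (intro st) (auto split: bool.splits)
  qed
  then have "indep_sets (case_bool (sigma_sets (space M) (\<Union>i\<in>I1. E i)) (sigma_sets (space M) (\<Union>i\<in>I2. E i))) UNIV"
    by (rule indep_sets_mono_sets) (auto split: bool.splits)
  then have "indep_set (sigma_sets (space M) (\<Union>i\<in>I1. E i)) (sigma_sets (space M) (\<Union>i\<in>I2. E i))"
    by (simp add: indep_set_def)
  then have pr: "prob (a \<inter> b) = prob a * prob b"
    if "a \<in> sigma_sets (space M) (\<Union>i\<in>I1. E i)" "b \<in> sigma_sets (space M) (\<Union>i\<in>I2. E i)" for a b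
    using that by (auto simp: indep_sets2_eq)
  have "distr M N1 U \<Otimes>\<^sub>M distr M N2 W = distr M (N1 \<Otimes>\<^sub>M N2) (\<lambda>w. (U w, W w))"
  proof (rule pair_measure_eqI)
    show "sigma_finite_measure (distr M N1 U)" "sigma_finite_measure (distr M N2 W)"
      by (auto intro!: prob_space_imp_sigma_finite prob_space_distr)
    show "sets (distr M N1 U \<Otimes>\<^sub>M distr M N2 W) = sets (distr M (N1 \<Otimes>\<^sub>M N2) (\<lambda>w. (U w, W w)))"
      by (simp cong: sets_pair_measure_cong)
    fix A B assume "A \<in> sets (distr M N1 U)" "B \<in> sets (distr M N2 W)"
    then have [measurable]: "A \<in> sets N1" "B \<in> sets N2" by auto
    let ?a = "U -` A \<inter> space M" and ?b = "W -` B \<inter> space M"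
    have "?a \<in> sigma_sets (space M) (\<Union>i\<in>I1. E i)" "?b \<in> sigma_sets (space M) (\<Union>i\<in>I2. E i)"
      using measurable_sets[OF U, of A] measurable_sets[OF W, of B]
      by (simp_all add: sets_measure_of sub I space_measure_of_conv)
    note p = pr[OF this]
    have "emeasure (distr M (N1 \<Otimes>\<^sub>M N2) (\<lambda>w. (U w, W w))) (A \<times> B) = emeasure M (?a \<inter> ?b)"
      by (subst emeasure_distr) (auto intro!: arg_cong[where f="emeasure M"])
    also have "\<dots> = ennreal (prob ?a * prob ?b)" by (simp only: emeasure_eq_measure p)
    also have "\<dots> = emeasure M ?a * emeasure M ?b" by (simp add: emeasure_eq_measure ennreal_mult)
    also have "\<dots> = emeasure (distr M N1 U) A * emeasure (distr M N2 W) B"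
      by (simp add: emeasure_distr)
    finally show "emeasure (distr M N1 U) A * emeasure (distr M N2 W) B
      = emeasure (distr M (N1 \<Otimes>\<^sub>M N2) (\<lambda>w. (U w, W w))) (A \<times> B)" by simp
  qed
  then show "distr M (N1 \<Otimes>\<^sub>M N2) (\<lambda>w. (U w, W w)) = distr M N1 U \<Otimes>\<^sub>M distr M N2 W" by simp
qed

text \<open>The hypothesis reads \<open>(1 - lam) * K > 2\<close>. That the first index is positive
  is what bounds the first term of the harmonic sum by \<open>1/2\<close>.\<close>

lemma first_index_less:
  assumes lam: "0 < lam" "lam < 1" and K: "real K > 2 / (1 - lam)"
  shows "first_index lam K + 2 \<le> K" "1 \<le> first_index lam K"
proof -
  have "2 < (1 - lam) * real K" using K lam by (simp add: field_simps)
  then have 1: "lam * real K < real K - 2" by (simp add: algebra_simps)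
  then have c: "\<lceil>lam * real K\<rceil> \<le> int K - 2" by (simp add: ceiling_le_iff)
  have K0: "0 < real K" using K lam by (smt (verit) divide_pos_pos)
  have K2: "2 \<le> K"
  proof -
    have "0 < lam * real K" using lam K0 by simp
    then have "2 < real K" using 1 by linarith
    then show ?thesis by simp
  qed
  have "nat \<lceil>lam * real K\<rceil> \<le> nat (int K - 2)" using c by (rule nat_mono)
  moreover have "nat (int K - 2) = K - 2" by arith
  ultimately show "first_index lam K + 2 \<le> K" unfolding first_index_def using K2 by linarith
  have "0 < lam * real K" using lam K0 by simp
  then have "1 \<le> \<lceil>lam * real K\<rceil>" by (simp add: le_ceiling_iff)
  then show "1 \<le> first_index lam K" unfolding first_index_def by linarith
qed

lemma closest_point_measurable[measurable]:
  fixes X :: "'a::euclidean_space set"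
  assumes "convex X" "closed X" "X \<noteq> {}"
  shows "closest_point X \<in> borel_measurable borel"
  by (rule borel_measurable_continuous_onI[OF continuous_on_closest_point[OF assms]])

text \<open>Covers both step-size rules: \<open>gam0\<close> is the constant step or the initial
  one, and the residual is taken with parameter \<open>1 / gam0\<close>.\<close>

locale zo_run = zo_data P xi X ft Lt eta0 eta
  for P :: "'w measure" and xi :: "'w \<Rightarrow> real^'d"
    and X :: "(real^'n) set" and ft :: "real^'n \<Rightarrow> real^'d \<Rightarrow> real" and Lt :: "real^'d \<Rightarrow> real"
    and eta0 eta :: real +
  fixes M :: "'s measure" and gam :: "nat \<Rightarrow> real" and N :: "nat \<Rightarrow> nat" and lam :: real and x0 :: "real^'n"
    and xis :: "nat \<Rightarrow> nat \<Rightarrow> 's \<Rightarrow> real^'d" and vs :: "nat \<Rightarrow> nat \<Rightarrow> 's \<Rightarrow> real^'n"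
    and R :: "nat \<Rightarrow> 's \<Rightarrow> nat" and gam0 :: real
  assumes run: "vrg_zo_run P xi eta M gam N lam xis vs R" and x0: "x0 \<in> X"
    and lam: "0 < lam" "lam < 1"
    and gam_le: "\<And>k. gam k \<le> gam0" and small: "sqrt CARD('n) * L0 * gam0 \<le> eta"
begin

lemma prob_M: "prob_space M" using run by (simp add: vrg_zo_run_def)
lemma gam_pos: "0 < gam k" using run by (simp add: vrg_zo_run_def)
lemma N_pos: "1 \<le> N k" using run by (simp add: vrg_zo_run_def)
lemma gam0_pos: "0 < gam0" using gam_pos gam_le order_less_le_trans by blast

sublocale M: prob_space M by (rule prob_M)

section \<open>Laws of the draws and the sigma-algebras of the past\<close>

lemma samples:
  assumes "1 \<le> j" "j \<le> N k"
  shows "xis k j \<in> borel_measurable M" "distr M borel (xis k j) = mu"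
    "vs k j \<in> borel_measurable M" "distr M borel (vs k j) = sigma_v"
  using run assms by (auto simp: vrg_zo_run_def)

text \<open>All that is drawn before the \<open>m\<close>-th sample of iteration \<open>k\<close>:
  \<open>past k 1\<close> determines the iterate \<open>x k\<close>, and
  \<open>past k (Suc m)\<close> the partial sum \<open>S k m\<close>.\<close>

definition "past k m = {Xi_draw k' j | k' j. 1 \<le> j \<and> j \<le> N k' \<and> (k' < k \<or> k' = k \<and> j < m)}
   \<union> {V_draw k' j | k' j. 1 \<le> j \<and> j \<le> N k' \<and> (k' < k \<or> k' = k \<and> j < m)}"

text \<open>The argument \<open>r\<close> enters only through \<open>Out_draw\<close>; with it the
  same lemmas serve histories with and without an output index.\<close>

definition "hist r A = sigma (space M) (\<Union>i\<in>A. draw_events M xis vs r i)"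

lemma draw_events_Pow: "draw_events M xis vs r i \<subseteq> Pow (space M)"
  by (cases i) (auto dest!: sets.sets_into_space)

lemma Int_stable_draw: "Int_stable (draw_events M xis vs r i)"
  by (cases i) (auto simp: Int_stable_def)

lemma sets_hist: "sets (hist r A) = sigma_sets (space M) (\<Union>i\<in>A. draw_events M xis vs r i)"
  unfolding hist_def by (rule sets_measure_of) (use draw_events_Pow in blast)

lemma space_hist: "space (hist r A) = space M"
  unfolding hist_def by (rule space_measure_of) (use draw_events_Pow in blast)

lemma hist_mono:
  assumes "A \<subseteq> B" "Z \<in> measurable (hist r A) K"
  shows "Z \<in> measurable (hist r B) K"
proof -
  have "sets (hist r A) \<subseteq> sets (hist r B)"
    unfolding sets_hist by (rule sigma_sets_mono') (use assms(1) in blast)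
  then show ?thesis using assms(2) by (auto simp: measurable_def space_hist)
qed

lemma draw_hist: "draw_events M xis vs r i \<subseteq> sets (hist r A)" if "i \<in> A"
  unfolding sets_hist using that by auto

lemma xis_hist: "xis k j \<in> borel_measurable (hist r A)" if "Xi_draw k j \<in> A"
proof (rule measurableI)
  fix B :: "(real^'d) set" assume "B \<in> sets borel"
  then have "xis k j -` B \<inter> space M \<in> draw_events M xis vs r (Xi_draw k j)"
    by (simp add: in_vimage_algebra)
  then show "xis k j -` B \<inter> space (hist r A) \<in> sets (hist r A)"
    using draw_hist[OF that, of r] by (auto simp: space_hist)
qed simp

lemma vs_hist: "vs k j \<in> borel_measurable (hist r A)" if "V_draw k j \<in> A"
proof (rule measurableI)
  fix B :: "(real^'n) set" assume "B \<in> sets borel"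
  then have "vs k j -` B \<inter> space M \<in> draw_events M xis vs r (V_draw k j)"
    by (simp add: in_vimage_algebra)
  then show "vs k j -` B \<inter> space (hist r A) \<in> sets (hist r A)"
    using draw_hist[OF that, of r] by (auto simp: space_hist)
qed simp

lemma R_hist: "r \<in> measurable (hist r A) (count_space UNIV)" if "Out_draw \<in> A"
proof (rule measurableI)
  fix B :: "nat set"
  have "r -` B \<inter> space M \<in> draw_events M xis vs r Out_draw"
    by (simp add: in_vimage_algebra)
  then show "r -` B \<inter> space (hist r A) \<in> sets (hist r A)"
    using draw_hist[OF that, of r] by (auto simp: space_hist)
qed simp

abbreviation "x \<equiv> iterate X ft eta gam N x0 xis vs"
definition "gN k w = (1 / real (N k)) *\<^sub>R (\<Sum>j = 1..N k. zo_grad ft eta (x k w) (vs k j w) (xis k j w))"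
text \<open>At \<open>m = N k\<close> this is \<open>N k\<close> times the error of the batch mean;
  all \<open>m\<close> are needed because the variance is accumulated sample by sample.\<close>

definition "S k m w = (\<Sum>j = 1..m. zo_grad ft eta (x k w) (vs k j w) (xis k j w) - g (x k w))"

lemma x_Suc: "x (Suc k) w = closest_point X (x k w - gam k *\<^sub>R gN k w)"
  by (simp add: Let_def gN_def)

lemma x_in: "x k w \<in> X"
proof (cases k)
  case (Suc j)
  show ?thesis unfolding Suc x_Suc by (rule closest_point_in_set[OF X(2) Xne])
qed (simp add: x0)

lemma x_hist: "x k \<in> borel_measurable (hist r (past k 1))"
proof (induction k)
  case (Suc k)
  have [measurable]: "x k \<in> borel_measurable (hist r (past (Suc k) 1))"
    by (rule hist_mono[OF _ Suc.IH]) (auto simp: past_def)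
  have [measurable]: "vs k j \<in> borel_measurable (hist r (past (Suc k) 1))"
    "xis k j \<in> borel_measurable (hist r (past (Suc k) 1))" if "j \<in> {1..N k}" for j
    using that by (auto intro!: xis_hist vs_hist simp: past_def)
  have [measurable]: "gN k \<in> borel_measurable (hist r (past (Suc k) 1))"
    unfolding gN_def[abs_def] by measurable
  have "(\<lambda>w. x k w - gam k *\<^sub>R gN k w) \<in> borel_measurable (hist r (past (Suc k) 1))" by measurable
  from measurable_compose[OF this closest_point_measurable[OF X Xne]]
  show ?case unfolding x_Suc[abs_def] .
qed simp

lemma S_hist: "m \<le> N k \<Longrightarrow> S k m \<in> borel_measurable (hist r (past k (Suc m)))"
proof -
  assume m: "m \<le> N k"
  have [measurable]: "x k \<in> borel_measurable (hist r (past k (Suc m)))"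
    by (rule hist_mono[OF _ x_hist]) (auto simp: past_def)
  have [measurable]: "vs k j \<in> borel_measurable (hist r (past k (Suc m)))"
    "xis k j \<in> borel_measurable (hist r (past k (Suc m)))" if "j \<in> {1..m}" for j
    using that m by (auto intro!: xis_hist vs_hist simp: past_def)
  show ?thesis unfolding S_def[abs_def] by measurable
qed

lemma exists_output: "\<exists>K. output_index M gam N lam xis vs K (R K)"
proof -
  obtain K :: nat where "real K > 2 / (1 - lam)" using reals_Archimedean2 by blast
  then have "first_index lam K < K" using first_index_less[OF lam, of K] by simp
  then show ?thesis using run by (auto simp: vrg_zo_run_def)
qed

text \<open>Independence of the samples is part of \<open>output_index\<close>, hence is available only through some
  output index; which one is irrelevant for the sample draws.\<close>

definition "r0 = R (SOME K. output_index M gam N lam xis vs K (R K))"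

lemma indep_samples: "M.indep_sets (draw_events M xis vs r0) (sample_draws N)"
proof -
  have "\<exists>K. output_index M gam N lam xis vs K r0"
    unfolding r0_def by (rule exI, rule someI_ex[OF exists_output])
  then have "M.indep_sets (draw_events M xis vs r0) (insert Out_draw (sample_draws N))"
    by (auto simp: output_index_def)
  then show ?thesis by (rule M.indep_sets_mono_index[rotated]) auto
qed

text \<open>Independence is used twice: between the two components of the fresh sample, which gives
  its law \<open>nu\<close>, and between this sample and everything before it.\<close>

lemma joint_past_present:
  assumes m: "1 \<le> m" "m \<le> N k" and U: "U \<in> measurable (hist r0 (past k m)) N1"
  shows "U \<in> measurable M N1"
    "distr M (N1 \<Otimes>\<^sub>M (borel \<Otimes>\<^sub>M borel)) (\<lambda>w. (U w, (xis k m w, vs k m w))) = distr M N1 U \<Otimes>\<^sub>M nu"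
proof -
  let ?W = "\<lambda>w. (xis k m w, vs k m w)"
  have "distr M (borel \<Otimes>\<^sub>M borel) ?W = distr M borel (xis k m) \<Otimes>\<^sub>M distr M borel (vs k m)"
    by (rule indep_joint_distr(3)[OF prob_M indep_samples, of "{Xi_draw k m}" "{V_draw k m}", folded hist_def])
       (use m in \<open>auto simp: sample_draws_def Int_stable_draw intro!: xis_hist vs_hist\<close>)
  then have W: "distr M (borel \<Otimes>\<^sub>M borel) ?W = nu"
    using samples(2,4)[OF m] by simp
  have Wm: "?W \<in> measurable (hist r0 {Xi_draw k m, V_draw k m}) (borel \<Otimes>\<^sub>M borel)"
    by (intro measurable_Pair xis_hist vs_hist) auto
  note j = indep_joint_distr[OF prob_M indep_samples, of "past k m" "{Xi_draw k m, V_draw k m}" U N1 ?W "borel \<Otimes>\<^sub>M borel",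
      folded hist_def, OF _ _ _ Int_stable_draw U Wm]
  show "U \<in> measurable M N1"
    by (rule j(1)) (use m in \<open>auto simp: past_def sample_draws_def\<close>)
  have "distr M (N1 \<Otimes>\<^sub>M (borel \<Otimes>\<^sub>M borel)) (\<lambda>w. (U w, ?W w)) = distr M N1 U \<Otimes>\<^sub>M distr M (borel \<Otimes>\<^sub>M borel) ?W"
    by (rule j(3)) (use m in \<open>auto simp: past_def sample_draws_def\<close>)
  then show "distr M (N1 \<Otimes>\<^sub>M (borel \<Otimes>\<^sub>M borel)) (\<lambda>w. (U w, (xis k m w, vs k m w))) = distr M N1 U \<Otimes>\<^sub>M nu"
    unfolding W .
qed

lemma x_m[measurable]: "x k \<in> borel_measurable M"
  by (rule joint_past_present(1)[OF order_refl N_pos x_hist])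

lemma V_nonneg: "0 \<le> V" by (simp add: V_def)

text \<open>The summands are orthogonal: with the iterate and the partial sum frozen, a fresh
  centred sample has mean zero, so the cross term vanishes and each sample adds at most
  \<open>V\<close>.\<close>

lemma S_second_moment:
  "m \<le> N k \<Longrightarrow> S k m \<in> borel_measurable M \<and> integrable M (\<lambda>w. (norm (S k m w))\<^sup>2) \<and> (\<integral>w. (norm (S k m w))\<^sup>2 \<partial>M) \<le> m * V"
proof (induction m)
  case 0
  show ?case by (simp add: S_def)
next
  case (Suc m)
  let ?N1 = "borel \<Otimes>\<^sub>M borel :: ((real^'n) \<times> (real^'n)) measure"
  let ?U = "\<lambda>w. (x k w, S k m w)"
  let ?W = "\<lambda>w. (xis k (Suc m) w, vs k (Suc m) w)"
  let ?Q = "distr M ?N1 ?U"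
  \<comment> \<open>The centred sample with point and draw as separate arguments, so that the point
    can be frozen under Fubini.\<close>
  define phi where "phi y p = zo_grad ft eta y (snd p) (fst p) - g y" for y and p :: "(real^'d) \<times> (real^'n)"
  define Y where "Y w = phi (x k w) (?W w)" for w
  have m: "1 \<le> Suc m" "Suc m \<le> N k" using Suc.prems by auto
  note IH = Suc.IH[OF Suc_leD[OF Suc.prems]]
  have Sm[measurable]: "S k m \<in> borel_measurable M" using IH by simp
  have [measurable]: "xis k (Suc m) \<in> borel_measurable M" "vs k (Suc m) \<in> borel_measurable M"
    using samples[OF m] by auto
  have U: "?U \<in> measurable (hist r0 (past k (Suc m))) ?N1"
    using Suc.prems by (intro measurable_Pair S_hist hist_mono[OF _ x_hist]) (auto simp: past_def)
  have Um[measurable]: "?U \<in> measurable M ?N1" by (rule joint_past_present(1)[OF m U])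
  have J: "distr M (?N1 \<Otimes>\<^sub>M (borel \<Otimes>\<^sub>M borel)) (\<lambda>w. (?U w, ?W w)) = ?Q \<Otimes>\<^sub>M nu"
    by (rule joint_past_present(2)[OF m U])
  interpret Q: prob_space ?Q by (rule M.prob_space_distr[OF Um])
  interpret nu: prob_space nu by (rule prob_nu)
  interpret Qn: pair_sigma_finite ?Q nu
    by (intro pair_sigma_finite.intro prob_space_imp_sigma_finite Q.prob_space_axioms nu.prob_space_axioms)
  have phim[measurable]: "(\<lambda>z. phi (a z) (b z)) \<in> borel_measurable A"
    if [measurable]: "a \<in> borel_measurable A" "b \<in> measurable A (borel \<Otimes>\<^sub>M borel)" for a b and A :: "'z measure"
    unfolding phi_def by measurable
  have Ym[measurable]: "Y \<in> borel_measurable M"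
    unfolding Y_def[abs_def] phi_def by measurable
  have [measurable]: "X \<in> sets borel" using X by simp
  have AEX: "AE u in ?Q. fst u \<in> X"
    by (subst AE_distr_iff) (use x_in in auto)
  have hm: "(\<lambda>z. phi (fst (fst z)) (snd z)) \<in> borel_measurable (?N1 \<Otimes>\<^sub>M (borel \<Otimes>\<^sub>M borel))"
    unfolding phi_def by measurable
  have hm': "(\<lambda>z. phi (fst (fst z)) (snd z)) \<in> borel_measurable (?Q \<Otimes>\<^sub>M nu)"
    unfolding phi_def by measurable
  \<comment> \<open>Fubini for nonnegative integrals presupposes no integrability; it thus comes
    first and yields the integrability used for the cross term.\<close>
  have nnY: "(\<integral>\<^sup>+w. ennreal ((norm (Y w))\<^sup>2) \<partial>M) \<le> ennreal V"
  proof -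
    have "(\<integral>\<^sup>+w. ennreal ((norm (Y w))\<^sup>2) \<partial>M)
        = (\<integral>\<^sup>+z. ennreal ((norm (phi (fst (fst z)) (snd z)))\<^sup>2) \<partial>distr M (?N1 \<Otimes>\<^sub>M (borel \<Otimes>\<^sub>M borel)) (\<lambda>w. (?U w, ?W w)))"
      using hm by (subst nn_integral_distr) (auto simp: Y_def)
    also have "\<dots> = (\<integral>\<^sup>+u. (\<integral>\<^sup>+p. ennreal ((norm (phi (fst u) p))\<^sup>2) \<partial>nu) \<partial>?Q)"
      unfolding J using hm' by (subst sigma_finite_measure.nn_integral_fst[OF prob_space_imp_sigma_finite[OF prob_nu], symmetric]) auto
    also have "\<dots> \<le> (\<integral>\<^sup>+u. ennreal V \<partial>?Q)"
    proof (rule nn_integral_mono_AE)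
      show "AE u in ?Q. (\<integral>\<^sup>+p. ennreal ((norm (phi (fst u) p))\<^sup>2) \<partial>nu) \<le> ennreal V"
        using AEX
      proof eventually_elim
        case (elim u)
        show ?case
          unfolding phi_def
          by (subst nn_integral_eq_integral) (use centered_second_moment[OF elim] in \<open>auto intro!: ennreal_leI\<close>)
      qed
    qed
    also have "\<dots> = ennreal V" using Q.emeasure_space_1 by simp
    finally show ?thesis .
  qed
  have Yi: "integrable M (\<lambda>w. (norm (Y w))\<^sup>2)"
    by (rule integrableI_bounded) (use nnY in \<open>auto simp: top_unique intro: le_less_trans\<close>)
  have "ennreal (\<integral>w. (norm (Y w))\<^sup>2 \<partial>M) \<le> ennreal V"
    using nnY nn_integral_eq_integral[OF Yi] by simp
  then have YV: "(\<integral>w. (norm (Y w))\<^sup>2 \<partial>M) \<le> V" using V_nonneg by simp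
  have SYi: "integrable M (\<lambda>w. S k m w \<bullet> Y w)"
  proof (rule Bochner_Integration.integrable_bound)
    show "integrable M (\<lambda>w. (norm (S k m w))\<^sup>2 + (norm (Y w))\<^sup>2)" using IH Yi by simp
    show "AE w in M. norm (S k m w \<bullet> Y w) \<le> norm ((norm (S k m w))\<^sup>2 + (norm (Y w))\<^sup>2)"
    proof (rule AE_I2)
      fix w
      have "\<bar>S k m w \<bullet> Y w\<bar> \<le> norm (S k m w) * norm (Y w)" by (rule Cauchy_Schwarz_ineq2)
      also have "\<dots> \<le> (norm (S k m w))\<^sup>2 + (norm (Y w))\<^sup>2"
        using sum_squares_bound[of "norm (S k m w)" "norm (Y w)"]
          mult_nonneg_nonneg[OF norm_ge_zero norm_ge_zero, of "S k m w" "Y w"] by linarith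
      finally show "norm (S k m w \<bullet> Y w) \<le> norm ((norm (S k m w))\<^sup>2 + (norm (Y w))\<^sup>2)" by simp
    qed
  qed measurable
  have SY0: "(\<integral>w. S k m w \<bullet> Y w \<partial>M) = 0"
  proof -
    have sm: "(\<lambda>z. snd (fst z) \<bullet> phi (fst (fst z)) (snd z)) \<in> borel_measurable (?N1 \<Otimes>\<^sub>M (borel \<Otimes>\<^sub>M borel))"
      using hm by measurable
    have "integrable (distr M (?N1 \<Otimes>\<^sub>M (borel \<Otimes>\<^sub>M borel)) (\<lambda>w. (?U w, ?W w))) (\<lambda>z. snd (fst z) \<bullet> phi (fst (fst z)) (snd z))"
      using sm SYi by (subst integrable_distr_eq) (auto simp: Y_def)
    then have i: "integrable (?Q \<Otimes>\<^sub>M nu) (\<lambda>z. snd (fst z) \<bullet> phi (fst (fst z)) (snd z))"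
      unfolding J .
    have "(\<integral>w. S k m w \<bullet> Y w \<partial>M)
        = (\<integral>z. snd (fst z) \<bullet> phi (fst (fst z)) (snd z) \<partial>distr M (?N1 \<Otimes>\<^sub>M (borel \<Otimes>\<^sub>M borel)) (\<lambda>w. (?U w, ?W w)))"
      using sm by (subst integral_distr) (auto simp: Y_def)
    also have "\<dots> = (\<integral>u. (\<integral>p. snd u \<bullet> phi (fst u) p \<partial>nu) \<partial>?Q)"
      unfolding J using Qn.integral_fst'[OF i] by simp
    also have "\<dots> = (\<integral>u. 0 \<partial>?Q)"
    proof (rule integral_cong_AE)
      show "AE u in ?Q. (\<integral>p. snd u \<bullet> phi (fst u) p \<partial>nu) = 0"
        using AEX
      proof eventually_elim
        case (elim u)
        show ?case unfolding phi_def
          using centered_second_moment(1,3)[OF elim] by (simp add: integral_inner_right)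
      qed
      show "(\<lambda>u. \<integral>p. snd u \<bullet> phi (fst u) p \<partial>nu) \<in> borel_measurable ?Q"
        using Qn.integrable_fst'[OF i] by simp
    qed simp
    finally show ?thesis by simp
  qed
  have eq: "S k (Suc m) w = S k m w + Y w" for w
    by (simp add: S_def Y_def phi_def)
  have sm: "S k (Suc m) \<in> borel_measurable M" unfolding eq[abs_def] by measurable
  have "integrable M (\<lambda>w. (norm (S k (Suc m) w))\<^sup>2)"
    unfolding eq power2_norm_add using IH Yi SYi by simp
  moreover have "(\<integral>w. (norm (S k (Suc m) w))\<^sup>2 \<partial>M) = (\<integral>w. (norm (S k m w))\<^sup>2 \<partial>M) + (\<integral>w. (norm (Y w))\<^sup>2 \<partial>M)"
    unfolding eq power2_norm_add using IH Yi SYi SY0 by simp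
  ultimately show ?case using IH YV sm by (simp add: algebra_simps)
qed

end

context zo_run
begin

section \<open>Batch errors, integrability along the iterates and descent in expectation\<close>

definition "err k w = gN k w - g (x k w)"

lemma err_eq: "err k w = (1 / real (N k)) *\<^sub>R S k (N k) w"
  using N_pos[of k] by (simp add: err_def gN_def S_def sum_subtractf scaleR_diff_right sum_constant_scaleR del: sum_constant)

lemma err_moment:
  "err k \<in> borel_measurable M" "integrable M (\<lambda>w. (norm (err k w))\<^sup>2)"
  "(\<integral>w. (norm (err k w))\<^sup>2 \<partial>M) \<le> V / N k"
proof -
  have N: "0 < real (N k)" using N_pos[of k] by simp
  note S = S_second_moment[OF order_refl, of k]
  have [measurable]: "S k (N k) \<in> borel_measurable M" using S by simp
  have eq: "(norm (err k w))\<^sup>2 = (norm (S k (N k) w))\<^sup>2 / (real (N k))\<^sup>2" for w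
    by (simp add: err_eq power_divide)
  show "err k \<in> borel_measurable M" unfolding err_eq[abs_def] by measurable
  show "integrable M (\<lambda>w. (norm (err k w))\<^sup>2)" unfolding eq using S by simp
  have "(\<integral>w. (norm (err k w))\<^sup>2 \<partial>M) = (\<integral>w. (norm (S k (N k) w))\<^sup>2 \<partial>M) / (real (N k))\<^sup>2"
    unfolding eq by simp
  also have "\<dots> \<le> (N k * V) / (real (N k))\<^sup>2" using S by (intro divide_right_mono) auto
  also have "\<dots> = V / N k" using N by (simp add: power2_eq_square)
  finally show "(\<integral>w. (norm (err k w))\<^sup>2 \<partial>M) \<le> V / N k" .
qed

text \<open>\<open>X\<close> may be unbounded, so expectations of Lipschitz functions of the
  iterates need a first moment. One step moves by at most
  \<open>gam k * (norm (err k w) + L0)\<close>.\<close>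

lemma x_dist_integrable: "integrable M (\<lambda>w. norm (x k w - x0))"
proof (induction k)
  case (Suc k)
  have [measurable]: "err k \<in> borel_measurable M" by (rule err_moment)
  have ei: "integrable M (\<lambda>w. norm (err k w))"
  proof (rule Bochner_Integration.integrable_bound)
    show "integrable M (\<lambda>w. 1 + (norm (err k w))\<^sup>2)" using err_moment by simp
    show "AE w in M. norm (norm (err k w)) \<le> norm (1 + (norm (err k w))\<^sup>2)"
    proof (rule AE_I2)
      fix w
      have "0 \<le> (norm (err k w) - 1/2)\<^sup>2" by simp
      then show "norm (norm (err k w)) \<le> norm (1 + (norm (err k w))\<^sup>2)" by (simp add: power2_diff power_divide)
    qed
  qed measurable
  show ?case
  proof (rule Bochner_Integration.integrable_bound)
    show "integrable M (\<lambda>w. norm (x k w - x0) + gam k * (norm (err k w) + L0))"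
      using Suc ei by simp
    show "AE w in M. norm (norm (x (Suc k) w - x0)) \<le> norm (norm (x k w - x0) + gam k * (norm (err k w) + L0))"
    proof (rule AE_I2)
      fix w
      have "norm (x k w - x (Suc k) w) \<le> norm (gam k *\<^sub>R gN k w)"
        unfolding x_Suc by (rule norm_projection_residual_le[OF X x_in])
      also have "\<dots> = gam k * norm (err k w + g (x k w))"
        using gam_pos[of k] by (simp add: err_def)
      also have "\<dots> \<le> gam k * (norm (err k w) + L0)"
        using gam_pos[of k] norm_g[of "x k w"] norm_triangle_ineq[of "err k w" "g (x k w)"]
        by (intro mult_left_mono) auto
      finally have 1: "norm (x k w - x (Suc k) w) \<le> gam k * (norm (err k w) + L0)" .
      have "norm (x (Suc k) w - x0) \<le> norm (x k w - x0) + norm (x k w - x (Suc k) w)"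
        using norm_triangle_ineq4[of "x k w - x0" "x k w - x (Suc k) w"] by simp
      also have "\<dots> \<le> \<bar>norm (x k w - x0) + gam k * (norm (err k w) + L0)\<bar>"
        using 1 by linarith
      finally show "norm (norm (x (Suc k) w - x0)) \<le> norm (norm (x k w - x0) + gam k * (norm (err k w) + L0))"
        by simp
    qed
  qed (simp del: iterate.simps)
qed simp

lemma lipschitz_integrable:
  assumes H: "C-lipschitz_on UNIV H"
  shows "integrable M (\<lambda>w. H (x k w) :: real)"
proof (rule Bochner_Integration.integrable_bound)
  have [measurable]: "H \<in> borel_measurable borel"
    by (rule borel_measurable_continuous_onI[OF lipschitz_on_continuous_on[OF H]])
  show "(\<lambda>w. H (x k w)) \<in> borel_measurable M" by measurable
  show "integrable M (\<lambda>w. \<bar>H x0\<bar> + C * norm (x k w - x0))" using x_dist_integrable by simp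
  show "AE w in M. norm (H (x k w)) \<le> norm (\<bar>H x0\<bar> + C * norm (x k w - x0))"
  proof (rule AE_I2)
    fix w
    have "\<bar>H (x k w) - H x0\<bar> \<le> C * norm (x k w - x0)"
      using lipschitz_onD[OF H, of "x k w" x0] by (simp add: dist_norm)
    then show "norm (H (x k w)) \<le> norm (\<bar>H x0\<bar> + C * norm (x k w - x0))" by simp
  qed
qed

lemma f_x: "f (x k w) = F (x k w)"
  using F_eq_X[OF x_in] by simp

lemma f_integrable: "integrable M (\<lambda>w. f (x k w))"
  unfolding f_x by (rule lipschitz_integrable[OF F_lip])

abbreviation "s \<equiv> smoothed F eta"

lemma s_integrable: "integrable M (\<lambda>w. s (x k w))"
  by (rule lipschitz_integrable[OF smoothed_lipschitz[OF F_lip]])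

abbreviation "fstar \<equiv> INF y\<in>X. f y"

lemma fstar_le: "y \<in> X \<Longrightarrow> fstar \<le> f y"
  by (rule cINF_lower[OF f_bdd])

text \<open>Passing between objective and smoothing costs \<open>L0 * eta\<close> at each end of the
  window, whence \<open>2 * L0 * eta\<close> in the bounds.\<close>

lemma s_upper: "(\<integral>w. s (x k w) \<partial>M) \<le> (\<integral>w. f (x k w) \<partial>M) + L0 * eta"
proof -
  have "(\<integral>w. s (x k w) \<partial>M) \<le> (\<integral>w. f (x k w) + L0 * eta \<partial>M)"
  proof (rule integral_mono)
    fix w
    show "s (x k w) \<le> f (x k w) + L0 * eta"
      using smoothed_close[OF F_lip, of eta "x k w"] eta unfolding f_x by simp
  qed (use f_integrable s_integrable in auto)
  then show ?thesis using f_integrable by (simp add: M.prob_space)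
qed

lemma s_lower: "fstar - L0 * eta \<le> (\<integral>w. s (x k w) \<partial>M)"
proof -
  have "(\<integral>w. fstar - L0 * eta \<partial>M) \<le> (\<integral>w. s (x k w) \<partial>M)"
  proof (rule integral_mono)
    fix w
    show "fstar - L0 * eta \<le> s (x k w)"
      using smoothed_close[OF F_lip, of eta "x k w"] eta fstar_le[OF x_in, of k w] unfolding f_x by simp
  qed (use s_integrable in auto)
  then show ?thesis by (simp add: M.prob_space)
qed

lemma fstar_le_integral: "fstar \<le> (\<integral>w. f (x k w) \<partial>M)"
proof -
  have "(\<integral>w. fstar \<partial>M) \<le> (\<integral>w. f (x k w) \<partial>M)"
    by (rule integral_mono) (use f_integrable fstar_le[OF x_in] in auto)
  then show ?thesis by (simp add: M.prob_space)
qed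

definition "G = proj_residual X g (1 / gam0)"

lemma G_residual: "y \<in> X \<Longrightarrow> residual X f eta (1 / gam0) y = G y"
  unfolding G_def g_def by (rule residual_eq_proj_residual[OF X _ F_lip eta(1) smoothed_eq])

lemma G_m[measurable]: "G \<in> borel_measurable borel"
  unfolding G_def g_def by (rule borel_measurable_continuous_onI[OF continuous_proj_residual[OF X Xne F_lip eta(1)]])

lemma G_le: "y \<in> X \<Longrightarrow> norm (G y) \<le> L0"
  unfolding G_def g_def using gam0_pos by (intro norm_proj_residual_le[OF X _ F_lip eta(1)]) auto

lemma G2_le: "y \<in> X \<Longrightarrow> (norm (G y))\<^sup>2 \<le> L0\<^sup>2"
  by (rule power_mono[OF G_le]) auto

lemma G2_integrable: "integrable M (\<lambda>w. (norm (G (x k w)))\<^sup>2)"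
  by (rule M.integrable_const_bound[where B="L0\<^sup>2"]) (use G2_le[OF x_in] in auto)

lemma expected_descent:
  "gam k * (\<integral>w. (norm (G (x k w)))\<^sup>2 \<partial>M)
    \<le> 2 * ((\<integral>w. s (x k w) \<partial>M) - (\<integral>w. s (x (Suc k) w) \<partial>M)) + V * (gam k / N k)"
proof -
  have "(\<integral>w. s (x (Suc k) w) \<partial>M)
      \<le> (\<integral>w. s (x k w) - gam k / 2 * (norm (G (x k w)))\<^sup>2 + gam k / 2 * (norm (err k w))\<^sup>2 \<partial>M)"
  proof (rule integral_mono)
    show "integrable M (\<lambda>w. s (x (Suc k) w))" by (rule s_integrable)
    show "integrable M (\<lambda>w. s (x k w) - gam k / 2 * (norm (G (x k w)))\<^sup>2 + gam k / 2 * (norm (err k w))\<^sup>2)"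
      using s_integrable G2_integrable err_moment by simp
    fix w
    show "s (x (Suc k) w) \<le> s (x k w) - gam k / 2 * (norm (G (x k w)))\<^sup>2 + gam k / 2 * (norm (err k w))\<^sup>2"
      unfolding x_Suc G_def g_def err_def
      by (rule one_step_descent[OF X x_in F_lip eta(1) gam_pos gam_le small])
  qed
  also have "\<dots> = (\<integral>w. s (x k w) \<partial>M) - gam k / 2 * (\<integral>w. (norm (G (x k w)))\<^sup>2 \<partial>M)
      + gam k / 2 * (\<integral>w. (norm (err k w))\<^sup>2 \<partial>M)"
    using s_integrable G2_integrable err_moment by simp
  also have "gam k / 2 * (\<integral>w. (norm (err k w))\<^sup>2 \<partial>M) \<le> gam k / 2 * (V / N k)"
    using gam_pos[of k] err_moment by (intro mult_left_mono) auto
  finally show ?thesis by (simp add: mult.commute)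
qed

lemma sum_descent:
  assumes "l \<le> K"
  shows "(\<Sum>k=l..<K. gam k * (\<integral>w. (norm (G (x k w)))\<^sup>2 \<partial>M))
    \<le> 2 * ((\<integral>w. f (x l w) \<partial>M) - fstar + 2 * L0 * eta) + V * (\<Sum>k=l..<K. gam k / N k)"
proof -
  have "(\<Sum>k=l..<K. gam k * (\<integral>w. (norm (G (x k w)))\<^sup>2 \<partial>M))
      \<le> (\<Sum>k=l..<K. 2 * ((\<integral>w. s (x k w) \<partial>M) - (\<integral>w. s (x (Suc k) w) \<partial>M)) + V * (gam k / N k))"
    by (rule sum_mono) (rule expected_descent)
  also have "\<dots> = 2 * (\<Sum>k=l..<K. (\<integral>w. s (x k w) \<partial>M) - (\<integral>w. s (x (Suc k) w) \<partial>M)) + V * (\<Sum>k=l..<K. gam k / N k)"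
    by (simp add: sum.distrib sum_distrib_left del: iterate.simps)
  also have "(\<Sum>k=l..<K. (\<integral>w. s (x k w) \<partial>M) - (\<integral>w. s (x (Suc k) w) \<partial>M)) = (\<integral>w. s (x l w) \<partial>M) - (\<integral>w. s (x K w) \<partial>M)"
    using sum_Suc_diff'[OF assms, of "\<lambda>k. - (\<integral>w. s (x k w) \<partial>M)"] by (simp del: iterate.simps)
  also have "2 * ((\<integral>w. s (x l w) \<partial>M) - (\<integral>w. s (x K w) \<partial>M)) \<le> 2 * ((\<integral>w. f (x l w) \<partial>M) - fstar + 2 * L0 * eta)"
    using diff_mono[OF s_upper[of l] s_lower[of K]] by (simp add: algebra_simps del: iterate.simps)
  finally show ?thesis by simp
qed

text \<open>\<open>x j\<close> is a function of \<open>past j 1\<close>, which is independent of the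
  output index, so the expectation factorises on the event that the index is \<open>j\<close>. The
  identity is multiplied by the sum of the steps to match the weighted descent sum.\<close>

lemma output_expectation:
  fixes q :: "real^'n \<Rightarrow> real"
  assumes K: "first_index lam K < K" and q[measurable]: "q \<in> borel_measurable borel"
    and qb: "\<And>y. y \<in> X \<Longrightarrow> \<bar>q y\<bar> \<le> B"
  shows "integrable M (\<lambda>w. q (x (R K w) w))"
    and "(\<integral>w. q (x (R K w) w) \<partial>M) * (\<Sum>i=first_index lam K..<K. gam i)
      = (\<Sum>j=first_index lam K..<K. gam j * (\<integral>w. q (x j w) \<partial>M))"
proof -
  let ?I = "{first_index lam K..<K}"
  have out: "output_index M gam N lam xis vs K (R K)" using run K by (auto simp: vrg_zo_run_def)
  have Rm[measurable]: "R K \<in> measurable M (count_space UNIV)"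
    and RI: "\<And>w. w \<in> space M \<Longrightarrow> R K w \<in> ?I"
    and Rp: "\<And>j. j \<in> ?I \<Longrightarrow> M.prob {w \<in> space M. R K w = j} = gam j / (\<Sum>i\<in>?I. gam i)"
    and ind: "M.indep_sets (draw_events M xis vs (R K)) (insert Out_draw (sample_draws N))"
    using out by (auto simp: output_index_def)
  have qi: "integrable M (\<lambda>w. q (x j w))" for j
    by (rule M.integrable_const_bound[where B=B]) (use qb[OF x_in] in auto)
  have m: "(\<lambda>w. q (x (R K w) w)) \<in> borel_measurable M"
    by (rule measurable_compose_countable[where f="\<lambda>j w. q (x j w)" and g="R K"]) measurable
  show "integrable M (\<lambda>w. q (x (R K w) w))"
    by (rule M.integrable_const_bound[where B=B]) (use qb[OF x_in] m in auto)
  have each: "(\<integral>w. q (x j w) * indicator {j} (R K w) \<partial>M) = (\<integral>w. q (x j w) \<partial>M) * (gam j / (\<Sum>i\<in>?I. gam i))"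
    and eachi: "integrable M (\<lambda>w. q (x j w) * indicator {j} (R K w))" if j: "j \<in> ?I" for j
  proof -
    show i: "integrable M (\<lambda>w. q (x j w) * indicator {j} (R K w))"
      by (rule Bochner_Integration.integrable_bound[OF qi[of j]]) (auto simp: indicator_def)
    let ?Q = "distr M borel (x j)" and ?R = "distr M (count_space UNIV) (R K)"
    have J: "distr M (borel \<Otimes>\<^sub>M count_space UNIV) (\<lambda>w. (x j w, R K w)) = ?Q \<Otimes>\<^sub>M ?R"
    proof (rule indep_joint_distr(3)[OF prob_M ind, of "past j 1" "{Out_draw}", folded hist_def])
      show "x j \<in> borel_measurable (hist (R K) (past j 1))" by (rule x_hist)
      show "R K \<in> measurable (hist (R K) {Out_draw}) (count_space UNIV)" by (rule R_hist) simp
    qed (auto simp: past_def sample_draws_def Int_stable_draw)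
    interpret Q: prob_space ?Q by (rule M.prob_space_distr) simp
    interpret R: prob_space ?R by (rule M.prob_space_distr) simp
    interpret QR: pair_sigma_finite ?Q ?R
      by (intro pair_sigma_finite.intro prob_space_imp_sigma_finite Q.prob_space_axioms R.prob_space_axioms)
    have hm: "(\<lambda>z. q (fst z) * indicator {j} (snd z)) \<in> borel_measurable (borel \<Otimes>\<^sub>M count_space UNIV)"
      by (intro borel_measurable_times measurable_compose[OF measurable_fst q]
          measurable_compose[OF measurable_snd, of "indicator {j}"]) simp
    have "integrable (distr M (borel \<Otimes>\<^sub>M count_space UNIV) (\<lambda>w. (x j w, R K w))) (\<lambda>z. q (fst z) * indicator {j} (snd z))"
      using hm i by (subst integrable_distr_eq) auto
    then have ii: "integrable (?Q \<Otimes>\<^sub>M ?R) (\<lambda>z. q (fst z) * indicator {j} (snd z))"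
      unfolding J .
    have "(\<integral>w. q (x j w) * indicator {j} (R K w) \<partial>M)
        = (\<integral>z. q (fst z) * indicator {j} (snd z) \<partial>distr M (borel \<Otimes>\<^sub>M count_space UNIV) (\<lambda>w. (x j w, R K w)))"
      using hm by (subst integral_distr) auto
    also have "\<dots> = (\<integral>u. (\<integral>i. q u * indicator {j} i \<partial>?R) \<partial>?Q)"
      unfolding J using QR.integral_fst'[OF ii] by simp
    also have "\<dots> = (\<integral>u. q u * R.prob {j} \<partial>?Q)" by simp
    also have "\<dots> = (\<integral>u. q u \<partial>?Q) * R.prob {j}" by simp
    also have "(\<integral>u. q u \<partial>?Q) = (\<integral>w. q (x j w) \<partial>M)" by (rule integral_distr) auto
    also have "R.prob {j} = gam j / (\<Sum>i\<in>?I. gam i)"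
      unfolding Rp[OF j, symmetric] by (subst measure_distr) (auto intro!: arg_cong[where f=M.prob])
    finally show "(\<integral>w. q (x j w) * indicator {j} (R K w) \<partial>M) = (\<integral>w. q (x j w) \<partial>M) * (gam j / (\<Sum>i\<in>?I. gam i))" .
  qed
  have "(\<integral>w. q (x (R K w) w) \<partial>M) = (\<integral>w. (\<Sum>j\<in>?I. q (x j w) * indicator {j} (R K w)) \<partial>M)"
  proof (rule Bochner_Integration.integral_cong[OF refl])
    fix w assume "w \<in> space M"
    have "(\<Sum>j\<in>?I. q (x j w) * indicator {j} (R K w)) = (\<Sum>j\<in>?I. if j = R K w then q (x j w) else 0)"
      by (intro sum.cong) (auto simp: indicator_def)
    also have "\<dots> = q (x (R K w) w)" using RI[OF \<open>w \<in> space M\<close>] by (simp add: sum.delta)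
    finally show "q (x (R K w) w) = (\<Sum>j\<in>?I. q (x j w) * indicator {j} (R K w))" by simp
  qed
  also have "\<dots> = (\<Sum>j\<in>?I. (\<integral>w. q (x j w) \<partial>M) * (gam j / (\<Sum>i\<in>?I. gam i)))"
    by (subst Bochner_Integration.integral_sum) (use eachi each in auto)
  finally have eq: "(\<integral>w. q (x (R K w) w) \<partial>M) = (\<Sum>j\<in>?I. gam j * (\<integral>w. q (x j w) \<partial>M)) / (\<Sum>i\<in>?I. gam i)"
    by (simp add: sum_divide_distrib mult.commute)
  have "(\<Sum>i\<in>?I. gam i) > 0" using K gam_pos by (intro sum_pos) auto
  then show "(\<integral>w. q (x (R K w) w) \<partial>M) * (\<Sum>i\<in>?I. gam i) = (\<Sum>j\<in>?I. gam j * (\<integral>w. q (x j w) \<partial>M))"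
    unfolding eq by simp
qed

text \<open>Everything the arithmetic below needs from the run. The mean of the norm is compared
  with the mean square by the nonnegativity of a variance.\<close>

lemma residual_bound:
  assumes K: "first_index lam K < K"
  defines "Res \<equiv> \<lambda>w. residual X f eta (1 / gam0) (x (R K w) w)"
  shows "integrable M (\<lambda>w. (norm (Res w))\<^sup>2)" "integrable M (\<lambda>w. norm (Res w))"
    "(\<integral>w. norm (Res w) \<partial>M)\<^sup>2 \<le> (\<integral>w. (norm (Res w))\<^sup>2 \<partial>M)"
    "(\<integral>w. (norm (Res w))\<^sup>2 \<partial>M) \<le> L0\<^sup>2"
    "(\<integral>w. (norm (Res w))\<^sup>2 \<partial>M) * (\<Sum>i=first_index lam K..<K. gam i)
      \<le> 2 * ((\<integral>w. f (x (first_index lam K) w) \<partial>M) - fstar + 2 * L0 * eta)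
        + V * (\<Sum>k=first_index lam K..<K. gam k / N k)"
proof -
  have Res: "Res w = G (x (R K w) w)" for w
    unfolding Res_def by (rule G_residual[OF x_in])
  note o2 = output_expectation[OF K, of "\<lambda>y. (norm (G y))\<^sup>2" "L0\<^sup>2"]
  show i2: "integrable M (\<lambda>w. (norm (Res w))\<^sup>2)"
    unfolding Res by (rule o2(1)) (use G2_le in auto)
  show i1: "integrable M (\<lambda>w. norm (Res w))"
    unfolding Res by (rule output_expectation(1)[OF K, of "\<lambda>y. norm (G y)" L0]) (use G_le in auto)
  have "0 \<le> M.variance (\<lambda>w. norm (Res w))" by simp
  then show "(\<integral>w. norm (Res w) \<partial>M)\<^sup>2 \<le> (\<integral>w. (norm (Res w))\<^sup>2 \<partial>M)"
    using i1 i2 by (subst (asm) M.variance_eq) auto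
  have "(\<integral>w. (norm (Res w))\<^sup>2 \<partial>M) \<le> (\<integral>w. L0\<^sup>2 \<partial>M)"
    by (rule integral_mono) (use i2 G2_le[OF x_in] in \<open>auto simp: Res\<close>)
  then show "(\<integral>w. (norm (Res w))\<^sup>2 \<partial>M) \<le> L0\<^sup>2" by (simp add: M.prob_space)
  have "(\<integral>w. (norm (Res w))\<^sup>2 \<partial>M) * (\<Sum>i=first_index lam K..<K. gam i)
      = (\<Sum>j=first_index lam K..<K. gam j * (\<integral>w. (norm (G (x j w)))\<^sup>2 \<partial>M))"
    unfolding Res by (rule o2(2)) (use G2_le in auto)
  also have "\<dots> \<le> 2 * ((\<integral>w. f (x (first_index lam K) w) \<partial>M) - fstar + 2 * L0 * eta)
        + V * (\<Sum>k=first_index lam K..<K. gam k / N k)"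
    by (rule sum_descent) (use K in simp)
  finally show "(\<integral>w. (norm (Res w))\<^sup>2 \<partial>M) * (\<Sum>i=first_index lam K..<K. gam i)
      \<le> 2 * ((\<integral>w. f (x (first_index lam K) w) \<partial>M) - fstar + 2 * L0 * eta)
        + V * (\<Sum>k=first_index lam K..<K. gam k / N k)" .
qed

end

subsection \<open>Step sizes and complexity\<close>

text \<open>The first term is at most \<open>1/2\<close>; the others are compared with the integral
  of \<open>1 / t\<close> from \<open>l + 1\<close> to \<open>K\<close>, and
  \<open>lam * K \<le> l\<close> turns this into \<open>- ln lam\<close>. This is the origin of
  \<open>0.5 - ln lam\<close>.\<close>

lemma harmonic_window:
  assumes l: "1 \<le> l" "l < K" and lam: "0 < lam" "lam * real K \<le> real l"
  shows "(\<Sum>k=l..<K. 1 / (real k + 1)) \<le> 1/2 - ln lam"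
proof -
  have "(\<Sum>k=l..<K. 1 / (real k + 1)) \<le> 1 / (real l + 1) + ln (real K) - ln (real l + 1)"
    using l(2)
  proof (induction K)
    case (Suc K)
    show ?case
    proof (cases "l < K")
      case True
      have K: "0 < real K" using True by simp
      have "ln (real K / (real K + 1)) \<le> real K / (real K + 1) - 1"
        using K by (intro ln_le_minus_one) simp
      also have "\<dots> = - (1 / (real K + 1))" using K by (simp add: field_simps)
      finally have "1 / (real K + 1) \<le> ln (real K + 1) - ln (real K)"
        using K by (simp add: ln_div)
      moreover have "(\<Sum>k=l..<Suc K. 1 / (real k + 1)) = (\<Sum>k=l..<K. 1 / (real k + 1)) + 1 / (real K + 1)"
        using True by simp
      ultimately show ?thesis using Suc.IH[OF True] by (simp add: add.commute)
    next
      case False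
      then have "l = K" using Suc.prems by simp
      then show ?thesis by (simp add: add.commute)
    qed
  qed simp
  moreover have "1 / (real l + 1) \<le> 1/2" using l by (simp add: divide_simps)
  moreover have "ln (real K) - ln (real l + 1) \<le> - ln lam"
  proof -
    have "0 < lam * real K" using lam l by simp
    moreover have "lam * real K \<le> real l + 1" using lam by simp
    ultimately have "ln (lam * real K) \<le> ln (real l + 1)" by simp
    moreover have "ln (lam * real K) = ln lam + ln (real K)" using lam l by (simp add: ln_mult)
    ultimately show ?thesis by simp
  qed
  ultimately show ?thesis by linarith
qed

lemma double_bound: "e \<le> 2 * d + v \<Longrightarrow> v \<le> y \<Longrightarrow> 0 \<le> y \<Longrightarrow> e \<le> 2 * (d + y)" for d e v y :: real
  unfolding distrib_left by linarith

lemma inverse_sqrt_window: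
  assumes "l \<le> K"
  shows "2 * (sqrt (real K + 1) - sqrt (real l + 1)) \<le> (\<Sum>k=l..<K. 1 / sqrt (real k + 1))"
  using assms
proof (induction K rule: dec_induct)
  case (step K)
  let ?a = "sqrt (real K + 1)" and ?b = "sqrt (real (Suc K) + 1)"
  have a: "0 < ?a" by simp
  have ab: "?a \<le> ?b" by simp
  have "(?b - ?a) * (?b + ?a) = 1"
    using real_sqrt_mult_self[of "real K + 1"] real_sqrt_mult_self[of "real (Suc K) + 1"]
    by (simp add: algebra_simps)
  moreover have "(?b - ?a) * (2 * ?a) \<le> (?b - ?a) * (?b + ?a)"
    using ab by (intro mult_left_mono) auto
  ultimately have "2 * (?b - ?a) * ?a \<le> 1" by (simp add: algebra_simps)
  then have "2 * (?b - ?a) \<le> 1 / ?a" using a by (simp add: pos_le_divide_eq)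
  then show ?case using step by (simp add: algebra_simps)
qed simp

text \<open>Compares the variance constant reached here with the constant claimed;
  \<open>3 < pi < 4\<close> is enough.\<close>

lemma pi_square_le: "pi\<^sup>2 \<le> 16 * sqrt (2 * pi)"
proof -
  have "pi\<^sup>2 \<le> 4\<^sup>2" using pi_less_4 by (intro power_mono) auto
  then have "pi\<^sup>2 \<le> 16 * 1" by simp
  also have "\<dots> \<le> 16 * sqrt (2 * pi)" using pi_gt3 by (intro mult_left_mono) auto
  finally show ?thesis .
qed

lemma first_index_ge: "0 \<le> lam \<Longrightarrow> lam * real K \<le> real (first_index lam K)"
  unfolding first_index_def by (simp add: real_nat_ceiling_ge)

lemma first_index_le: "0 \<le> lam \<Longrightarrow> real (first_index lam K) \<le> lam * real K + 1"
  unfolding first_index_def by (simp add: of_nat_nat)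

lemma ceiling_batch: "c > 0 \<Longrightarrow> real (nat \<lceil>c\<rceil>) \<le> c + 1" "c \<le> real (nat \<lceil>c\<rceil>)"
  by (simp_all add: of_nat_nat real_nat_ceiling_ge)

text \<open>Integral comparison gives twice the difference of the roots, and rounding the first
  index costs at most 2 in that difference. The surplus pays for twice this loss as soon as the
  difference is 4.\<close>

lemma sqrt_window_ge:
  assumes lam: "0 < lam" "lam < 1" and l: "first_index lam K \<le> K" and big: "4 \<le> sqrt K - sqrt (lam * K)"
  shows "(1 - sqrt lam) * sqrt K \<le> (\<Sum>k=first_index lam K..<K. 1 / sqrt (real k + 1))"
proof -
  let ?l = "first_index lam K"
  have "sqrt (real ?l + 1) \<le> sqrt (lam * real K + 2)"
    using first_index_le[of lam K] lam by simp
  also have "\<dots> \<le> sqrt (lam * real K) + sqrt 2"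
    using lam by (intro sqrt_add_le_add_sqrt) auto
  also have "sqrt 2 \<le> (2::real)" by (rule real_le_lsqrt) auto
  finally have 1: "sqrt (real ?l + 1) \<le> sqrt (lam * real K) + 2" by simp
  have 2: "sqrt (real K) \<le> sqrt (real K + 1)" by simp
  have arith: "b - c \<le> 2 * (b' - a)" if "a \<le> c + 2" "b \<le> b'" "4 \<le> b - c" for a b b' c :: real
    using that unfolding right_diff_distrib by linarith
  have "(1 - sqrt lam) * sqrt K = sqrt K - sqrt (lam * K)"
    by (simp add: real_sqrt_mult algebra_simps)
  also have "\<dots> \<le> 2 * (sqrt (real K + 1) - sqrt (real ?l + 1))"
    by (rule arith[OF 1 2 big])
  also have "\<dots> \<le> (\<Sum>k=?l..<K. 1 / sqrt (real k + 1))" by (rule inverse_sqrt_window[OF l])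
  finally show ?thesis .
qed

text \<open>The window keeps at least \<open>(1 - lam) * K / 2\<close> indices and the descent sum
  carries a factor 2; together they make the 4 of \<open>gamma / 4\<close>.\<close>

lemma const_step_arith:
  fixes n L eta gamma lam a D E H :: real and K l :: nat
  assumes n: "1 \<le> n" and L: "0 < L" and eta: "0 < eta" and gam: "0 < gamma" "gamma < eta / (sqrt n * L)"
    and lam: "lam < 1" and K: "2 / (1 - lam) < real K" and a: "0 < a" and D: "0 \<le> D" and H: "0 \<le> H"
    and l: "real l \<le> lam * real K + 1" "l < K"
    and sums: "(\<Sum>k=l..<K. 1 / (real k + 1)) \<le> H"
    and N: "\<And>k. a * sqrt n * L * (real k + 1) \<le> N k"
    and E0: "0 \<le> E"
    and E: "E * (\<Sum>i=l..<K. gamma) \<le> 2 * (D + 2 * L * eta) + (pi\<^sup>2 * n * L\<^sup>2) * (\<Sum>k=l..<K. gamma / N k)"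
  shows "E \<le> (D + 2 * L * eta + 16 * sqrt n * sqrt (2 * pi) * L * H / a * gamma)
    / ((1 - sqrt n * L * gamma / eta) * (gamma / 4) * (1 - lam) * real K)"
proof -
  let ?s = "sqrt n"
  let ?Num = "D + 2 * L * eta + 16 * ?s * sqrt (2 * pi) * L * H / a * gamma"
  have s: "0 < ?s" "?s * ?s = n" using n by auto
  have r: "0 \<le> ?s * L * gamma / eta" "?s * L * gamma / eta < 1"
    using gam eta L s by (auto simp: field_simps)
  have "(\<Sum>k=l..<K. gamma / N k) \<le> (\<Sum>k=l..<K. gamma / (a * ?s * L) * (1 / (real k + 1)))"
  proof (rule sum_mono)
    fix k
    have p: "0 < a * ?s * L * (real k + 1)" using a s L by simp
    have "gamma / N k \<le> gamma / (a * ?s * L * (real k + 1))"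
      using gam by (intro frac_le[OF _ order_refl p N]) auto
    then show "gamma / N k \<le> gamma / (a * ?s * L) * (1 / (real k + 1))" by simp
  qed
  also have "\<dots> = gamma / (a * ?s * L) * (\<Sum>k=l..<K. 1 / (real k + 1))"
    by (simp add: sum_distrib_left)
  also have "\<dots> \<le> gamma / (a * ?s * L) * H"
    using sums gam a s L by (intro mult_left_mono) auto
  finally have "(pi\<^sup>2 * n * L\<^sup>2) * (\<Sum>k=l..<K. gamma / N k) \<le> (pi\<^sup>2 * n * L\<^sup>2) * (gamma / (a * ?s * L) * H)"
    using n by (intro mult_left_mono) auto
  also have "\<dots> = pi\<^sup>2 * (?s * L * H / a * gamma)"
    using s a L by (simp add: power2_eq_square field_simps)
  also have "\<dots> \<le> (16 * sqrt (2 * pi)) * (?s * L * H / a * gamma)"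
    using s a L H gam by (intro mult_right_mono pi_square_le) auto
  also have "\<dots> = 16 * ?s * sqrt (2 * pi) * L * H / a * gamma" by (simp add: ac_simps)
  finally have 1: "E * (\<Sum>i=l..<K. gamma) \<le> 2 * ?Num"
    by (rule double_bound[OF E]) (use s a L H gam in auto)
  \<comment> \<open>Hence the single index that rounding up may cost is less than half of
    \<open>(1 - lam) * K\<close>.\<close>
  have "2 < (1 - lam) * real K" using K lam by (simp add: field_simps)
  then have "(1 - lam) * real K / 2 \<le> real K - real l"
    using l unfolding left_diff_distrib mult_1 diff_divide_distrib by linarith
  then have "E * ((1 - lam) * real K / 2 * gamma) \<le> E * ((real K - real l) * gamma)"
    using E0 gam by (intro mult_left_mono mult_right_mono) auto
  also have "\<dots> = E * (\<Sum>i=l..<K. gamma)" using l by (simp add: of_nat_diff)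
  finally have "E * ((1 - lam) * real K / 2 * gamma) \<le> 2 * ?Num" using 1 by (rule order_trans)
  then have "E * ((1 - lam) * real K / 2 * gamma) / 2 \<le> ?Num" by simp
  moreover have "E * ((1 - lam) * real K / 2 * gamma) / 2 = E * ((gamma / 4) * (1 - lam) * real K)" by simp
  ultimately have 2: "E * ((gamma / 4) * (1 - lam) * real K) \<le> ?Num" by (simp only:)
  have Kp: "0 < real K" using l by simp
  have den: "0 < (1 - ?s * L * gamma / eta) * (gamma / 4) * (1 - lam) * real K"
    using r gam lam Kp by simp
  have "(1 - ?s * L * gamma / eta) * (E * ((gamma / 4) * (1 - lam) * real K)) \<le> 1 * (E * ((gamma / 4) * (1 - lam) * real K))"
    using r E0 gam lam Kp by (intro mult_right_mono) auto
  then have "E * ((1 - ?s * L * gamma / eta) * (gamma / 4) * (1 - lam) * real K) \<le> ?Num"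
    using 2 by (simp only: ac_simps mult_1)
  then show ?thesis using den by (simp only: pos_le_divide_eq)
qed

text \<open>The threshold 4 is that of \<open>sqrt_window_ge\<close>. Below it the left-hand side is
  at most \<open>L^2 * (gamma0 / 2 * 4)\<close>, and the step-size condition bounds this by the term
  \<open>2 * L * eta\<close> of the numerator.\<close>

lemma dim_step_arith:
  fixes n L eta gamma0 lam a D E H :: real and K :: nat
  assumes n: "1 \<le> n" and L: "0 < L" and eta: "0 < eta" and gam: "0 < gamma0" "gamma0 < eta / (sqrt n * L)"
    and lam: "0 < lam" "lam < 1" and a: "0 < a" and D: "0 \<le> D" and H: "0 \<le> H"
    and l: "first_index lam K < K"
    and sums: "(\<Sum>k=first_index lam K..<K. 1 / (real k + 1)) \<le> H"
    and N: "\<And>k. a * sqrt n * L * sqrt (real k + 1) \<le> N k"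
    and E0: "0 \<le> E" and EL: "E \<le> L\<^sup>2"
    and E: "E * (\<Sum>i=first_index lam K..<K. gamma0 / sqrt (real i + 1))
      \<le> 2 * (D + 2 * L * eta) + (pi\<^sup>2 * n * L\<^sup>2) * (\<Sum>k=first_index lam K..<K. gamma0 / sqrt (real k + 1) / N k)"
  shows "E \<le> (D + 2 * L * eta + 16 * sqrt (2 * pi) * L * sqrt n * H / a * gamma0)
    / ((1 - sqrt n * L * gamma0 / eta) * (gamma0 / 2) * (1 - sqrt lam) * sqrt (real K))"
proof -
  let ?l = "first_index lam K"
  let ?s = "sqrt n"
  let ?d = "(1 - sqrt lam) * sqrt (real K)"
  let ?Num = "D + 2 * L * eta + 16 * sqrt (2 * pi) * L * ?s * H / a * gamma0"
  have s: "1 \<le> ?s" "?s * ?s = n" using n by auto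
  have r: "0 \<le> ?s * L * gamma0 / eta" "?s * L * gamma0 / eta < 1"
    using gam eta L s by (auto simp: field_simps)
  have noise: "0 \<le> 16 * sqrt (2 * pi) * L * ?s * H / a * gamma0" using s a L H gam by auto
  have Kp: "0 < real K" using l by simp
  have d0: "0 < ?d" using lam Kp by simp
  have main: "E * (gamma0 / 2 * ?d) \<le> ?Num"
  proof (cases "4 \<le> sqrt K - sqrt (lam * K)")
    case True
    \<comment> \<open>Step and batch contribute one root each, so the noise sums to the same
      harmonic window as for constant steps.\<close>
    have "(\<Sum>k=?l..<K. gamma0 / sqrt (real k + 1) / N k) \<le> (\<Sum>k=?l..<K. gamma0 / (a * ?s * L) * (1 / (real k + 1)))"
    proof (rule sum_mono)
      fix k
      have p: "0 < a * ?s * L * sqrt (real k + 1)" using a s L by simp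
      have "gamma0 / sqrt (real k + 1) / N k \<le> gamma0 / sqrt (real k + 1) / (a * ?s * L * sqrt (real k + 1))"
        using gam by (intro frac_le[OF _ order_refl p N]) auto
      also have "\<dots> = gamma0 / (a * ?s * L) * (1 / (real k + 1))"
        by (simp add: field_simps)
      finally show "gamma0 / sqrt (real k + 1) / N k \<le> gamma0 / (a * ?s * L) * (1 / (real k + 1))" .
    qed
    also have "\<dots> = gamma0 / (a * ?s * L) * (\<Sum>k=?l..<K. 1 / (real k + 1))"
      by (simp add: sum_distrib_left)
    also have "\<dots> \<le> gamma0 / (a * ?s * L) * H"
      using sums gam a s L by (intro mult_left_mono) auto
    finally have "(pi\<^sup>2 * n * L\<^sup>2) * (\<Sum>k=?l..<K. gamma0 / sqrt (real k + 1) / N k) \<le> (pi\<^sup>2 * n * L\<^sup>2) * (gamma0 / (a * ?s * L) * H)"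
      using n by (intro mult_left_mono) auto
    also have "\<dots> = pi\<^sup>2 * (?s * L * H / a * gamma0)"
      using s a L by (simp add: power2_eq_square field_simps)
    also have "\<dots> \<le> (16 * sqrt (2 * pi)) * (?s * L * H / a * gamma0)"
      using s a L H gam by (intro mult_right_mono pi_square_le) auto
    also have "\<dots> = 16 * sqrt (2 * pi) * L * ?s * H / a * gamma0" by (simp add: ac_simps)
    finally have 1: "E * (\<Sum>i=?l..<K. gamma0 / sqrt (real i + 1)) \<le> 2 * ?Num"
      by (rule double_bound[OF E _ noise])
    have "?d \<le> (\<Sum>k=?l..<K. 1 / sqrt (real k + 1))"
      by (rule sqrt_window_ge[OF lam _ True]) (use l in simp)
    then have "gamma0 * ?d \<le> gamma0 * (\<Sum>k=?l..<K. 1 / sqrt (real k + 1))"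
      using gam by (intro mult_left_mono) auto
    also have "\<dots> = (\<Sum>k=?l..<K. gamma0 / sqrt (real k + 1))" by (simp add: sum_distrib_left)
    finally have "E * (gamma0 * ?d) \<le> E * (\<Sum>k=?l..<K. gamma0 / sqrt (real k + 1))"
      using E0 by (rule mult_left_mono)
    then have "E * (gamma0 * ?d) \<le> 2 * ?Num" using 1 by linarith
    then show ?thesis by simp
  next
    case False \<comment> \<open>the window is short, and the right-hand side exceeds \<open>L\<^sup>2\<close>\<close>
    have "?d = sqrt K - sqrt (lam * K)"
      by (simp add: real_sqrt_mult algebra_simps)
    then have d4: "?d \<le> 4" using False by simp
    have "L * gamma0 * 1 \<le> L * gamma0 * ?s" using L gam s by (intro mult_left_mono) auto
    also have "\<dots> \<le> eta" using r eta by (simp add: field_simps)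
    finally have Lg: "L * gamma0 \<le> eta" by simp
    have "E * (gamma0 / 2 * ?d) \<le> L\<^sup>2 * (gamma0 / 2 * 4)"
      using EL E0 gam d4 d0 by (intro mult_mono mult_left_mono) auto
    also have "\<dots> = 2 * L * (L * gamma0)" by (simp add: power2_eq_square)
    also have "\<dots> \<le> 2 * L * eta" using Lg L by (intro mult_left_mono) auto
    finally show ?thesis using D noise by linarith
  qed
  have den: "0 < (1 - ?s * L * gamma0 / eta) * (gamma0 / 2) * (1 - sqrt lam) * sqrt (real K)"
    using r gam lam Kp by simp
  have "(1 - ?s * L * gamma0 / eta) * (E * (gamma0 / 2 * ?d)) \<le> 1 * (E * (gamma0 / 2 * ?d))"
    using r E0 gam d0 by (intro mult_right_mono) auto
  then have "E * ((1 - ?s * L * gamma0 / eta) * (gamma0 / 2) * (1 - sqrt lam) * sqrt (real K)) \<le> ?Num"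
    using main by (simp only: ac_simps mult_1)
  then show ?thesis using den by (simp only: pos_le_divide_eq)
qed


section \<open>Choosing the number of iterations and counting samples\<close>

lemma sum_of_squares_bound: "(x + y)\<^sup>2 \<le> 2 * (x\<^sup>2 + y\<^sup>2)" for x y :: real
  using zero_le_power2[of "x - y"] unfolding power2_diff power2_sum distrib_left by linarith

lemma sum_of_cubes_bound: "0 \<le> x \<Longrightarrow> 0 \<le> y \<Longrightarrow> (x + y)^3 \<le> 4 * (x^3 + y^3)" for x y :: real
proof -
  assume "0 \<le> x" "0 \<le> y"
  then have "0 \<le> 3 * ((x + y) * (x - y)\<^sup>2)" by simp
  also have "3 * ((x + y) * (x - y)\<^sup>2) = 4 * (x^3 + y^3) - (x + y)^3"
    by (simp add: power2_eq_square power3_eq_cube algebra_simps)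
  finally show ?thesis by simp
qed

lemma sum_batch_const:
  assumes "0 < c"
  shows "real (\<Sum>k=0..K. nat \<lceil>c * (real k + 1)\<rceil>) \<le> c * ((real K + 1) * (real K + 2)) / 2 + (real K + 1)"
proof (induction K)
  case 0
  show ?case using ceiling_batch(1)[OF assms] by simp
next
  case (Suc K)
  have "real (nat \<lceil>c * (real (Suc K) + 1)\<rceil>) \<le> c * (real (Suc K) + 1) + 1"
    by (rule ceiling_batch(1)) (use assms in simp)
  moreover have "c * ((real (Suc K) + 1) * (real (Suc K) + 2)) / 2 + (real (Suc K) + 1)
      = (c * ((real K + 1) * (real K + 2)) / 2 + (real K + 1)) + (c * (real (Suc K) + 1) + 1)"
    by (simp add: field_simps)
  moreover have "real (\<Sum>k=0..Suc K. nat \<lceil>c * (real k + 1)\<rceil>)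
      = real (\<Sum>k=0..K. nat \<lceil>c * (real k + 1)\<rceil>) + real (nat \<lceil>c * (real (Suc K) + 1)\<rceil>)"
    by simp
  ultimately show ?case using Suc.IH by linarith
qed

lemma sum_batch_sqrt:
  assumes "0 < c"
  shows "real (\<Sum>k=0..K. nat \<lceil>c * sqrt (real k + 1)\<rceil>) \<le> (real K + 1) * (c * sqrt (real K + 1) + 1)"
proof -
  have "real (\<Sum>k=0..K. nat \<lceil>c * sqrt (real k + 1)\<rceil>) = (\<Sum>k=0..K. real (nat \<lceil>c * sqrt (real k + 1)\<rceil>))"
    by simp
  also have "\<dots> \<le> (\<Sum>k=0..K. c * sqrt (real K + 1) + 1)"
  proof (rule sum_mono)
    fix k assume "k \<in> {0..K}"
    then have "c * sqrt (real k + 1) \<le> c * sqrt (real K + 1)"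
      using assms by (intro mult_left_mono) auto
    moreover have "real (nat \<lceil>c * sqrt (real k + 1)\<rceil>) \<le> c * sqrt (real k + 1) + 1"
      by (rule ceiling_batch(1)) (use assms in simp)
    ultimately show "real (nat \<lceil>c * sqrt (real k + 1)\<rceil>) \<le> c * sqrt (real K + 1) + 1" by linarith
  qed
  also have "\<dots> = (real K + 1) * (c * sqrt (real K + 1) + 1)" by simp
  finally show ?thesis .
qed

lemma window_const_ge_2:
  assumes "0 < lam" "lam < 1" "0 < a" "0 < eta0" "0 \<le> D" "0 \<le> c"
  shows "2 \<le> 2 + D + c * sqrt (2 * pi) * (1/2 - ln lam) * eta0 / a"
proof -
  have "ln lam \<le> 0" using assms by simp
  then have "0 \<le> 1/2 - ln lam" by linarith
  then have "0 \<le> c * sqrt (2 * pi) * (1/2 - ln lam) * eta0 / a" using assms by simp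
  then show ?thesis using assms by linarith
qed

text \<open>Each summand is charged to one part of \<open>L / eta + L^2\<close>: the gap
  \<open>D\<close> and the noise to \<open>L / eta\<close>, a leftover \<open>eta\<close> being
  bounded by \<open>eta0\<close>, and the smoothing error to \<open>L^2\<close>.\<close>

lemma numerator_bound:
  fixes D L eta eta0 c a H :: real
  assumes L: "0 < L" and eta: "0 < eta" "eta \<le> eta0" and a: "0 < a" and D: "0 \<le> D" and c: "0 \<le> c" "0 \<le> H"
  shows "(L / eta) * (D + 2 * L * eta + c * sqrt (2 * pi) * H * eta / a)
    \<le> (2 + D + c * sqrt (2 * pi) * H * eta0 / a) * (L / eta + L\<^sup>2)"
proof -
  let ?A = "L / eta + L\<^sup>2"
  have A: "L / eta \<le> ?A" "L\<^sup>2 \<le> ?A" using L eta by auto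
  have "(L / eta) * D \<le> ?A * D" using D A by (intro mult_right_mono) auto
  moreover have "(L / eta) * (2 * L * eta) \<le> ?A * 2"
  proof -
    have "(L / eta) * (2 * L * eta) = L\<^sup>2 * 2" using eta by (simp add: power2_eq_square)
    then show ?thesis using mult_right_mono[OF A(2), of 2] by simp
  qed
  moreover have "(L / eta) * (c * sqrt (2 * pi) * H * eta / a) \<le> ?A * (c * sqrt (2 * pi) * H * eta0 / a)"
    using A L eta a c by (intro mult_mono divide_right_mono mult_left_mono) auto
  moreover have "(x + y + z) * w = w * x + w * y + w * z" "w * (x + y + z) = w * x + w * y + w * z" for w x y z :: real
    by (simp_all add: algebra_simps)
  ultimately show ?thesis by (simp only:)
qed

text \<open>With \<open>Q\<close> the claimed order, about \<open>Fc * Q / 2\<close> iterations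
  reach the accuracy, and the other half of the budget pays for rounding. The clauses of
  \<open>small_eps\<close> say \<open>Q \<ge> 1\<close> and \<open>s * L * Q \<ge> 1\<close>; the
  second keeps the rounding of the batches below the order of the main term.\<close>

lemma const_step_complexity:
  fixes n L eta eta0 lam a D eps H :: real
  assumes n: "1 \<le> n" and L: "0 < L" and eta: "0 < eta" "eta \<le> eta0"
    and lam: "0 < lam" "lam < 1" and a: "0 < a" and D: "0 \<le> D"
    and eps: "0 < eps" "small_eps n L eta eps"
  defines "gamma \<equiv> eta / (2 * sqrt n * L)"
  shows "\<exists>K::nat. 2 / (1 - lam) < real K \<and>
     (D + 2 * L * eta + 16 * sqrt n * sqrt (2 * pi) * L * (1/2 - ln lam) / a * gamma)
       / ((1 - sqrt n * L * gamma / eta) * (gamma / 4) * (1 - lam) * real K) \<le> eps\<^sup>2 \<and>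
     real K \<le> factor_const a lam eta0 D * (n powr (1/2) * (L / eta + L\<^sup>2) / eps\<^sup>2) \<and>
     real (\<Sum>k=0..K. nat \<lceil>a * sqrt n * L * (real k + 1)\<rceil>)
       \<le> (a + 1) * (factor_const a lam eta0 D)\<^sup>2 * (n powr (3/2) * (L^3 / eta\<^sup>2 + L^5) / eps^4)"
proof -
  define s where "s = sqrt n"
  define H where "H = 1/2 - ln lam"
  define A where "A = L / eta + L\<^sup>2"
  define c1 where "c1 = 2 + D + 8 * sqrt (2 * pi) * H * eta0 / a"
  define Fc where "Fc = 32 / (1 - lam) * c1"
  define Q where "Q = s * A / eps\<^sup>2"
  have "ln lam \<le> 0" using lam by simp
  then have H0: "0 \<le> H" unfolding H_def by linarith
  have s: "1 \<le> s" "s * s = n" using n by (auto simp: s_def)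
  have e2: "0 < eps\<^sup>2" using eps by simp
  have A0: "0 < A" using L eta by (simp add: A_def add_pos_nonneg)
  have Q1: "1 \<le> Q"
    using eps e2 by (simp add: small_eps_def Q_def A_def s_def)
  have sLQ: "1 \<le> s * L * Q"
  proof -
    have "eps\<^sup>2 \<le> s * s * L * A" using eps by (simp add: small_eps_def A_def s)
    then have "1 \<le> s * s * L * A / eps\<^sup>2" using e2 by simp
    then show ?thesis by (simp add: Q_def ac_simps)
  qed
  have c1: "2 \<le> c1" unfolding c1_def H_def by (rule window_const_ge_2) (use lam a eta D in auto)
  have Fc: "64 / (1 - lam) \<le> Fc"
  proof -
    have "32 / (1 - lam) * 2 \<le> 32 / (1 - lam) * c1" using c1 lam by (intro mult_left_mono) auto
    then show ?thesis by (simp add: Fc_def)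
  qed
  have "64 \<le> 64 / (1 - lam)" using lam by (simp add: pos_le_divide_eq)
  with Fc have Fc64: "64 \<le> Fc" by linarith
  have FQ: "Fc \<le> Fc * Q" using mult_left_mono[OF Q1, of Fc] Fc64 by simp
  define K where "K = nat \<lfloor>Fc * Q / 2\<rfloor> + 1"
  have K: "Fc * Q / 2 < real K" "real K \<le> Fc * Q / 2 + 1"
    using FQ Fc64 unfolding K_def by (auto simp: of_nat_nat) linarith+
  have k1: "2 / (1 - lam) < real K"
  proof -
    have "2 / (1 - lam) \<le> 32 / (1 - lam)" using lam by (intro divide_right_mono) auto
    moreover have "64 / (1 - lam) = 2 * (32 / (1 - lam))" by simp
    ultimately show ?thesis using Fc FQ K by linarith
  qed
  have K0: "0 < real K" using K FQ Fc64 by linarith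
  have gam: "gamma = eta / (2 * s * L)" by (simp add: gamma_def s_def)
  let ?W = "D + 2 * L * eta + 8 * sqrt (2 * pi) * H * eta / a"
  have bound: "(D + 2 * L * eta + 16 * s * sqrt (2 * pi) * L * H / a * gamma)
       / ((1 - s * L * gamma / eta) * (gamma / 4) * (1 - lam) * real K) \<le> eps\<^sup>2"
  proof -
    \<comment> \<open>The special step cancels \<open>s\<close> and \<open>L\<close> and halves 16
      to the 8 of \<open>factor_const\<close>.\<close>
    have num: "D + 2 * L * eta + 16 * s * sqrt (2 * pi) * L * H / a * gamma = ?W"
      using s L by (simp add: gam)
    have half: "1 - s * L * gamma / eta = 1 / 2" using s L eta by (simp add: gam)
    \<comment> \<open>This 16 is made of the 4 of \<open>gamma / 4\<close>, the 2 in the step and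
      the factor \<open>1/2\<close> of the denominator; since \<open>K\<close> uses half of the
      budget, it becomes the 32 of \<open>factor_const\<close>.\<close>
    have "16 * s * ((L / eta) * ?W) \<le> 16 * s * (c1 * A)"
      unfolding c1_def A_def using s
      by (intro mult_left_mono numerator_bound[OF L eta a D]) (use H0 in auto)
    also have "\<dots> = eps\<^sup>2 * ((1 - lam) * (Fc * Q / 2))"
      using lam e2 by (simp add: Fc_def Q_def)
    also have "\<dots> \<le> eps\<^sup>2 * ((1 - lam) * real K)"
      using K lam e2 by (intro mult_left_mono) auto
    finally have le: "16 * s * ((L / eta) * ?W) \<le> eps\<^sup>2 * ((1 - lam) * real K)" .
    have g: "1 / 2 * (gamma / 4) * (1 - lam) * real K * (16 * s * L) = eta * ((1 - lam) * real K)"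
      using s L by (simp add: gam field_simps)
    have "?W * (16 * s * L) = eta * (16 * s * ((L / eta) * ?W))" using eta by (simp add: field_simps)
    also have "\<dots> \<le> eta * (eps\<^sup>2 * ((1 - lam) * real K))" using le eta by (intro mult_left_mono) auto
    also have "\<dots> = eps\<^sup>2 * (eta * ((1 - lam) * real K))" by simp
    also have "\<dots> = eps\<^sup>2 * (1 / 2 * (gamma / 4) * (1 - lam) * real K) * (16 * s * L)"
      unfolding g[symmetric] by (simp only: mult.assoc)
    finally have "?W \<le> eps\<^sup>2 * (1 / 2 * (gamma / 4) * (1 - lam) * real K)"
      by (rule mult_right_le_imp_le) (use s L in simp)
    moreover have "0 < 1 / 2 * (gamma / 4) * (1 - lam) * real K"
      using s L eta lam K0 by (simp add: gam)
    ultimately show ?thesis unfolding num half by (simp only: pos_divide_le_eq)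
  qed
  have KF: "real K + 2 \<le> Fc * Q" using K FQ Fc64 by linarith
  have samples: "real (\<Sum>k=0..K. nat \<lceil>a * s * L * (real k + 1)\<rceil>)
       \<le> (a + 1) * Fc\<^sup>2 * (n powr (3/2) * (L^3 / eta\<^sup>2 + L^5) / eps^4)"
  proof -
    let ?T = "Fc\<^sup>2 * Q\<^sup>2 * s * L / 2"
    have "(real K + 1) * (real K + 2) \<le> (Fc * Q) * (Fc * Q)"
      using KF by (intro mult_mono) auto
    then have 1: "a * s * L * ((real K + 1) * (real K + 2)) / 2 \<le> a * s * L * ((Fc * Q) * (Fc * Q)) / 2"
      using a s L by (intro divide_right_mono mult_left_mono) auto
    \<comment> \<open>Rounding adds up to one sample per iteration; raised to the order of the main
      term by \<open>s * L * Q \<ge> 1\<close>, it accounts for \<open>a + 1\<close> in place of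
      \<open>a\<close>.\<close>
    have "real K + 1 \<le> Fc * Q * 1" using KF by simp
    also have "\<dots> \<le> Fc * Q * (Fc / 2 * (s * L * Q))"
      using sLQ Fc64 Q1 mult_mono[of 1 "Fc / 2" 1 "s * L * Q"] by (intro mult_left_mono) auto
    finally have 2: "real K + 1 \<le> ?T" by (simp add: power2_eq_square ac_simps)
    have "real (\<Sum>k=0..K. nat \<lceil>a * s * L * (real k + 1)\<rceil>) \<le> a * s * L * ((real K + 1) * (real K + 2)) / 2 + (real K + 1)"
      by (rule sum_batch_const) (use a s L in simp)
    also have "\<dots> \<le> a * s * L * ((Fc * Q) * (Fc * Q)) / 2 + ?T" using 1 2 by linarith
    also have "\<dots> = (a + 1) * Fc\<^sup>2 * (Q\<^sup>2 * s * L / 2)"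
      by (simp add: power2_eq_square algebra_simps)
    also have "Q\<^sup>2 * s * L / 2 \<le> n powr (3/2) * (L^3 / eta\<^sup>2 + L^5) / eps^4"
    proof -
      have "A\<^sup>2 \<le> 2 * ((L / eta)\<^sup>2 + (L\<^sup>2)\<^sup>2)" unfolding A_def by (rule sum_of_squares_bound)
      then have "s * s * s * L * A\<^sup>2 / 2 \<le> s * s * s * L * (2 * ((L / eta)\<^sup>2 + (L\<^sup>2)\<^sup>2)) / 2"
        using s L by (intro divide_right_mono mult_left_mono) auto
      also have "\<dots> = s * s * s * (L^3 / eta\<^sup>2 + L^5)"
        by (simp add: power2_eq_square power3_eq_cube eval_nat_numeral algebra_simps)
      finally have "s * s * s * L * A\<^sup>2 / 2 / eps^4 \<le> s * s * s * (L^3 / eta\<^sup>2 + L^5) / eps^4"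
        by (rule divide_right_mono) simp
      moreover have "s * s * s = n powr (3/2)"
      proof -
        have "n powr (3/2) = n powr (1 + 1/2)" by simp
        also have "\<dots> = n * s" using n unfolding powr_add by (simp add: s_def powr_half_sqrt)
        finally show ?thesis using s by simp
      qed
      moreover have "Q\<^sup>2 * s * L / 2 = s * s * s * L * A\<^sup>2 / 2 / eps^4"
        by (simp add: Q_def power_divide power_mult_distrib power2_eq_square eval_nat_numeral ac_simps)
      ultimately show ?thesis by (simp only:)
    qed
    finally show ?thesis using a by (simp add: mult_left_mono)
  qed
  have Fc_eq: "factor_const a lam eta0 D = Fc"
    by (simp add: factor_const_def Fc_def c1_def H_def)
  have "n powr (1/2) = s" using n by (simp add: s_def powr_half_sqrt)
  then have "real K \<le> factor_const a lam eta0 D * (n powr (1/2) * (L / eta + L\<^sup>2) / eps\<^sup>2)"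
    using KF unfolding Fc_eq A_def[symmetric] by (simp add: Q_def)
  then show ?thesis
    using k1 bound samples unfolding Fc_eq s_def H_def by (intro exI[of _ K] conjI)
qed

text \<open>The accuracy depends on \<open>sqrt K\<close>, so \<open>K\<close> is taken just above
  \<open>T^2 / 9\<close>; the root \<open>T / 3\<close> explains \<open>6 = 2 * 3\<close> in
  \<open>factor_dim\<close>. The room up to \<open>T^2 / 2\<close> and \<open>T^2 / 4\<close>
  absorbs rounding and the constants 2 and 4 of the bounds for squares and cubes of sums.\<close>

lemma dim_step_complexity:
  fixes n L eta eta0 lam a D eps gamma0 :: real
  assumes n: "1 \<le> n" and L: "0 < L" and eta: "0 < eta" "eta \<le> eta0"
    and lam: "0 < lam" "lam < 1" and a: "0 < a" and D: "0 \<le> D"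
    and eps: "0 < eps" "small_eps n L eta eps"
    and gam: "0 < gamma0" "gamma0 < eta / (sqrt n * L)"
  defines "r \<equiv> sqrt n * L * gamma0 / eta"
  shows "\<exists>K::nat. 2 / (1 - lam) < real K \<and>
     (D + 2 * L * eta + 16 * sqrt (2 * pi) * L * sqrt n * (1/2 - ln lam) / a * gamma0)
       / ((1 - sqrt n * L * gamma0 / eta) * (gamma0 / 2) * (1 - sqrt lam) * sqrt (real K)) \<le> eps\<^sup>2 \<and>
     real K \<le> (factor_dim a lam eta0 D r)\<^sup>2 * (n * (L\<^sup>2 / eta\<^sup>2 + L^4) / eps^4) \<and>
     real (\<Sum>k=0..K. nat \<lceil>a * sqrt n * L * sqrt (real k + 1)\<rceil>)
       \<le> (a + 1) * (factor_dim a lam eta0 D r)^3 * (n\<^sup>2 * (L^4 / eta^3 + L^7) / eps^6)"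
proof -
  define s where "s = sqrt n"
  define H where "H = 1/2 - ln lam"
  define A where "A = L / eta + L\<^sup>2"
  define c1 where "c1 = 2 + D + 16 * sqrt (2 * pi) * H * eta0 / a"
  define d where "d = r * (1 - r) * (1 - sqrt lam)"
  define Fc where "Fc = 6 / d * c1"
  define Q where "Q = s * A / eps\<^sup>2"
  have "ln lam \<le> 0" using lam by simp
  then have H0: "0 \<le> H" unfolding H_def by linarith
  have s: "1 \<le> s" "s * s = n" using n by (auto simp: s_def)
  have e2: "0 < eps\<^sup>2" using eps by simp
  have A0: "0 < A" using L eta by (simp add: A_def add_pos_nonneg)
  have r: "0 < r" "r < 1"
    using gam eta L s n unfolding r_def by (auto simp: field_simps)
  have g0: "gamma0 = r * eta / (s * L)" using s L eta by (simp add: r_def s_def[symmetric])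
  have sl: "0 < 1 - sqrt lam" "1 - sqrt lam \<le> 1" using lam by auto
  have d0: "0 < d" using r sl by (simp add: d_def)
  have rr: "r * (1 - r) \<le> 1 / 4"
    using zero_le_power2[of "r - 1/2"] by (simp add: power2_eq_square algebra_simps)
  \<comment> \<open>Uniformly in \<open>r\<close> this makes \<open>Fc\<close> at least 48, which is
    what makes all additive constants negligible against \<open>T^2\<close>.\<close>
  have dl: "4 * d \<le> 1 - sqrt lam"
  proof -
    have "4 * (r * (1 - r)) * (1 - sqrt lam) \<le> 1 * (1 - sqrt lam)"
      by (rule mult_right_mono) (use rr sl in linarith)+
    then show ?thesis by (simp only: d_def mult.assoc mult_1)
  qed
  have Q1: "1 \<le> Q"
    using eps e2 by (simp add: small_eps_def Q_def A_def s_def)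
  have sLQ: "1 \<le> s * L * Q"
  proof -
    have "eps\<^sup>2 \<le> s * s * L * A" using eps by (simp add: small_eps_def A_def s)
    then have "1 \<le> s * s * L * A / eps\<^sup>2" using e2 by simp
    then show ?thesis by (simp add: Q_def ac_simps)
  qed
  have c1: "2 \<le> c1" unfolding c1_def H_def by (rule window_const_ge_2) (use lam a eta D in auto)
  have Fc: "48 / (1 - sqrt lam) \<le> Fc"
  proof -
    have "48 / (1 - sqrt lam) \<le> 48 / (4 * d)" using dl d0 by (intro divide_left_mono) (use sl in auto)
    also have "\<dots> = 6 / d * 2" by simp
    also have "\<dots> \<le> 6 / d * c1" using c1 d0 by (intro mult_left_mono) auto
    finally show ?thesis by (simp add: Fc_def)
  qed
  have i1: "1 \<le> 1 / (1 - sqrt lam)" using sl by simp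
  have Fc48: "48 \<le> Fc" using Fc i1 by (simp add: pos_le_divide_eq)
  define T where "T = Fc * Q"
  have FT: "Fc \<le> T" using mult_left_mono[OF Q1, of Fc] Fc48 by (simp add: T_def)
  have T2: "48 * T \<le> T\<^sup>2" using FT Fc48 mult_right_mono[of 48 T T] by (simp add: power2_eq_square)
  define K where "K = nat \<lfloor>T\<^sup>2 / 9\<rfloor> + 1"
  have K: "T\<^sup>2 / 9 < real K" "real K \<le> T\<^sup>2 / 9 + 1"
    unfolding K_def by (auto simp: of_nat_nat) linarith+
  have k1: "2 / (1 - lam) < real K"
  proof -
    have "lam \<le> sqrt lam" using lam real_sqrt_le_mono[of "lam * lam" lam] mult_left_le[of lam lam] by simp
    then have "2 / (1 - lam) \<le> 2 / (1 - sqrt lam)" using lam sl by (intro divide_left_mono) auto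
    also have "\<dots> \<le> Fc"
    proof -
      have "2 / (1 - sqrt lam) \<le> 48 / (1 - sqrt lam)" using sl by (intro divide_right_mono) auto
      then show ?thesis using Fc by linarith
    qed
    finally show ?thesis using K T2 FT Fc48 by linarith
  qed
  have K0: "0 < real K" using K zero_le_power2[of T] by linarith
  have T0: "0 < T" using FT Fc48 by linarith
  have sK: "T / 3 \<le> sqrt K"
    by (rule real_le_rsqrt) (use K in \<open>simp add: power_divide\<close>)
  let ?W = "D + 2 * L * eta + 16 * sqrt (2 * pi) * H * eta / a"
  have bound: "(D + 2 * L * eta + 16 * sqrt (2 * pi) * L * s * H / a * gamma0)
       / ((1 - r) * (gamma0 / 2) * (1 - sqrt lam) * sqrt (real K)) \<le> eps\<^sup>2"
  proof -
    have "16 * sqrt (2 * pi) * L * s * H / a * gamma0 = r * (16 * sqrt (2 * pi) * H * eta / a)"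
      using s L by (simp add: g0)
    also have "\<dots> \<le> 1 * (16 * sqrt (2 * pi) * H * eta / a)"
      using r H0 eta a by (intro mult_right_mono) auto
    finally have num: "D + 2 * L * eta + 16 * sqrt (2 * pi) * L * s * H / a * gamma0 \<le> ?W" by simp
    have "2 * s * ((L / eta) * ?W) \<le> 2 * s * (c1 * A)"
      unfolding c1_def A_def using s
      by (intro mult_left_mono numerator_bound[OF L eta a D]) (use H0 in auto)
    also have "\<dots> = eps\<^sup>2 * (d * (T / 3))"
      using d0 e2 by (simp add: Fc_def Q_def T_def)
    also have "\<dots> \<le> eps\<^sup>2 * (d * sqrt K)"
      using sK d0 e2 by (intro mult_left_mono) auto
    finally have le: "2 * s * ((L / eta) * ?W) \<le> eps\<^sup>2 * (d * sqrt K)" .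
    have g: "(1 - r) * (gamma0 / 2) * (1 - sqrt lam) * sqrt (real K) * (2 * s * L) = eta * (d * sqrt K)"
      using s L by (simp add: g0 d_def field_simps)
    have "?W * (2 * s * L) = eta * (2 * s * ((L / eta) * ?W))" using eta by (simp add: field_simps)
    also have "\<dots> \<le> eta * (eps\<^sup>2 * (d * sqrt K))" using le eta by (intro mult_left_mono) auto
    also have "\<dots> = eps\<^sup>2 * (eta * (d * sqrt K))" by simp
    also have "\<dots> = eps\<^sup>2 * ((1 - r) * (gamma0 / 2) * (1 - sqrt lam) * sqrt (real K)) * (2 * s * L)"
      unfolding g[symmetric] by (simp only: mult.assoc)
    finally have "?W \<le> eps\<^sup>2 * ((1 - r) * (gamma0 / 2) * (1 - sqrt lam) * sqrt (real K))"
      by (rule mult_right_le_imp_le) (use s L in simp)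
    with num have "D + 2 * L * eta + 16 * sqrt (2 * pi) * L * s * H / a * gamma0
        \<le> eps\<^sup>2 * ((1 - r) * (gamma0 / 2) * (1 - sqrt lam) * sqrt (real K))" by (rule order_trans)
    moreover have "0 < (1 - r) * (gamma0 / 2) * (1 - sqrt lam) * sqrt (real K)"
      using r gam sl K0 by simp
    ultimately show ?thesis by (simp only: pos_divide_le_eq)
  qed
  have A2: "A\<^sup>2 \<le> 2 * ((L / eta)\<^sup>2 + (L\<^sup>2)\<^sup>2)" unfolding A_def by (rule sum_of_squares_bound)
  have steps: "real K \<le> Fc\<^sup>2 * (n * (L\<^sup>2 / eta\<^sup>2 + L^4) / eps^4)"
  proof -
    have "real K \<le> T\<^sup>2 / 2" using K T2 FT Fc48 by linarith
    also have "\<dots> = Fc\<^sup>2 * (n * A\<^sup>2 / 2 / eps^4)"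
      using s by (simp add: T_def Q_def power_mult_distrib power_divide power2_eq_square eval_nat_numeral ac_simps)
    also have "\<dots> \<le> Fc\<^sup>2 * (n * (2 * ((L / eta)\<^sup>2 + (L\<^sup>2)\<^sup>2)) / 2 / eps^4)"
      using A2 n by (intro mult_left_mono divide_right_mono) auto
    also have "\<dots> = Fc\<^sup>2 * (n * (L\<^sup>2 / eta\<^sup>2 + L^4) / eps^4)"
    proof -
      have "(L / eta)\<^sup>2 + (L\<^sup>2)\<^sup>2 = L\<^sup>2 / eta\<^sup>2 + L^4" by (simp add: power_divide flip: power_mult)
      moreover have "n * (2 * u) / 2 / w = n * u / w" for u w :: real by simp
      ultimately show ?thesis by (simp only:)
    qed
    finally show ?thesis .
  qed
  have samples: "real (\<Sum>k=0..K. nat \<lceil>a * s * L * sqrt (real k + 1)\<rceil>)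
       \<le> (a + 1) * Fc^3 * (n\<^sup>2 * (L^4 / eta^3 + L^7) / eps^6)"
  proof -
    have K4: "real K + 1 \<le> T\<^sup>2 / 4" using K T2 FT Fc48 by linarith
    have sK4: "sqrt (real K + 1) \<le> T / 2"
      by (rule real_le_lsqrt) (use K4 T0 in \<open>simp_all add: power_divide\<close>)
    have "real (\<Sum>k=0..K. nat \<lceil>a * s * L * sqrt (real k + 1)\<rceil>) \<le> (real K + 1) * (a * s * L * sqrt (real K + 1) + 1)"
      by (rule sum_batch_sqrt) (use a s L in simp)
    also have "\<dots> \<le> T\<^sup>2 / 4 * (a * s * L * T + s * L * T)"
    proof (rule mult_mono[OF K4])
      have "a * s * L * sqrt (real K + 1) \<le> a * s * L * T"
        using sK4 T0 a s L by (intro mult_left_mono) auto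
      moreover have "1 \<le> s * L * T"
      proof -
        have "1 * 1 \<le> Fc * (s * L * Q)" using Fc48 sLQ by (intro mult_mono) auto
        then show ?thesis by (simp add: T_def ac_simps)
      qed
      ultimately show "a * s * L * sqrt (real K + 1) + 1 \<le> a * s * L * T + s * L * T" by linarith
    qed (use a s L in auto)
    also have "\<dots> = (a + 1) * Fc^3 * (Q^3 * s * L / 4)"
      by (simp add: T_def power2_eq_square power3_eq_cube algebra_simps)
    also have "Q^3 * s * L / 4 \<le> n\<^sup>2 * (L^4 / eta^3 + L^7) / eps^6"
    proof -
      have "A^3 \<le> 4 * ((L / eta)^3 + (L\<^sup>2)^3)"
        unfolding A_def by (rule sum_of_cubes_bound) (use L eta in auto)
      then have "n * n * L * A^3 / 4 \<le> n * n * L * (4 * ((L / eta)^3 + (L\<^sup>2)^3)) / 4"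
        using n L by (intro divide_right_mono mult_left_mono) auto
      also have "\<dots> = n\<^sup>2 * (L^4 / eta^3 + L^7)"
        by (simp add: power_divide eval_nat_numeral algebra_simps)
      finally have "n * n * L * A^3 / 4 / eps^6 \<le> n\<^sup>2 * (L^4 / eta^3 + L^7) / eps^6"
        by (rule divide_right_mono) simp
      moreover have "Q^3 * s * L / 4 = (s * s) * (s * s) * L * A^3 / 4 / eps^6"
        by (simp add: Q_def power_divide power_mult_distrib eval_nat_numeral ac_simps)
      ultimately show ?thesis unfolding s(2) by simp
    qed
    finally show ?thesis using a Fc48 by (simp add: mult_left_mono)
  qed
  have Fc_eq: "factor_dim a lam eta0 D r = Fc"
    by (simp add: factor_dim_def Fc_def c1_def H_def d_def)
  show ?thesis
    using k1 bound steps samples unfolding Fc_eq s_def[symmetric] H_def[symmetric] r_def[symmetric, folded s_def]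
    by (intro exI[of _ K] conjI)
qed

lemma le_of_square_mean:
  fixes A B C eps :: real
  assumes "A\<^sup>2 \<le> B" "B \<le> C" "C \<le> eps\<^sup>2" "0 < eps"
  shows "A \<le> eps"
  by (rule power2_le_imp_le) (use assms in linarith)+

context zo_run
begin

section \<open>The two step-size rules along a run\<close>

abbreviation "Res K w \<equiv> residual X f eta (1 / gam0) (x (R K w) w)"

lemma n_ge_1: "1 \<le> real CARD('n)"
  by (simp add: Suc_leI)

lemma log_window_nonneg: "0 \<le> 1/2 - ln lam"
proof -
  have "ln lam \<le> 0" using lam by simp
  then show ?thesis by linarith
qed

lemma const_step_bound:
  assumes gam: "gam = (\<lambda>_. gam0)" and N: "N = (\<lambda>k. nat \<lceil>a * sqrt (real CARD('n)) * L0 * (real k + 1)\<rceil>)"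
    and a: "0 < a" and L: "0 < L0" and g: "gam0 < eta / (sqrt (real CARD('n)) * L0)" and K: "real K > 2 / (1 - lam)"
  shows "(\<integral>w. (norm (Res K w))\<^sup>2 \<partial>M)
     \<le> ((\<integral>w. f (x (first_index lam K) w) \<partial>M) - fstar + 2 * L0 * eta
          + 16 * sqrt (real CARD('n)) * sqrt (2 * pi) * L0 * (1/2 - ln lam) / a * gam0)
       / ((1 - sqrt (real CARD('n)) * L0 * gam0 / eta) * (gam0 / 4) * (1 - lam) * real K)"
proof -
  note l = first_index_less[OF lam K]
  have lK: "first_index lam K < K" using l by simp
  show ?thesis
  proof (rule const_step_arith[OF n_ge_1 L eta(1) gam0_pos g lam(2) K a _ log_window_nonneg first_index_le lK harmonic_window])
    show "0 \<le> (\<integral>w. f (x (first_index lam K) w) \<partial>M) - fstar"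
      using fstar_le_integral[of "first_index lam K"] by simp
    show "(\<integral>w. (norm (Res K w))\<^sup>2 \<partial>M) * (\<Sum>i=first_index lam K..<K. gam0)
      \<le> 2 * ((\<integral>w. f (x (first_index lam K) w) \<partial>M) - fstar + 2 * L0 * eta)
        + (pi\<^sup>2 * real CARD('n) * L0\<^sup>2) * (\<Sum>k=first_index lam K..<K. gam0 / real (N k))"
      using residual_bound(5)[OF lK] by (simp only: V_def gam)
    show "a * sqrt (real CARD('n)) * L0 * (real k + 1) \<le> real (N k)" for k
      unfolding N by (rule ceiling_batch(2))
  qed (use lam l lK first_index_ge[of lam K] in auto)
qed

lemma const_step_complexity_bound:
  assumes gam: "gam = (\<lambda>_. gam0)" and N: "N = (\<lambda>k. nat \<lceil>a * sqrt (real CARD('n)) * L0 * (real k + 1)\<rceil>)"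
    and a: "0 < a" and L: "0 < L0" and g: "gam0 < eta / (sqrt (real CARD('n)) * L0)" and g2: "gam0 = eta / (2 * sqrt (real CARD('n)) * L0)"
    and D: "\<And>K. 1 \<le> K \<Longrightarrow> (\<integral>w. f (x (first_index lam K) w) \<partial>M) - fstar \<le> D"
    and eps: "0 < eps" "small_eps (real CARD('n)) L0 eta eps"
  shows "\<exists>K. first_index lam K < K \<and>
     integrable M (\<lambda>w. norm (Res K w)) \<and>
     (\<integral>w. norm (Res K w) \<partial>M) \<le> eps \<and>
     real K \<le> factor_const a lam eta0 D * (real CARD('n) powr (1/2) * (L0 / eta + L0\<^sup>2) / eps\<^sup>2) \<and>
     real (\<Sum>k=0..K. N k)
       \<le> (a + 1) * (factor_const a lam eta0 D)\<^sup>2 * (real CARD('n) powr (3/2) * (L0^3 / eta\<^sup>2 + L0^5) / eps^4)"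
proof -
  have D0: "0 \<le> D" using fstar_le_integral[of "first_index lam 1"] D[of 1] by simp
  obtain K :: nat where K: "2 / (1 - lam) < real K"
    and Ke: "(D + 2 * L0 * eta + 16 * sqrt (real CARD('n)) * sqrt (2 * pi) * L0 * (1/2 - ln lam) / a * gam0)
      / ((1 - sqrt (real CARD('n)) * L0 * gam0 / eta) * (gam0 / 4) * (1 - lam) * real K) \<le> eps\<^sup>2"
    and Kb: "real K \<le> factor_const a lam eta0 D * (real CARD('n) powr (1/2) * (L0 / eta + L0\<^sup>2) / eps\<^sup>2)"
      "real (\<Sum>k=0..K. N k) \<le> (a + 1) * (factor_const a lam eta0 D)\<^sup>2 * (real CARD('n) powr (3/2) * (L0^3 / eta\<^sup>2 + L0^5) / eps^4)"
    using const_step_complexity[OF n_ge_1 L eta lam a D0 eps] unfolding g2 N by blast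
  have lK: "first_index lam K < K" using first_index_less[OF lam K] by simp
  have r1: "0 \<le> 1 - sqrt (real CARD('n)) * L0 * gam0 / eta" using small eta by (simp add: pos_divide_le_eq)
  have "(\<integral>w. (norm (Res K w))\<^sup>2 \<partial>M) \<le> (D + 2 * L0 * eta + 16 * sqrt (real CARD('n)) * sqrt (2 * pi) * L0 * (1/2 - ln lam) / a * gam0)
      / ((1 - sqrt (real CARD('n)) * L0 * gam0 / eta) * (gam0 / 4) * (1 - lam) * real K)"
    by (rule order_trans[OF const_step_bound[OF gam N a L g K]], intro divide_right_mono add_right_mono)
       (use D[of K] lK gam0_pos lam r1 in auto)
  from le_of_square_mean[OF residual_bound(3)[OF lK] this Ke eps(1)]
  show ?thesis using residual_bound(2)[OF lK] lK Kb by blast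
qed

lemma dim_step_bound:
  assumes gam: "gam = (\<lambda>k. gam0 / sqrt (real k + 1))"
    and N: "N = (\<lambda>k. nat \<lceil>a * sqrt (real CARD('n)) * L0 * sqrt (real k + 1)\<rceil>)"
    and a: "0 < a" and L: "0 < L0" and g: "gam0 < eta / (sqrt (real CARD('n)) * L0)" and K: "real K > 2 / (1 - lam)"
  shows "(\<integral>w. (norm (Res K w))\<^sup>2 \<partial>M)
     \<le> ((\<integral>w. f (x (first_index lam K) w) \<partial>M) - fstar + 2 * L0 * eta
          + 16 * sqrt (2 * pi) * L0 * sqrt (real CARD('n)) * (1/2 - ln lam) / a * gam0)
       / ((1 - sqrt (real CARD('n)) * L0 * gam0 / eta) * (gam0 / 2) * (1 - sqrt lam) * sqrt (real K))"
proof -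
  note l = first_index_less[OF lam K]
  have lK: "first_index lam K < K" using l by simp
  show ?thesis
  proof (rule dim_step_arith[OF n_ge_1 L eta(1) gam0_pos g lam a _ log_window_nonneg lK harmonic_window])
    show "0 \<le> (\<integral>w. f (x (first_index lam K) w) \<partial>M) - fstar"
      using fstar_le_integral[of "first_index lam K"] by simp
    show "(\<integral>w. (norm (Res K w))\<^sup>2 \<partial>M) * (\<Sum>i=first_index lam K..<K. gam0 / sqrt (real i + 1))
      \<le> 2 * ((\<integral>w. f (x (first_index lam K) w) \<partial>M) - fstar + 2 * L0 * eta)
        + (pi\<^sup>2 * real CARD('n) * L0\<^sup>2) * (\<Sum>k=first_index lam K..<K. gam0 / sqrt (real k + 1) / real (N k))"
      using residual_bound(5)[OF lK] by (simp only: V_def gam)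
    show "a * sqrt (real CARD('n)) * L0 * sqrt (real k + 1) \<le> real (N k)" for k
      unfolding N by (rule ceiling_batch(2))
    show "(\<integral>w. (norm (Res K w))\<^sup>2 \<partial>M) \<le> L0\<^sup>2" by (rule residual_bound(4)[OF lK])
  qed (use lam l lK first_index_ge[of lam K] in auto)
qed

lemma dim_step_complexity_bound:
  assumes gam: "gam = (\<lambda>k. gam0 / sqrt (real k + 1))"
    and N: "N = (\<lambda>k. nat \<lceil>a * sqrt (real CARD('n)) * L0 * sqrt (real k + 1)\<rceil>)"
    and a: "0 < a" and L: "0 < L0" and g: "gam0 < eta / (sqrt (real CARD('n)) * L0)"
    and D: "\<And>K. 1 \<le> K \<Longrightarrow> (\<integral>w. f (x (first_index lam K) w) \<partial>M) - fstar \<le> D"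
    and eps: "0 < eps" "small_eps (real CARD('n)) L0 eta eps"
  shows "\<exists>K. first_index lam K < K \<and>
     integrable M (\<lambda>w. norm (Res K w)) \<and>
     (\<integral>w. norm (Res K w) \<partial>M) \<le> eps \<and>
     real K \<le> (factor_dim a lam eta0 D (sqrt (real CARD('n)) * L0 * gam0 / eta))\<^sup>2
       * (real CARD('n) * (L0\<^sup>2 / eta\<^sup>2 + L0^4) / eps^4) \<and>
     real (\<Sum>k=0..K. N k) \<le> (a + 1) * (factor_dim a lam eta0 D (sqrt (real CARD('n)) * L0 * gam0 / eta))^3
       * ((real CARD('n))\<^sup>2 * (L0^4 / eta^3 + L0^7) / eps^6)"
proof -
  have D0: "0 \<le> D" using fstar_le_integral[of "first_index lam 1"] D[of 1] by simp
  obtain K :: nat where K: "2 / (1 - lam) < real K"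
    and Ke: "(D + 2 * L0 * eta + 16 * sqrt (2 * pi) * L0 * sqrt (real CARD('n)) * (1/2 - ln lam) / a * gam0)
      / ((1 - sqrt (real CARD('n)) * L0 * gam0 / eta) * (gam0 / 2) * (1 - sqrt lam) * sqrt (real K)) \<le> eps\<^sup>2"
    and Kb: "real K \<le> (factor_dim a lam eta0 D (sqrt (real CARD('n)) * L0 * gam0 / eta))\<^sup>2 * (real CARD('n) * (L0\<^sup>2 / eta\<^sup>2 + L0^4) / eps^4)"
      "real (\<Sum>k=0..K. N k) \<le> (a + 1) * (factor_dim a lam eta0 D (sqrt (real CARD('n)) * L0 * gam0 / eta))^3
         * ((real CARD('n))\<^sup>2 * (L0^4 / eta^3 + L0^7) / eps^6)"
    using dim_step_complexity[OF n_ge_1 L eta lam a D0 eps gam0_pos g] unfolding N by blast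
  have lK: "first_index lam K < K" using first_index_less[OF lam K] by simp
  have r1: "0 \<le> 1 - sqrt (real CARD('n)) * L0 * gam0 / eta" using small eta by (simp add: pos_divide_le_eq)
  have "(\<integral>w. (norm (Res K w))\<^sup>2 \<partial>M) \<le> (D + 2 * L0 * eta + 16 * sqrt (2 * pi) * L0 * sqrt (real CARD('n)) * (1/2 - ln lam) / a * gam0)
      / ((1 - sqrt (real CARD('n)) * L0 * gam0 / eta) * (gam0 / 2) * (1 - sqrt lam) * sqrt (real K))"
    by (rule order_trans[OF dim_step_bound[OF gam N a L g K]], intro divide_right_mono add_right_mono)
       (use D[of K] lK gam0_pos lam r1 in auto)
  from le_of_square_mean[OF residual_bound(3)[OF lK] this Ke eps(1)]
  show ?thesis using residual_bound(2)[OF lK] lK Kb by blast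
qed

end

theorem theorem3p7:
  fixes P :: "'w measure" and xi :: "'w \<Rightarrow> real^'d"
    and X :: "(real^'n) set" and ft :: "real^'n \<Rightarrow> real^'d \<Rightarrow> real" and Lt :: "real^'d \<Rightarrow> real"
    and f :: "real^'n \<Rightarrow> real" and fstar n L0 eta0 eta a lam :: real
    and M :: "'s measure" and x0 :: "real^'n"
    and xis :: "nat \<Rightarrow> nat \<Rightarrow> 's \<Rightarrow> real^'d" and vs :: "nat \<Rightarrow> nat \<Rightarrow> 's \<Rightarrow> real^'n"
    and R :: "nat \<Rightarrow> 's \<Rightarrow> nat"
  assumes problem: "zo_problem P xi X ft Lt eta0"
    and f: "f = obj P xi ft" and fstar: "fstar = (INF x\<in>X. f x)"
    and n: "n = real CARD('n)" and L0: "L0 = sqrt (\<integral>w. (Lt (xi w))\<^sup>2 \<partial>P)"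
    and eta: "0 < eta" "eta \<le> eta0" and x0: "x0 \<in> X"
    and a: "0 < a" and lam: "0 < lam" "lam < 1"
  shows
    "(\<forall>gamma.
        let N = (\<lambda>k. nat \<lceil>a * sqrt n * L0 * (real k + 1)\<rceil>);
            x = iterate X ft eta (\<lambda>_. gamma) N x0 xis vs;
            G = residual X f eta (1 / gamma);
            ell = first_index lam
        in 0 < gamma \<and> gamma < eta / (sqrt n * L0) \<and>
           vrg_zo_run P xi eta M (\<lambda>_. gamma) N lam xis vs R \<longrightarrow>
        (\<forall>K. real K > 2 / (1 - lam) \<longrightarrow>
           integrable M (\<lambda>w. f (x (ell K) w)) \<and>
           integrable M (\<lambda>w. (norm (G (x (R K w) w)))\<^sup>2) \<and>
           (\<integral>w. (norm (G (x (R K w) w)))\<^sup>2 \<partial>M)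
             \<le> ((\<integral>w. f (x (ell K) w) \<partial>M) - fstar + 2 * L0 * eta
                  + 16 * sqrt n * sqrt (2 * pi) * L0 * (1/2 - ln lam) / a * gamma)
               / ((1 - sqrt n * L0 * gamma / eta) * (gamma / 4) * (1 - lam) * real K)) \<and>
        (gamma = eta / (2 * sqrt n * L0) \<longrightarrow>
           (\<forall>D eps. (\<forall>K\<ge>1. (\<integral>w. f (x (ell K) w) \<partial>M) - fstar \<le> D) \<and>
              0 < eps \<and> small_eps n L0 eta eps \<longrightarrow>
              (\<exists>K. ell K < K \<and>
                 integrable M (\<lambda>w. norm (G (x (R K w) w))) \<and>
                 (\<integral>w. norm (G (x (R K w) w)) \<partial>M) \<le> eps \<and>
                 real K \<le> factor_const a lam eta0 D
                   * (n powr (1/2) * (L0 / eta + L0\<^sup>2) / eps\<^sup>2) \<and>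
                 real (\<Sum>k=0..K. N k) \<le> (a + 1) * (factor_const a lam eta0 D)\<^sup>2
                   * (n powr (3/2) * (L0^3 / eta\<^sup>2 + L0^5) / eps^4)))))
     \<and>
     (\<forall>gamma0.
        let gam = (\<lambda>k. gamma0 / sqrt (real k + 1));
            N = (\<lambda>k. nat \<lceil>a * sqrt n * L0 * sqrt (real k + 1)\<rceil>);
            x = iterate X ft eta gam N x0 xis vs;
            G = residual X f eta (1 / gamma0);
            ell = first_index lam;
            r = sqrt n * L0 * gamma0 / eta
        in 0 < gamma0 \<and> gamma0 < eta / (sqrt n * L0) \<and>
           vrg_zo_run P xi eta M gam N lam xis vs R \<longrightarrow>
        (\<forall>K. real K > 2 / (1 - lam) \<longrightarrow>
           integrable M (\<lambda>w. f (x (ell K) w)) \<and>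
           integrable M (\<lambda>w. (norm (G (x (R K w) w)))\<^sup>2) \<and>
           (\<integral>w. (norm (G (x (R K w) w)))\<^sup>2 \<partial>M)
             \<le> ((\<integral>w. f (x (ell K) w) \<partial>M) - fstar + 2 * L0 * eta
                  + 16 * sqrt (2 * pi) * L0 * sqrt n * (1/2 - ln lam) / a * gamma0)
               / ((1 - sqrt n * L0 * gamma0 / eta) * (gamma0 / 2) * (1 - sqrt lam) * sqrt (real K))) \<and>
        (\<forall>D eps. (\<forall>K\<ge>1. (\<integral>w. f (x (ell K) w) \<partial>M) - fstar \<le> D) \<and>
           0 < eps \<and> small_eps n L0 eta eps \<longrightarrow>
           (\<exists>K. ell K < K \<and>
              integrable M (\<lambda>w. norm (G (x (R K w) w))) \<and>
              (\<integral>w. norm (G (x (R K w) w)) \<partial>M) \<le> eps \<and>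
              real K \<le> (factor_dim a lam eta0 D r)\<^sup>2
                * (n * (L0\<^sup>2 / eta\<^sup>2 + L0^4) / eps^4) \<and>
              real (\<Sum>k=0..K. N k) \<le> (a + 1) * (factor_dim a lam eta0 D r)^3
                * (n\<^sup>2 * (L0^4 / eta^3 + L0^7) / eps^6))))"
proof -
  have n1: "1 \<le> n" unfolding n by (simp add: Suc_leI)
  have data: "zo_data P xi X ft Lt eta0 eta"
    by unfold_locales (rule problem eta)+
  have L0_eq: "zo_data.L0 P xi Lt = L0"
    unfolding zo_data.L0_def[OF data] L0 ..
  have L_nonneg: "0 \<le> L0" unfolding L0 by simp
  have positive: "0 < L0" "sqrt n * L0 * g \<le> eta" if "0 < g" "g < eta / (sqrt n * L0)" for g
  proof -
    \<comment> \<open>For \<open>L0 = 0\<close> the bound on the step would be a division by zero,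
      hence 0, and no positive step could satisfy it.\<close>
    have "L0 \<noteq> 0" using that by auto
    then show L: "0 < L0" using L_nonneg by simp
    have "0 < sqrt n * L0" using L n1 by simp
    then show "sqrt n * L0 * g \<le> eta" using that by (simp add: pos_less_divide_eq mult.commute)
  qed
  show ?thesis
    apply (intro conjI allI; unfold Let_def; rule impI; elim conjE)
    subgoal premises prems for gamma
    proof -
      note pos = positive[OF prems(1,2)]
      interpret Z: zo_run P xi X ft Lt eta0 eta M "\<lambda>_. gamma" "\<lambda>k. nat \<lceil>a * sqrt n * L0 * (real k + 1)\<rceil>"
          lam x0 xis vs R gamma
        using data prems(3) x0 lam pos unfolding n
        by (intro zo_run.intro zo_run_axioms.intro) (simp_all add: L0_eq)
      note bound = Z.const_step_bound[OF refl _ a, unfolded L0_eq, folded n f, folded fstar, OF refl pos(1) prems(2)]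
      note complexity = Z.const_step_complexity_bound[OF refl _ a, unfolded L0_eq, folded n f, folded fstar,
          OF refl pos(1) prems(2)]
      have window: "first_index lam K < K" if "2 / (1 - lam) < real K" for K
        using first_index_less[OF lam that] by simp
      show ?thesis
        apply (intro conjI allI impI)
        subgoal by (rule Z.f_integrable[folded f])
        subgoal by (rule Z.residual_bound(1)[OF window, folded f])
        subgoal by (rule bound)
        subgoal by (elim conjE, rule complexity) auto
        done
    qed
    subgoal premises prems for gamma0
    proof -
      note pos = positive[OF prems(1,2)]
      have dec: "gamma0 / sqrt (real k + 1) \<le> gamma0" for k
        using prems(1) by (simp add: divide_le_eq mult_left_le mult_le_cancel_left1)
      interpret Z: zo_run P xi X ft Lt eta0 eta M "\<lambda>k. gamma0 / sqrt (real k + 1)"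
          "\<lambda>k. nat \<lceil>a * sqrt n * L0 * sqrt (real k + 1)\<rceil>" lam x0 xis vs R gamma0
        using data prems(3) x0 lam pos dec unfolding n
        by (intro zo_run.intro zo_run_axioms.intro) (simp_all add: L0_eq)
      note bound = Z.dim_step_bound[OF refl _ a, unfolded L0_eq, folded n f, folded fstar, OF refl pos(1) prems(2)]
      note complexity = Z.dim_step_complexity_bound[OF refl _ a, unfolded L0_eq, folded n f, folded fstar,
          OF refl pos(1) prems(2)]
      have window: "first_index lam K < K" if "2 / (1 - lam) < real K" for K
        using first_index_less[OF lam that] by simp
      show ?thesis
        apply (intro conjI allI impI)
        subgoal by (rule Z.f_integrable[folded f])
        subgoal by (rule Z.residual_bound(1)[OF window, folded f])
        subgoal by (rule bound)
        subgoal by (elim conjE, rule complexity) auto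
        done
    qed
    done
qed

end
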